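(* For every $\beta\in[0,1)$ there exists $u_\beta\in H^1_{0,rad}(w_0,B)$ with $\|u_\beta\|_{w_0}\le 1$ such that $$J_\beta(u_\beta)=\sup\left\{J_\beta(u)\ :\ u\in H^1_{0,rad}(w_0,B),\ \|u\|_{w_0}\le 1\right\}.$$
   Context: $B\subset\mathbb{R}^2$ is the unit ball centered at the origin, $|B|$ its Lebesgue measure. For $\beta\in[0,1)$ the weight is $w_0(x)=|\log|x||^\beta$. $H^1_0(w_0,B)$ is the completion of $C_c^\infty(B)$ with respect to the norm $\|u\|_{w_0}=\left(\int_B|\nabla u|^2w_0\,dx\right)^{1/2}$, and $H^1_{0,rad}(w_0,B)$ is its subspace of radial functions. Set $$\alpha_\beta=2\left[2\pi(1-\beta)\right]^{\frac1{1-\beta}},\qquad J_\beta(u)=\frac1{|B|}\int_B e^{\alpha_\beta |u|^{\frac{2}{1-\beta}}}\,dx .$$ *)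

theory Defs
  imports "HOL-Analysis.Analysis"
begin

abbreviation B :: "(real ^ 2) set"
  where "B \<equiv> ball 0 1"

(* At x = 0 and, for beta = 0, at norm x = 1 the value is an artefact of
   ln 0 = 0 and 0 powr b = 0; both are null sets. *)
definition weight :: "real \<Rightarrow> real ^ 2 \<Rightarrow> real"
  where "weight \<beta> x = \<bar>ln (norm x)\<bar> powr \<beta>"

definition grad :: "(real ^ 2 \<Rightarrow> real) \<Rightarrow> real ^ 2 \<Rightarrow> real ^ 2"
  where "grad f x = (THE g. GDERIV f x :> g)"

primrec C_k :: "nat \<Rightarrow> (real ^ 2 \<Rightarrow> real) \<Rightarrow> bool"
  where
    "C_k 0 f \<longleftrightarrow> continuous_on UNIV f"
  | "C_k (Suc k) f \<longleftrightarrow>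
      (\<exists>g. (\<forall>x. GDERIV f x :> g x) \<and> (\<forall>i. C_k k (\<lambda>x. g x $ i)))"

(* Smooth functions with compact support in B, extended by zero to the plane. *)
definition test_functions :: "(real ^ 2 \<Rightarrow> real) set"
  where "test_functions =
    {f. (\<forall>k. C_k k f) \<and> compact (closure {x. f x \<noteq> 0}) \<and> closure {x. f x \<noteq> 0} \<subseteq> B}"

definition test_norm :: "real \<Rightarrow> (real ^ 2 \<Rightarrow> real) \<Rightarrow> real"
  where "test_norm \<beta> f =
    sqrt (LINT x|lebesgue_on B. (norm (grad f x))\<^sup>2 * weight \<beta> x)"

(* The completion is realised concretely as a space of functions on B (elements
   are representatives of a.e. classes; values outside B are irrelevant).
   As 1 / weight is integrable on B for 0 <= beta < 1, Cauchy-Schwarz and the Poincare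
   inequality bound the L^1 norm of f and of its gradient by a multiple of
   test_norm beta f.  So every Cauchy sequence of test functions has an L^1 limit, and
   by uniqueness of weak gradients two Cauchy sequences have the same limit a.e. iff
   their difference tends to 0 in test_norm, i.e. iff they represent the same
   element of the completion. *)
definition represents :: "real \<Rightarrow> (nat \<Rightarrow> real ^ 2 \<Rightarrow> real) \<Rightarrow> (real ^ 2 \<Rightarrow> real) \<Rightarrow> bool"
  where "represents \<beta> \<phi> u \<longleftrightarrow>
    (\<forall>n. \<phi> n \<in> test_functions) \<and>
    (\<forall>e>0. \<exists>N. \<forall>m\<ge>N. \<forall>n\<ge>N. test_norm \<beta> (\<lambda>x. \<phi> m x - \<phi> n x) < e) \<and>
    integrable (lebesgue_on B) u \<and>
    (\<lambda>n. LINT x|lebesgue_on B. \<bar>\<phi> n x - u x\<bar>) \<longlonglongrightarrow> 0"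

definition H10 :: "real \<Rightarrow> (real ^ 2 \<Rightarrow> real) set"
  where "H10 \<beta> = {u. \<exists>\<phi>. represents \<beta> \<phi> u}"

(* The norm of the completion: the limit of the norms along any representing
   Cauchy sequence. *)
definition H10_norm :: "real \<Rightarrow> (real ^ 2 \<Rightarrow> real) \<Rightarrow> real"
  where "H10_norm \<beta> u =
    (THE r. \<exists>\<phi>. represents \<beta> \<phi> u \<and> (\<lambda>n. test_norm \<beta> (\<phi> n)) \<longlonglongrightarrow> r)"

definition H10_rad :: "real \<Rightarrow> (real ^ 2 \<Rightarrow> real) set"
  where "H10_rad \<beta> = {u \<in> H10 \<beta>. \<exists>v. AE x in lebesgue_on B. u x = v (norm x)}"

definition alpha :: "real \<Rightarrow> real"
  where "alpha \<beta> = 2 * (2 * pi * (1 - \<beta>)) powr (1 / (1 - \<beta>))"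

(* Valued in [0,\<infinity>], so that a divergent integral counts as \<infinity>, not as 0. *)
definition J :: "real \<Rightarrow> (real ^ 2 \<Rightarrow> real) \<Rightarrow> ennreal"
  where "J \<beta> u =
    (\<integral>\<^sup>+ x. ennreal (exp (alpha \<beta> * \<bar>u x\<bar> powr (2 / (1 - \<beta>)))) \<partial>lebesgue_on B)
      / emeasure lebesgue B"

end

theory Submission
  imports Defs "HOL-Real_Asymp.Real_Asymp" "HOL-Complex_Analysis.Great_Picard"
begin

text \<open>With \<open>t = - 2 ln \<bar>x\<bar>\<close>, \<open>q = 1 - \<beta>\<close> and \<open>w = \<alpha>\<^sub>\<beta>\<^bsup>q/2\<^esup> u\<close>, a radial function becomes a
  profile on the half-line with energy \<open>\<integral> t\<^bsup>1-q\<^esup> w'\<^sup>2 / q dt \<le> 1\<close>, and \<open>J\<^sub>\<beta>\<close> becomes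
  \<open>\<integral> exp (\<bar>w\<bar>\<^bsup>2/q\<^esup> - t) dt\<close>. As in the argument of Carleson and Chang, along a maximising sequence of profiles
  either the pointwise limit is nonzero and the functional passes to the limit, or it is zero and the limit of
  the functional is at most \<open>1 + e\<close>; the constant \<open>e\<close> comes from the one-dimensional Onofri inequality
  \<open>ln (\<integral> exp (2 v - s) ds) \<le> 1 + \<integral> v'\<^sup>2 ds\<close>. An explicit trial profile has a value larger than
  \<open>1 + e\<close>, which excludes the second alternative. Finally the unit ball of the completion is closed
  under \<open>L\<^sup>1\<close> limits, so the limit profile is admissible.\<close>

section \<open>An Onofri inequality on the half-line\<close>

text \<open>\<open>energy\<close> is normalised so that
  \<open>\<bar>w t\<bar> powr (2 / q) \<le> t\<close>: every integrand is at most 1, a bound that is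
  not integrable on the half-line. The exponent is critical, and mass can escape to t = \<infinity>,
  the origin of the disc. Control comes from an energy budget: the value w s uses up at least
  \<open>(w s)\<^sup>2 / s powr q\<close>, and only the rest drives w after s. A nonzero limit uses
  a fixed share, which makes the decay uniform. Escaping mass needs a first large a where
  \<open>\<bar>w a\<bar> powr (2 / q)\<close> is within \<open>2 * ln a\<close> of a; there the
  power is linearised, q cancels to leading order, and the Onofri bound leaves e for every \<beta>.
  The 1 is the integral of exp (- t) from the zero limit. Approximants of a radial element need not
  be radial. Their circular means provide profiles without raising the energy, while the test
  functions themselves, close to the means in L1, are kept to place the limit in the completion. The
  supremum may a priori be infinite, so the argument runs through levels below it.\<close>

lemma continuous_on_x_ln_x: "continuous_on {0..} (\<lambda>x::real. x * ln x)"
proof -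
  have "((\<lambda>x::real. x * ln x) \<longlongrightarrow> 0) (at_right 0)"
    by real_asymp
  then have *: "continuous (at 0 within {0..}) (\<lambda>x::real. x * ln x)"
    by (simp add: continuous_within at_within_Ici_at_right)
  show ?thesis
    unfolding continuous_on_eq_continuous_within
  proof
    fix x :: real assume "x \<in> {0..}"
    show "continuous (at x within {0..}) (\<lambda>x. x * ln x)"
    proof (cases "x = 0")
      case True with * show ?thesis by simp
    next
      case False
      with \<open>x \<in> {0..}\<close> show ?thesis by (auto intro!: continuous_intros)
    qed
  qed
qed

text \<open>\<open>ln x \<le> x - 1\<close> at \<open>x = k / \<rho>\<close>. The expression is the
  pointwise density of the relative entropy of \<rho> with respect to k.\<close>

lemma mult_ln_ge:
  fixes \<rho> k \<mu> :: real
  assumes "0 < \<rho>" "0 < k"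
  shows "\<rho> * (ln \<rho> - ln k) - \<rho> + k \<ge> 0"
proof -
  have "ln (k / \<rho>) \<le> k / \<rho> - 1" using assms by (intro ln_le_minus_one) auto
  then have "\<rho> * (ln k - ln \<rho>) \<le> \<rho> * (k / \<rho> - 1)"
    using assms by (intro mult_left_mono) (auto simp: ln_div)
  also have "\<dots> = k - \<rho>" using assms by (simp add: algebra_simps)
  finally show ?thesis by (simp add: algebra_simps)
qed

text \<open>With \<open>\<rho>\<close> the normalised integrand and \<open>R\<close> its tail integral, the Gibbs variational formula and
  \<open>c v' R \<le> c\<^sup>2 v'\<^sup>2 / (4\<mu>) + \<mu> R\<^sup>2\<close> reduce the claim to the pointwise inequality
  \<open>\<rho> ln (\<rho> / k) - \<rho> + k \<ge> 0\<close> with \<open>k = \<mu> R (1 - R)\<close>; below, \<open>\<Psi>\<close> is the primitive of the resulting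
  nonnegative expression.\<close>

lemma onofri_inequality:
  fixes v v' :: "real \<Rightarrow> real" and a b c \<mu> :: real
  assumes ab: "a < b" and \<mu>: "\<mu> > 0"
    and v: "\<And>s. s \<in> {a..b} \<Longrightarrow> (v has_real_derivative v' s) (at s within {a..b})"
    and v': "continuous_on {a..b} v'" and va: "v a = 0"
  shows "integral {a..b} (\<lambda>s. exp (c * v s - \<mu> * (s - a)))
    \<le> exp (1 + c\<^sup>2 / (4 * \<mu>) * integral {a..b} (\<lambda>s. (v' s)\<^sup>2)) / \<mu>"
proof -
  define f where "f = (\<lambda>s. exp (c * v s - \<mu> * (s - a)))"
  have contv: "continuous_on {a..b} v"
    using v by (meson DERIV_continuous continuous_on_eq_continuous_within)
  have contf: "continuous_on {a..b} f"
    unfolding f_def by (intro continuous_intros contv)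
  define A where "A = (\<lambda>s. integral {a..s} f)"
  have A: "(A has_real_derivative f s) (at s within {a..b})" if "s \<in> {a..b}" for s
    unfolding A_def by (rule integral_has_real_derivative[OF contf that])
  define Z where "Z = integral {a..b} f"
  define energy_on where "energy_on = (\<lambda>s. integral {a..s} (\<lambda>s. (v' s)\<^sup>2))"
  have energy_on: "(energy_on has_real_derivative (v' s)\<^sup>2) (at s within {a..b})" if "s \<in> {a..b}" for s
    unfolding energy_on_def using that v'
    by (intro integral_has_real_derivative) (auto intro!: continuous_intros)
  have Amono: "A x < A y" if "a \<le> x" "x < y" "y \<le> b" for x y
  proof (rule DERIV_pos_imp_increasing_open[OF \<open>x < y\<close>])
    show "\<exists>y. (A has_real_derivative y) (at z) \<and> y > 0" if "x < z" "z < y" for z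
    proof -
      have "(A has_real_derivative f z) (at z)"
        using A[of z] that \<open>a \<le> x\<close> \<open>y \<le> b\<close> at_within_Icc_at[of a z b] by auto
      then show ?thesis by (auto simp: f_def)
    qed
    have "continuous_on {a..b} A" using A by (meson DERIV_continuous continuous_on_eq_continuous_within)
    then show "continuous_on {x..y} A" by (rule continuous_on_subset) (use that in auto)
  qed
  have Aa: "A a = 0" by (simp add: A_def)
  have Ab: "A b = Z" by (simp add: A_def Z_def)
  have Zpos: "Z > 0" using Amono[of a b] ab Aa Ab by auto
  define R where "R = (\<lambda>s. 1 - A s / Z)"
  have R: "(R has_real_derivative - f s / Z) (at s within {a..b})" if "s \<in> {a..b}" for s
    unfolding R_def using Zpos by (auto intro!: derivative_eq_intros A that)
  have R01: "0 < R s" "R s < 1" if "s \<in> {a<..<b}" for s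
    using Amono[of a s] Amono[of s b] that Zpos unfolding R_def Aa Ab by auto
  have R01': "0 \<le> R s" "R s \<le> 1" if "s \<in> {a..b}" for s
  proof -
    have "0 \<le> A s" "A s \<le> Z"
      using that Amono[of a s] Amono[of s b] unfolding Aa Ab
      by (metis Aa Ab atLeastAtMost_iff less_eq_real_def order_refl)+
    then show "0 \<le> R s" "R s \<le> 1" using Zpos by (auto simp: R_def)
  qed
  have Rab: "R a = 1" "R b = 0" using Zpos by (auto simp: R_def Aa Ab)
  \<comment> \<open>K is an antiderivative of \<open>1 + ln r + ln (1 - r)\<close>, the part of the
    derivative of \<open>\<Psi>\<close> in which R alone enters. Its values at R a = 1 and R b = 0
    are -1 and 0, reading 0 * ln 0 as 0; their difference is the 1 in the exponent, and thus the
    origin of e.\<close>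
  define K where "K = (\<lambda>r::real. r * ln r - (1 - r) * ln (1 - r) - r)"
  have contK: "continuous_on {0..1} K"
    unfolding K_def
    by (intro continuous_intros continuous_on_subset[OF continuous_on_x_ln_x]
        continuous_on_compose2[OF continuous_on_x_ln_x, where f="\<lambda>r. 1 - r"]) auto
  define \<Psi> where "\<Psi> = (\<lambda>s. K (R s) - R s * (c * v s - \<mu> * (s - a))
      + c\<^sup>2 / (4 * \<mu>) * energy_on s + R s * ln (\<mu> * Z))"
  have contR: "continuous_on {a..b} R" using R by (meson DERIV_continuous continuous_on_eq_continuous_within)
  have contEn: "continuous_on {a..b} energy_on" using energy_on by (meson DERIV_continuous continuous_on_eq_continuous_within)
  have cont\<Psi>: "continuous_on {a..b} \<Psi>"
    unfolding \<Psi>_def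
    by (intro continuous_intros contR contEn contv continuous_on_compose2[OF contK contR]) (use R01' in auto)
  have "\<Psi> a \<le> \<Psi> b"
  proof (rule DERIV_nonneg_imp_increasing_open[OF less_imp_le[OF ab] _ cont\<Psi>])
    fix s assume s: "a < s" "s < b"
    then have s': "s \<in> {a..b}" "s \<in> {a<..<b}" "at s within {a..b} = at s" by (auto simp: at_within_Icc_at)
    define \<rho> where "\<rho> = f s / Z"
    have \<rho>: "\<rho> > 0" using Zpos by (simp add: \<rho>_def f_def)
    have ln\<rho>: "ln \<rho> = c * v s - \<mu> * (s - a) - ln Z"
      using Zpos unfolding \<rho>_def f_def by (subst ln_div) auto
    have "(R has_real_derivative - \<rho>) (at s)"
      using R[OF s'(1)] by (simp add: s'(3) \<rho>_def)
    note d = this v[OF s'(1), unfolded s'(3)] energy_on[OF s'(1), unfolded s'(3)]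
    have "(\<Psi> has_real_derivative
       - \<rho> * (1 + ln (R s) + ln (1 - R s)) + \<rho> * (c * v s - \<mu> * (s - a)) - R s * (c * v' s - \<mu>)
       + c\<^sup>2 / (4 * \<mu>) * (v' s)\<^sup>2 - \<rho> * ln (\<mu> * Z)) (at s)"
      unfolding \<Psi>_def K_def
      apply (rule derivative_eq_intros d refl | (use R01[OF s'(2)] in simp; fail))+
      using R01[OF s'(2)] by (simp add: field_simps)
    moreover have "- \<rho> * (1 + ln (R s) + ln (1 - R s)) + \<rho> * (c * v s - \<mu> * (s - a)) - R s * (c * v' s - \<mu>)
       + c\<^sup>2 / (4 * \<mu>) * (v' s)\<^sup>2 - \<rho> * ln (\<mu> * Z) \<ge> 0" (is "?d \<ge> 0")
    proof -
      define k where "k = \<mu> * (R s * (1 - R s))"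
      have k: "k > 0" using R01[OF s'(2)] \<mu> by (simp add: k_def)
      have lnk: "ln k = ln \<mu> + ln (R s) + ln (1 - R s)"
        using R01[OF s'(2)] \<mu> by (simp add: k_def ln_mult)
      have "c\<^sup>2 / (4 * \<mu>) * (v' s)\<^sup>2 - c * R s * v' s + \<mu> * (R s)\<^sup>2 = (c * v' s / 2 - \<mu> * R s)\<^sup>2 / \<mu>"
        using \<mu> by (simp add: power2_eq_square field_simps)
      then have "c\<^sup>2 / (4 * \<mu>) * (v' s)\<^sup>2 - c * R s * v' s + \<mu> * (R s)\<^sup>2 \<ge> 0" using \<mu> by simp
      moreover have "?d = (\<rho> * (ln \<rho> - ln k) - \<rho> + \<mu> * (R s * (1 - R s))) + (c\<^sup>2 / (4 * \<mu>) * (v' s)\<^sup>2 - c * R s * v' s + \<mu> * (R s)\<^sup>2)"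
        unfolding ln\<rho> lnk using Zpos \<mu> by (simp add: ln_mult power2_eq_square algebra_simps)
      ultimately show ?thesis using mult_ln_ge[OF \<rho> k] unfolding k_def[symmetric] by linarith
    qed
    ultimately show "\<exists>y. (\<Psi> has_real_derivative y) (at s) \<and> y \<ge> 0" by blast
  qed
  \<comment> \<open>At a only K 1 = -1 and \<open>ln (\<mu> * Z)\<close> survive, because v a = 0;
    at b only the energy term survives, because R b = 0.\<close>
  then have "ln (\<mu> * Z) \<le> 1 + c\<^sup>2 / (4 * \<mu>) * energy_on b"
    unfolding \<Psi>_def by (simp add: K_def Rab va energy_on_def)
  then have "\<mu> * Z \<le> exp (1 + c\<^sup>2 / (4 * \<mu>) * energy_on b)"
    using Zpos \<mu> by (metis exp_le_cancel_iff exp_ln mult_pos_pos)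
  then show ?thesis using \<mu> unfolding Z_def energy_on_def f_def by (simp add: field_simps)
qed

section \<open>Profiles and their energy\<close>

text \<open>Concavity of the q-th power, from Young's inequality with weights q and 1 - q applied to
  y / x and 1. It supplies the tangent lines used at the concentration point.\<close>

lemma powr_tangent_le:
  fixes x y q :: real
  assumes "0 < x" "0 < y" "0 \<le> q" "q \<le> 1"
  shows "y powr q \<le> x powr q + q * x powr (q - 1) * (y - x)"
proof -
  have "(y / x) powr q * 1 powr (1 - q) \<le> q * (y / x) + (1 - q) * 1"
    using assms by (intro Youngs_inequality_0) auto
  then have "x powr q * (y / x) powr q \<le> x powr q * (1 + q * (y - x) / x)"
    using assms by (intro mult_left_mono) (auto simp: field_simps)
  also have "\<dots> = x powr q + q * x powr (q - 1) * (y - x)"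
    using assms by (simp add: powr_diff field_simps)
  finally show ?thesis using assms by (simp add: powr_divide)
qed

text \<open>Second-order Taylor expansion with a crude explicit remainder. It linearises
  \<open>\<bar>w\<bar> powr (2 / q)\<close> around a large value of w, with r = 2 / q; the base
  stays between 1/2 and 3/2.\<close>

lemma powr_quadratic_le:
  fixes r z :: real
  assumes r: "2 \<le> r" and z: "\<bar>z\<bar> \<le> 1 / 2"
  shows "(1 + z) powr r \<le> 1 + r * z + r\<^sup>2 * 2 powr r * z\<^sup>2"
proof (cases "z = 0")
  case True then show ?thesis by simp
next
  case False
  define f where "f = (\<lambda>x::real. (1 + x) powr r)"
  define f' where "f' = (\<lambda>x::real. r * (1 + x) powr (r - 1))"
  define f'' where "f'' = (\<lambda>x::real. r * (r - 1) * (1 + x) powr (r - 2))"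
  define d where "d = (\<lambda>n::nat. if n = 0 then f else if n = 1 then f' else f'')"
  have "\<exists>t. (if z < 0 then z < t \<and> t < 0 else 0 < t \<and> t < z) \<and>
      f z = (\<Sum>m<2. d m 0 / fact m * (z - 0) ^ m) + d 2 t / fact 2 * (z - 0) ^ 2"
  proof (rule Taylor[where a="-1/2" and b="1/2"])
    show "\<forall>m t. m < 2 \<and> - 1 / 2 \<le> t \<and> t \<le> 1 / 2 \<longrightarrow> (d m has_real_derivative d (Suc m) t) (at t)"
    proof (intro allI impI)
      fix m :: nat and t :: real assume "m < 2 \<and> - 1 / 2 \<le> t \<and> t \<le> 1 / 2"
      then consider "m = 0" "- 1 / 2 \<le> t" | "m = 1" "- 1 / 2 \<le> t" by linarith
      then show "(d m has_real_derivative d (Suc m) t) (at t)"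
        by cases (auto simp: d_def f_def f'_def f''_def intro!: derivative_eq_intros)
    qed
  qed (use z False in \<open>auto simp: d_def\<close>)
  then obtain t where t': "if z < 0 then z < t \<and> t < 0 else 0 < t \<and> t < z" and
    eq: "f z = (\<Sum>m<2. d m 0 / fact m * (z - 0) ^ m) + d 2 t / fact 2 * (z - 0) ^ 2"
    by blast
  from t' z have t: "\<bar>t\<bar> \<le> 1 / 2" by (auto split: if_splits)
  have "f z = 1 + r * z + r * (r - 1) * (1 + t) powr (r - 2) / 2 * z\<^sup>2"
  proof -
    have "(\<Sum>m<2. d m 0 / fact m * (z - 0) ^ m) = d 0 0 + d 1 0 * z"
      by (simp add: eval_nat_numeral)
    then have "f z = d 0 0 + d 1 0 * z + d 2 t / 2 * z\<^sup>2" using eq by simp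
    then show ?thesis by (simp add: d_def f_def f'_def f''_def)
  qed
  moreover have "r * (r - 1) * (1 + t) powr (r - 2) / 2 * z\<^sup>2 \<le> r\<^sup>2 * 2 powr r * z\<^sup>2"
  proof (rule mult_right_mono)
    have "(1 + t) powr (r - 2) \<le> 2 powr (r - 2)" using t r by (intro powr_mono2) auto
    also have "\<dots> \<le> 2 powr r" by (intro powr_mono) auto
    finally have "r * (r - 1) * (1 + t) powr (r - 2) \<le> r * r * 2 powr r"
      using r by (intro mult_mono) auto
    moreover have "0 \<le> r * r * 2 powr r" using r by simp
    ultimately show "r * (r - 1) * (1 + t) powr (r - 2) / 2 \<le> r\<^sup>2 * 2 powr r"
      unfolding power2_eq_square by linarith
  qed simp
  ultimately show ?thesis by (simp add: f_def)
qed

lemma nn_integral_indicator_has_integral: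
  fixes f :: "'a::euclidean_space \<Rightarrow> real"
  assumes nonneg: "\<And>x. x \<in> \<Omega> \<Longrightarrow> 0 \<le> f x" and I: "(f has_integral I) \<Omega>"
  shows "(\<integral>\<^sup>+x. indicator \<Omega> x * ennreal (f x) \<partial>lborel) = ennreal I"
proof -
  have "(\<integral>\<^sup>+x. indicator \<Omega> x * ennreal (f x) \<partial>lborel) = (\<integral>\<^sup>+x. ennreal (indicator \<Omega> x * f x) \<partial>lborel)"
    by (intro nn_integral_cong) (simp split: split_indicator)
  then show ?thesis using nn_integral_has_integral_lebesgue[OF nonneg I] by simp
qed

lemma nn_integral_exp_tail:
  fixes k a :: real
  assumes "0 < k"
  shows "(\<integral>\<^sup>+t. ennreal (exp (- k * t)) * indicator {a..} t \<partial>lborel) = ennreal (exp (- k * a) / k)"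
proof -
  have "(\<integral>\<^sup>+t. ennreal (exp (- k * t)) * indicator {a..} t \<partial>lborel) = ennreal (0 - (- exp (- k * a) / k))"
  proof (rule nn_integral_FTC_atLeast)
    show "((\<lambda>t. - exp (- k * t) / k) has_real_derivative exp (- k * t)) (at t)" for t
      using assms by (auto intro!: derivative_eq_intros)
    show "((\<lambda>t. - exp (- k * t) / k) \<longlongrightarrow> 0) at_top"
      using assms by real_asymp
  qed auto
  then show ?thesis by simp
qed

text \<open>Valued in [0,\<infinity>], so that a divergent integral counts as \<infinity>. The
  weight is the reciprocal of q * t powr (q - 1), the derivative of t powr q; hence reaching a value
  y at time t from 0 costs at least \<open>y\<^sup>2 / t powr q\<close>, with no further
  constant.\<close>

definition energy :: "real \<Rightarrow> (real \<Rightarrow> real) \<Rightarrow> ennreal"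
  where "energy q w' = (\<integral>\<^sup>+t. indicator {0<..} t * ennreal (t powr (1 - q) * (w' t)\<^sup>2 / q) \<partial>lborel)"

definition moser :: "real \<Rightarrow> (real \<Rightarrow> real) \<Rightarrow> ennreal"
  where "moser q w = (\<integral>\<^sup>+t. indicator {0<..} t * ennreal (exp (\<bar>w t\<bar> powr (2 / q) - t)) \<partial>lborel)"

text \<open>Differentiability is asked on the whole line: negative t stands for radii above 1, where
  test functions vanish, so one-sided derivatives at t = 0 do not arise.\<close>

definition profile :: "real \<Rightarrow> (real \<Rightarrow> real) \<Rightarrow> (real \<Rightarrow> real) \<Rightarrow> bool"
  where "profile q w w' \<longleftrightarrow> (\<forall>t. (w has_real_derivative w' t) (at t)) \<and> continuous_on UNIV w' \<and>
    w 0 = 0 \<and> energy q w' \<le> 1"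

definition energy_on :: "real \<Rightarrow> (real \<Rightarrow> real) \<Rightarrow> real \<Rightarrow> real \<Rightarrow> real"
  where "energy_on q w' a b = integral {a..b} (\<lambda>t. t powr (1 - q) * (w' t)\<^sup>2 / q)"

section \<open>Growth bounds and the energy budget of a profile\<close>

context
  fixes q :: real and w w' :: "real \<Rightarrow> real"
  assumes q: "0 < q" "q \<le> 1" and prof: "profile q w w'"
begin

lemma profile_deriv: "(w has_real_derivative w' t) (at t within S)"
  using prof unfolding profile_def by (blast intro: has_field_derivative_at_within)

lemma profile_cont': "continuous_on S w'"
  using prof unfolding profile_def by (blast intro: continuous_on_subset)

lemma profile_cont: "continuous_on S w"
  by (meson DERIV_continuous continuous_on_eq_continuous_within profile_deriv)

lemma energy_on_cont: "0 < a \<Longrightarrow> continuous_on {a..b} (\<lambda>t. t powr (1 - q) * (w' t)\<^sup>2 / q)"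
  using q by (intro continuous_intros profile_cont') auto

lemma energy_on_nonneg: "0 \<le> energy_on q w' a b"
  unfolding energy_on_def using q
  \<comment> \<open>If the integrand is not integrable on {a..b}, the integral is 0 by convention,
    so the sign holds for every a.\<close>
  by (cases "(\<lambda>t. t powr (1 - q) * (w' t)\<^sup>2 / q) integrable_on {a..b}")
    (auto intro!: Henstock_Kurzweil_Integration.integral_nonneg divide_nonneg_nonneg simp: not_integrable_integral)

lemma energy_on_add: "0 < a \<Longrightarrow> a \<le> b \<Longrightarrow> b \<le> c \<Longrightarrow> energy_on q w' a b + energy_on q w' b c = energy_on q w' a c"
  unfolding energy_on_def by (intro Henstock_Kurzweil_Integration.integral_combine integrable_continuous_real energy_on_cont) auto

lemma energy_on_le_1:
  assumes "0 < a"
  shows "energy_on q w' a b \<le> 1"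
proof -
  have "((\<lambda>t. t powr (1 - q) * (w' t)\<^sup>2 / q) has_integral energy_on q w' a b) {a..b}"
    unfolding energy_on_def using assms by (intro integrable_integral integrable_continuous_real energy_on_cont)
  then have "(\<integral>\<^sup>+t. indicator {a..b} t * ennreal (t powr (1 - q) * (w' t)\<^sup>2 / q) \<partial>lborel) = energy_on q w' a b"
    using q by (intro nn_integral_indicator_has_integral) auto
  moreover have "(\<integral>\<^sup>+t. indicator {a..b} t * ennreal (t powr (1 - q) * (w' t)\<^sup>2 / q) \<partial>lborel) \<le> energy q w'"
    unfolding energy_def using assms by (intro nn_integral_mono) (auto simp: indicator_def)
  moreover have "energy q w' \<le> 1" using prof by (simp add: profile_def)
  ultimately have "ennreal (energy_on q w' a b) \<le> 1" using order_trans by metis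
  then show ?thesis using ennreal_le_1 by blast
qed

text \<open>Weighted Cauchy-Schwarz for w' against q * t powr (q - 1), whose integral is D. It comes
  from integrating \<open>(l * x - w' t)\<^sup>2 / x \<ge> 0\<close> with x that weight and l the
  optimal multiplier.\<close>

lemma profile_increment:
  assumes ab: "0 < a" "a < b"
  shows "(w b - w a)\<^sup>2 \<le> (b powr q - a powr q) * energy_on q w' a b"
proof -
  define D where "D = b powr q - a powr q"
  have D: "D > 0" using ab q by (auto simp: D_def intro!: powr_less_mono2)
  define l where "l = (w b - w a) / D"
  have i1: "((\<lambda>t. q * t powr (q - 1)) has_integral D) {a..b}"
    unfolding D_def
    by (rule fundamental_theorem_of_calculus)
      (use ab q in \<open>auto intro!: derivative_eq_intros simp: has_real_derivative_iff_has_vector_derivative[symmetric]\<close>)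
  have i2: "(w' has_integral (w b - w a)) {a..b}"
    by (rule fundamental_theorem_of_calculus)
      (use ab profile_deriv in \<open>auto simp: has_real_derivative_iff_has_vector_derivative[symmetric]\<close>)
  have i3: "((\<lambda>t. t powr (1 - q) * (w' t)\<^sup>2 / q) has_integral energy_on q w' a b) {a..b}"
    unfolding energy_on_def using ab by (intro integrable_integral integrable_continuous_real energy_on_cont)
  have "((\<lambda>t. l\<^sup>2 * (q * t powr (q - 1)) - 2 * l * w' t + t powr (1 - q) * (w' t)\<^sup>2 / q)
     has_integral (l\<^sup>2 * D - 2 * l * (w b - w a) + energy_on q w' a b)) {a..b}"
    by (intro has_integral_add has_integral_diff has_integral_mult_right i1 i2 i3)
  moreover have "0 \<le> l\<^sup>2 * (q * t powr (q - 1)) - 2 * l * w' t + t powr (1 - q) * (w' t)\<^sup>2 / q"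
    if "t \<in> {a..b}" for t
  proof -
    define x where "x = q * t powr (q - 1)"
    have x: "x > 0" using that ab q by (simp add: x_def)
    have "t powr (1 - q) / q = 1 / x" using that ab by (simp add: x_def powr_diff field_simps)
    then have "l\<^sup>2 * (q * t powr (q - 1)) - 2 * l * w' t + t powr (1 - q) * (w' t)\<^sup>2 / q = (l * x - w' t)\<^sup>2 / x"
      using x by (simp add: x_def[symmetric] power2_eq_square field_simps)
    then show ?thesis using x by simp
  qed
  ultimately have "0 \<le> l\<^sup>2 * D - 2 * l * (w b - w a) + energy_on q w' a b"
    by (rule has_integral_nonneg)
  also have "l\<^sup>2 * D - 2 * l * (w b - w a) = - (w b - w a)\<^sup>2 / D"
    using D by (simp add: l_def power2_eq_square field_simps)
  finally show ?thesis using D unfolding D_def[symmetric] by (simp add: field_simps)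
qed

text \<open>The energy budget: reaching w s by time s uses up
  \<open>(w s)\<^sup>2 / s powr q\<close>, by \<open>profile_increment\<close> on {a..s}, and energy
  is additive over adjacent intervals. The left end a tends to 0 from the right because the weighted
  integrals are controlled only away from 0.\<close>

lemma profile_split:
  assumes st: "0 < s" "s \<le> t"
  shows "(w s)\<^sup>2 / s powr q + energy_on q w' s t \<le> 1"
proof -
  have unit_vec: "\<forall>\<^sub>F a in at_right 0. (w s - w a)\<^sup>2 / (s powr q - a powr q) + energy_on q w' s t \<le> 1"
    using eventually_at_right_less eventually_at_right_real[OF st(1)]
  proof eventually_elim
    case (elim a)
    then have a: "0 < a" "a < s" by auto
    have D: "s powr q - a powr q > 0" using a q by (auto intro!: powr_less_mono2)
    have "(w s - w a)\<^sup>2 / (s powr q - a powr q) \<le> energy_on q w' a s"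
      using profile_increment[OF a] D by (simp add: field_simps)
    moreover have "energy_on q w' a s + energy_on q w' s t \<le> 1"
      using energy_on_add[of a s t] energy_on_le_1[of a t] a st by simp
    ultimately show ?case by linarith
  qed
  have w0: "(w \<longlongrightarrow> w 0) (at_right 0)"
    using profile_cont[of UNIV] by (auto simp: continuous_on_def intro: tendsto_within_subset)
  have "((\<lambda>a. a powr q) \<longlongrightarrow> 0) (at_right 0)" using q by real_asymp
  then have "((\<lambda>a. (w s - w a)\<^sup>2 / (s powr q - a powr q) + energy_on q w' s t)
     \<longlongrightarrow> (w s - w 0)\<^sup>2 / (s powr q - 0) + energy_on q w' s t) (at_right 0)"
    using st by (intro tendsto_intros w0) auto
  from tendsto_upperbound[OF this unit_vec] show ?thesis using prof by (simp add: profile_def)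
qed

lemma profile_sq_le: "0 \<le> t \<Longrightarrow> (w t)\<^sup>2 \<le> t powr q"
  using profile_split[of t t] energy_on_nonneg[of t t] prof
  by (cases "t = 0") (auto simp: profile_def field_simps energy_on_def)

lemma profile_abs_le:
  assumes "0 \<le> t"
  shows "\<bar>w t\<bar> \<le> t powr (q / 2)"
proof -
  have "sqrt ((w t)\<^sup>2) \<le> sqrt (t powr q)" by (intro real_sqrt_le_mono profile_sq_le assms)
  also have "sqrt (t powr q) = t powr (q / 2)"
    using assms by (cases "t = 0") (auto simp: powr_half_sqrt[symmetric] powr_powr)
  finally show ?thesis by simp
qed

text \<open>Critical growth: the integrand of \<open>moser\<close> is at most 1, but a constant is
  not integrable on the half-line, so this bound alone does not allow passage to the limit.\<close>

lemma profile_powr_le: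
  assumes "0 \<le> t"
  shows "\<bar>w t\<bar> powr (2 / q) \<le> t"
proof -
  have "\<bar>w t\<bar> powr (2 / q) \<le> (t powr (q / 2)) powr (2 / q)"
    using profile_abs_le[OF assms] q by (intro powr_mono2) auto
  also have "\<dots> = t" using assms q by (simp add: powr_powr)
  finally show ?thesis .
qed

text \<open>After s only the unspent part of the unit energy is available. The estimates beyond a
  chosen point all start from here.\<close>

lemma profile_increment_split:
  assumes st: "0 < s" "s \<le> t"
  shows "(w t - w s)\<^sup>2 \<le> (t powr q - s powr q) * (1 - (w s)\<^sup>2 / s powr q)"
proof (cases "s = t")
  case False
  with st have "s < t" by simp
  have "(w t - w s)\<^sup>2 \<le> (t powr q - s powr q) * energy_on q w' s t"
    by (rule profile_increment[OF st(1) \<open>s < t\<close>])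
  also have "\<dots> \<le> (t powr q - s powr q) * (1 - (w s)\<^sup>2 / s powr q)"
    using profile_split[OF st] st q by (intro mult_left_mono) (auto intro!: powr_mono2)
  finally show ?thesis .
qed simp

text \<open>The bound is the same for all profiles; it is the equicontinuity behind the extraction
  of a convergent subsequence.\<close>

lemma profile_holder:
  assumes st: "0 \<le> s" "s \<le> t"
  shows "(w t - w s)\<^sup>2 \<le> t powr q - s powr q"
proof (cases "s = 0")
  case True
  then show ?thesis using profile_sq_le[of t] st prof by (simp add: profile_def)
next
  case False
  then have "(w t - w s)\<^sup>2 \<le> (t powr q - s powr q) * (1 - (w s)\<^sup>2 / s powr q)"
    using profile_increment_split st by auto
  also have "\<dots> \<le> (t powr q - s powr q) * 1"
    using st q by (intro mult_left_mono) (auto intro!: powr_mono2)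
  finally show ?thesis by simp
qed

end

lemma profile_minus: "profile q w w' \<Longrightarrow> profile q (\<lambda>t. - w t) (\<lambda>t. - w' t)"
  unfolding profile_def energy_def by (auto intro!: derivative_intros continuous_intros)

section \<open>The concentration level\<close>

lemma set_nn_integral_le_integral:
  fixes f :: "real \<Rightarrow> real"
  assumes "continuous_on {a..b} f" "\<And>x. x \<in> {a..b} \<Longrightarrow> 0 \<le> f x" "integral {a..b} f \<le> C"
  shows "(\<integral>\<^sup>+x. indicator {a..b} x * ennreal (f x) \<partial>lborel) \<le> ennreal C"
proof -
  have "(f has_integral integral {a..b} f) {a..b}"
    using assms by (intro integrable_integral integrable_continuous_real)
  from nn_integral_indicator_has_integral[OF assms(2) this] assms(3) show ?thesis
    by (simp add: ennreal_leI)
qed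

text \<open>If \<open>\<bar>w a\<bar> powr (2 / q)\<close> is close to its maximal value a, little
  energy is left after a. On {a..K * a} the exponent is then its linearisation at a plus a
  second-order error of at most \<open>M * \<delta> * (t - a)\<close>, which is absorbed into the
  decay rate before \<open>onofri_inequality\<close> is applied. M is the Taylor constant of
  \<open>powr_quadratic_le\<close> times the 2 * q that comes from the squared relative increment of
  w.\<close>

lemma profile_tail_near:
  fixes q :: real
  defines "M \<equiv> 2 * q * ((2 / q)\<^sup>2 * 2 powr (2 / q))"
  assumes q: "0 < q" "q \<le> 1" and prof: "profile q w w'"
    and a: "1 \<le> a" and \<eta>: "\<eta> \<le> 1 / 2" "M * \<eta> \<le> 1 / 2" and K: "1 < K" "2 * q * \<eta> * K \<le> 1 / 4"
    and wa: "\<bar>w a\<bar> powr (2 / q) \<ge> a * (1 - \<eta>)" and pos: "w a \<ge> 0"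
  shows "integral {a..K * a} (\<lambda>t. exp (\<bar>w t\<bar> powr (2 / q) - t)) \<le> exp (1 + 2 * M * a * \<eta>\<^sup>2) / (1 - M * \<eta>)"
proof -
  note P = q prof
  define r where "r = 2 / q"
  have r: "r \<ge> 2" using q by (simp add: r_def field_simps)
  have M: "M > 0" using q by (simp add: M_def)
  define W where "W = \<bar>w a\<bar> powr r"
  \<comment> \<open>The ratio of W to its maximal value a. The energy spent by time a is at least h
    powr q, so that \<open>\<delta>\<close> below bounds what remains.\<close>
  define h where "h = W / a"
  have W: "W = h * a" using a by (simp add: h_def)
  have W_le: "W \<le> a" unfolding W_def r_def using profile_powr_le[OF P] a by simp
  have h: "1 - \<eta> \<le> h" "h \<le> 1" "1 / 2 \<le> h"
  proof -
    show "1 - \<eta> \<le> h" using wa a by (simp add: h_def W_def r_def field_simps)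
    show "h \<le> 1" using W_le a by (simp add: h_def)
    show "1 / 2 \<le> h" using \<open>1 - \<eta> \<le> h\<close> \<eta> by simp
  qed
  then have Wpos: "W > 0" using a by (simp add: W)
  have wpos: "w a > 0" using Wpos pos by (cases "w a = 0") (auto simp: W_def)
  have wsq: "(w a)\<^sup>2 = h powr q * a powr q"
  proof -
    have "h powr q * a powr q = W powr q" using a h by (simp add: W powr_mult)
    also have "\<dots> = w a powr (r * q)" using wpos by (simp add: W_def powr_powr)
    also have "r * q = 2" using q by (simp add: r_def)
    finally show ?thesis using wpos by (simp add: powr_numeral)
  qed
  have hq: "h \<le> h powr q" "h powr q \<le> 1"
  proof -
    have "h powr 1 \<le> h powr q" using h q by (intro powr_mono') auto
    then show "h \<le> h powr q" using h by simp
    show "h powr q \<le> 1" using h q by (intro powr_le1) auto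
  qed
  define \<delta> where "\<delta> = 1 - h powr q"
  have \<delta>: "0 \<le> \<delta>" "\<delta> \<le> 1 - h" "\<delta> \<le> \<eta>" using hq h by (auto simp: \<delta>_def)
  have \<delta>2: "\<delta> \<le> q * h powr (q - 1) * (1 - h)"
    using powr_tangent_le[of h 1 q] h q by (simp add: \<delta>_def)
  have \<delta>_eq: "1 - (w a)\<^sup>2 / a powr q = \<delta>" using a by (simp add: wsq \<delta>_def)
  have wsq_ge: "(w a)\<^sup>2 \<ge> a powr q / 2"
  proof -
    have "h powr q * a powr q \<ge> 1 / 2 * a powr q" using hq h by (intro mult_right_mono) auto
    then show ?thesis by (simp add: wsq)
  qed
  \<comment> \<open>Slope of t powr q at a. By concavity it bounds the growth of t powr q after a,
    and since t powr (1 - q) is nondecreasing it also converts weighted into unweighted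
    energy.\<close>
  define e where "e = q * a powr (q - 1)"
  have e: "e > 0" using q a by (simp add: e_def)
  have aq: "a powr (q - 1) * a = a powr q" using a by (simp add: powr_diff)
  have v2: "(w t - w a)\<^sup>2 \<le> e * (t - a) * \<delta>" if "a \<le> t" for t
  proof -
    have "(w t - w a)\<^sup>2 \<le> (t powr q - a powr q) * \<delta>"
      using profile_increment_split[OF P, of a t] that a by (simp add: \<delta>_eq)
    also have "\<dots> \<le> e * (t - a) * \<delta>"
      using powr_tangent_le[of a t q] that a q \<delta> by (intro mult_right_mono) (auto simp: e_def)
    finally show ?thesis .
  qed
  have aK: "a < K * a" using a K by simp
  have D: "integral {a..K * a} (\<lambda>t. (w' t)\<^sup>2) \<le> e * \<delta>"
  proof -
    have "integral {a..K * a} (\<lambda>t. (w' t)\<^sup>2) \<le> integral {a..K * a} (\<lambda>t. e * (t powr (1 - q) * (w' t)\<^sup>2 / q))"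
    proof (rule integral_le)
      show "(\<lambda>t. (w' t)\<^sup>2) integrable_on {a..K * a}"
        by (intro integrable_continuous_real continuous_intros profile_cont'[OF P])
      show "(\<lambda>t. e * (t powr (1 - q) * (w' t)\<^sup>2 / q)) integrable_on {a..K * a}"
        using a by (intro integrable_continuous_real continuous_on_mult_left energy_on_cont[OF P]) auto
      fix t assume t: "t \<in> {a..K * a}"
      have "a powr (q - 1) * t powr (1 - q) \<ge> a powr (q - 1) * a powr (1 - q)"
        using t a q by (intro mult_left_mono powr_mono2) auto
      also have "a powr (q - 1) * a powr (1 - q) = 1" using a by (simp flip: powr_add)
      finally have "1 * (w' t)\<^sup>2 \<le> (a powr (q - 1) * t powr (1 - q)) * (w' t)\<^sup>2"
        by (intro mult_right_mono) auto
      then show "(w' t)\<^sup>2 \<le> e * (t powr (1 - q) * (w' t)\<^sup>2 / q)" using q by (simp add: e_def field_simps)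
    qed
    also have "\<dots> = e * energy_on q w' a (K * a)" by (simp add: energy_on_def)
    also have "\<dots> \<le> e * \<delta>"
      using profile_split[OF P, of a "K * a"] a aK e by (intro mult_left_mono) (auto simp flip: \<delta>_eq)
    finally show ?thesis .
  qed
  \<comment> \<open>c is the derivative of x powr r at x = w a, and \<open>\<mu>\<close> is the unit
    decay rate reduced by the quadratic error.\<close>
  define c where "c = r * W / w a"
  define \<mu> where "\<mu> = 1 - M * \<delta>"
  have M\<delta>: "M * \<delta> \<le> M * \<eta>" using \<delta> M by (intro mult_left_mono) auto
  then have \<mu>: "\<mu> \<ge> 1 / 2" "\<mu> \<ge> 1 - M * \<eta>" using \<eta> by (auto simp: \<mu>_def)
  have pt: "\<bar>w t\<bar> powr r - t \<le> (W - a) + (c * (w t - w a) - \<mu> * (t - a))" if t: "t \<in> {a..K * a}" for t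
  proof -
    define z where "z = (w t - w a) / w a"
    have z2: "z\<^sup>2 \<le> 2 * q * \<delta> * (t - a) / a"
    proof -
      have "z\<^sup>2 \<le> e * (t - a) * \<delta> / (w a)\<^sup>2"
        unfolding z_def power_divide using v2[of t] t wpos by (intro divide_right_mono) auto
      also have "\<dots> \<le> e * (t - a) * \<delta> / (a powr q / 2)"
        using wsq_ge t e \<delta> a wpos by (intro divide_left_mono) auto
      also have "\<dots> = 2 * q * \<delta> * (t - a) / a" using aq a by (simp add: e_def field_simps)
      finally show ?thesis .
    qed
    \<comment> \<open>K enters through t - a \<le> K * a. Together with the assumption on K this
      keeps z in the range of the Taylor estimate.\<close>
    also have "\<dots> \<le> 2 * q * \<eta> * K"
    proof -
      have "\<delta> * (t - a) \<le> \<eta> * (K * a)" using t a \<delta> K by (intro mult_mono) auto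
      then have "q * (\<delta> * (t - a)) \<le> q * (\<eta> * (K * a))" using q by (intro mult_left_mono) auto
      then show ?thesis using a by (simp add: field_simps)
    qed
    also have "\<dots> \<le> (1 / 2)\<^sup>2" using K by (simp add: power2_eq_square)
    finally have z: "\<bar>z\<bar> \<le> 1 / 2" using abs_le_square_iff[of z "1/2"] by simp
    have "w t = w a * (1 + z)" using wpos by (simp add: z_def field_simps)
    then have "\<bar>w t\<bar> = w a * (1 + z)" using wpos z by (simp add: abs_mult)
    then have "\<bar>w t\<bar> powr r = W * (1 + z) powr r" using wpos z by (simp add: W_def powr_mult)
    also have "\<dots> \<le> W * (1 + r * z + r\<^sup>2 * 2 powr r * z\<^sup>2)"
      using powr_quadratic_le[OF r z] Wpos by (intro mult_left_mono) auto
    also have "\<dots> = W + c * (w t - w a) + W * (r\<^sup>2 * 2 powr r * z\<^sup>2)"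
      using wpos by (simp add: c_def z_def field_simps)
    also have "W * (r\<^sup>2 * 2 powr r * z\<^sup>2) \<le> a * (r\<^sup>2 * 2 powr r * (2 * q * \<delta> * (t - a) / a))"
      using W_le Wpos z2 by (intro mult_mono) auto
    also have "\<dots> = M * \<delta> * (t - a)" using a by (simp add: M_def r_def)
    finally show ?thesis by (simp add: \<mu>_def algebra_simps)
  qed
  have contv: "continuous_on S w" for S by (rule profile_cont[OF P])
  have "integral {a..K * a} (\<lambda>t. exp (\<bar>w t\<bar> powr (2 / q) - t)) \<le>
      integral {a..K * a} (\<lambda>t. exp (W - a) * exp (c * (w t - w a) - \<mu> * (t - a)))"
  proof (rule integral_le)
    show "(\<lambda>t. exp (\<bar>w t\<bar> powr (2 / q) - t)) integrable_on {a..K * a}"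
      using q by (intro integrable_continuous_real continuous_intros continuous_on_powr' contv) auto
    show "(\<lambda>t. exp (W - a) * exp (c * (w t - w a) - \<mu> * (t - a))) integrable_on {a..K * a}"
      by (intro integrable_continuous_real continuous_intros contv)
    show "exp (\<bar>w t\<bar> powr (2 / q) - t) \<le> exp (W - a) * exp (c * (w t - w a) - \<mu> * (t - a))"
      if "t \<in> {a..K * a}" for t
      using pt[OF that] by (simp add: r_def flip: exp_add)
  qed
  also have "\<dots> = exp (W - a) * integral {a..K * a} (\<lambda>t. exp (c * (w t - w a) - \<mu> * (t - a)))" by simp
  also have "\<dots> \<le> exp (W - a) * (exp (1 + c\<^sup>2 / (4 * \<mu>) * integral {a..K * a} (\<lambda>t. (w' t)\<^sup>2)) / \<mu>)"
    using \<mu> by (intro mult_left_mono onofri_inequality[OF aK]) (auto intro!: derivative_eq_intros profile_deriv[OF P] profile_cont'[OF P])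
  also have "\<dots> \<le> exp (W - a) * (exp (1 + c\<^sup>2 / (4 * \<mu>) * (e * \<delta>)) / \<mu>)"
  proof -
    have "c\<^sup>2 / (4 * \<mu>) * integral {a..K * a} (\<lambda>t. (w' t)\<^sup>2) \<le> c\<^sup>2 / (4 * \<mu>) * (e * \<delta>)"
      using \<mu> by (intro mult_left_mono D) auto
    then show ?thesis using \<mu> by (intro mult_left_mono divide_right_mono) auto
  qed
  also have "\<dots> = exp (1 + (W - a + c\<^sup>2 / (4 * \<mu>) * (e * \<delta>))) / \<mu>" by (simp flip: exp_add)
  \<comment> \<open>The decisive cancellation: the energy term is at most a * h * (1 - h) / \<mu>,
    while W - a equals - a * (1 - h). What is left is a times 1 - h times (h - \<mu>) / \<mu>, and
    the last two factors are bounded by multiples of \<eta>.\<close>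
  also have "W - a + c\<^sup>2 / (4 * \<mu>) * (e * \<delta>) \<le> 2 * M * a * \<eta>\<^sup>2"
  proof -
    have "c\<^sup>2 / 4 * e * \<delta> = (a * h powr (2 - q) / q) * \<delta>"
    proof -
      have 1: "h powr (2 - q) = h\<^sup>2 / h powr q" using h by (simp add: powr_diff powr_numeral)
      have 2: "c\<^sup>2 = (2 / q)\<^sup>2 * (h * a)\<^sup>2 / (h powr q * a powr q)"
        by (simp add: c_def power_divide power_mult_distrib wsq W r_def)
      have 3: "e = q * (a powr q / a)" using aq a by (simp add: e_def field_simps)
      have "h powr q > 0" "a powr q > 0" using a h by auto
      then show ?thesis unfolding 1 2 3 using a q by (simp add: power2_eq_square field_simps)
    qed
    \<comment> \<open>The tangent bound for \<open>\<delta>\<close> is what makes q disappear,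
      because h powr (2 - q) * h powr (q - 1) = h.\<close>
    also have "\<dots> \<le> (a * h powr (2 - q) / q) * (q * h powr (q - 1) * (1 - h))"
      using \<delta>2 a q by (intro mult_left_mono) auto
    also have "\<dots> = a * (h powr (2 - q) * h powr (q - 1)) * (1 - h)" using q by simp
    also have "h powr (2 - q) * h powr (q - 1) = h" using h by (simp flip: powr_add)
    finally have 1: "c\<^sup>2 / 4 * e * \<delta> \<le> a * h * (1 - h)" .
    have "c\<^sup>2 / (4 * \<mu>) * (e * \<delta>) = (c\<^sup>2 / 4 * e * \<delta>) / \<mu>" by simp
    also have "\<dots> \<le> a * h * (1 - h) / \<mu>" using 1 \<mu> by (intro divide_right_mono) auto
    finally have "W - a + c\<^sup>2 / (4 * \<mu>) * (e * \<delta>) \<le> a * h * (1 - h) / \<mu> - a * (1 - h)"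
      by (simp add: W algebra_simps)
    also have "\<dots> = a * (1 - h) * ((h - \<mu>) / \<mu>)" using \<mu> by (simp add: field_simps)
    also have "(h - \<mu>) / \<mu> \<le> M * \<delta> / (1 / 2)"
    proof -
      have "(h - \<mu>) / \<mu> \<le> M * \<delta> / \<mu>" using h \<mu> by (intro divide_right_mono) (auto simp: \<mu>_def)
      also have "\<dots> \<le> M * \<delta> / (1 / 2)" using \<mu> M \<delta> by (intro divide_left_mono) auto
      finally show ?thesis .
    qed
    also have "M * \<delta> / (1 / 2) \<le> 2 * M * \<eta>" using M\<delta> by simp
    finally have "W - a + c\<^sup>2 / (4 * \<mu>) * (e * \<delta>) \<le> a * (1 - h) * (2 * M * \<eta>)"
      using a h by (simp add: mult_left_mono)
    also have "\<dots> \<le> a * \<eta> * (2 * M * \<eta>)" using a h M by (intro mult_right_mono mult_left_mono) auto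
    also have "\<dots> = 2 * M * a * \<eta>\<^sup>2" by (simp add: power2_eq_square)
    finally show ?thesis .
  qed
  also have "exp (1 + 2 * M * a * \<eta>\<^sup>2) / \<mu> \<le> exp (1 + 2 * M * a * \<eta>\<^sup>2) / (1 - M * \<eta>)"
    using \<mu> \<eta> by (intro divide_left_mono) auto
  finally show ?thesis using \<mu> by (simp add: divide_right_mono)
qed

text \<open>Both w a and the increment after a are at most half of (t / 2) powr (q / 2): the first
  because of the factor 4 powr (1 / q) in the lower bound for t, the second because
  \<open>\<eta> \<le> 2 powr (- q) / 4\<close>. The integrand is then at most exp (- t / 2).\<close>

lemma profile_tail_far:
  assumes q: "0 < q" "q \<le> 1" and prof: "profile q w w'"
    and a: "1 \<le> a" and \<eta>: "0 \<le> \<eta>" "\<eta> \<le> 2 powr (- q) / 4"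
    and wa: "\<bar>w a\<bar> powr (2 / q) \<ge> a * (1 - \<eta>)" and t: "2 * 4 powr (1 / q) * a \<le> t"
  shows "\<bar>w t\<bar> powr (2 / q) \<le> t / 2"
proof -
  note P = q prof
  define K where "K = 2 * 4 powr (1 / q)"
  have "1 \<le> (4::real) powr (1 / q)" using q by (intro ge_one_powr_ge_zero) auto
  then have K: "1 \<le> K" unfolding K_def by linarith
  have "1 * a \<le> K * a" using a K by (intro mult_right_mono) auto
  then have at: "a \<le> t" "0 < t" using t[folded K_def] a by linarith+
  have "2 powr (- q) \<le> (2::real) powr 0" using q by (intro powr_mono) auto
  then have \<eta>1: "\<eta> \<le> 1 / 4" using \<eta> by simp
  have "(a * (1 - \<eta>)) powr q \<le> (\<bar>w a\<bar> powr (2 / q)) powr q"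
    using wa a \<eta>1 q by (intro powr_mono2) auto
  also have "\<dots> = \<bar>w a\<bar> powr 2" using q by (simp add: powr_powr)
  also have "\<dots> = (w a)\<^sup>2" by (cases "w a = 0") (auto simp: powr_numeral)
  finally have 1: "a powr q * (1 - \<eta>) powr q \<le> (w a)\<^sup>2" using a \<eta>1 by (simp add: powr_mult)
  have "(1 - \<eta>) powr 1 \<le> (1 - \<eta>) powr q" using \<eta> \<eta>1 q by (intro powr_mono') auto
  then have "a powr q * (1 - \<eta>) \<le> a powr q * (1 - \<eta>) powr q" using \<eta>1 by (intro mult_left_mono) auto
  with 1 have "a powr q * (1 - \<eta>) \<le> (w a)\<^sup>2" by linarith
  then have \<delta>: "1 - (w a)\<^sup>2 / a powr q \<le> \<eta>" using a by (simp add: field_simps)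
  have "(w t - w a)\<^sup>2 \<le> (t powr q - a powr q) * (1 - (w a)\<^sup>2 / a powr q)"
    using profile_increment_split[OF P, of a t] a at by simp
  also have "\<dots> \<le> (t powr q - a powr q) * \<eta>"
    using \<delta> at a q by (intro mult_left_mono) (auto intro!: powr_mono2)
  also have "\<dots> \<le> t powr q * (2 powr (- q) / 4)"
    using \<eta> a by (intro mult_mono) auto
  also have "\<dots> = ((t / 2) powr (q / 2) / 2)\<^sup>2"
    using at by (simp add: power_divide powr_divide powr_minus power2_eq_square field_simps flip: powr_add)
  finally have A: "\<bar>w t - w a\<bar> \<le> (t / 2) powr (q / 2) / 2"
    by (metis abs_le_square_iff abs_of_nonneg divide_nonneg_nonneg powr_ge_zero zero_le_numeral)
  have "\<bar>w a\<bar> \<le> a powr (q / 2)" using profile_abs_le[OF P] a by simp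
  also have "\<dots> \<le> (t / K) powr (q / 2)" using t a K q unfolding K_def by (intro powr_mono2) (auto simp: field_simps)
  also have "\<dots> = (t / 2) powr (q / 2) / 2"
  proof -
    have "K powr (q / 2) = 2 powr (q / 2) * 4 powr (1 / q * (q / 2))"
      by (simp add: K_def powr_mult powr_powr)
    also have "4 powr (1 / q * (q / 2)) = (2::real)" using q by (simp add: powr_half_sqrt)
    finally show ?thesis using at K by (simp add: powr_divide)
  qed
  finally have "\<bar>w t\<bar> \<le> (t / 2) powr (q / 2)" using A by linarith
  then have "\<bar>w t\<bar> powr (2 / q) \<le> ((t / 2) powr (q / 2)) powr (2 / q)" using q by (intro powr_mono2) auto
  also have "\<dots> = t / 2" using q at by (simp add: powr_powr)
  finally show ?thesis .
qed

text \<open>The threshold a - 2 * ln a meets two demands. Below it the integrand is at most t powr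
  (-2), which is integrable; at or above it the relative deficit is at most
  \<open>\<eta> a = 2 * ln a / a\<close>, and \<open>a * (\<eta> a)\<^sup>2\<close> tends to 0,
  which removes the error in \<open>profile_tail_near\<close>.\<close>

lemma profile_tail:
  assumes q: "0 < q" "q \<le> 1" and \<epsilon>: "0 < \<epsilon>"
  obtains A where "1 \<le> A" "\<And>a w w'. A \<le> a \<Longrightarrow> profile q w w' \<Longrightarrow> a - 2 * ln a \<le> \<bar>w a\<bar> powr (2 / q) \<Longrightarrow>
    (\<integral>\<^sup>+t. indicator {a..} t * ennreal (exp (\<bar>w t\<bar> powr (2 / q) - t)) \<partial>lborel) \<le> ennreal (exp 1 + \<epsilon>)"
proof -
  define M where "M = 2 * q * ((2 / q)\<^sup>2 * 2 powr (2 / q))"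
  define K where "K = 2 * 4 powr (1 / q)"
  have "1 \<le> (4::real) powr (1 / q)" using q by (intro ge_one_powr_ge_zero) auto
  then have K: "1 < K" unfolding K_def by linarith
  define \<eta> where "\<eta> = (\<lambda>a::real. 2 * ln a / a)"
  have \<eta>0: "(\<eta> \<longlongrightarrow> 0) at_top" unfolding \<eta>_def by real_asymp
  have a\<eta>: "((\<lambda>a. a * (\<eta> a)\<^sup>2) \<longlongrightarrow> 0) at_top" unfolding \<eta>_def by real_asymp
  have "((\<lambda>a. exp (1 + 2 * M * (a * (\<eta> a)\<^sup>2)) / (1 - M * \<eta> a) + 2 * exp (- a / 2))
      \<longlongrightarrow> exp (1 + 2 * M * 0) / (1 - M * 0) + 2 * 0) at_top"
    by (intro tendsto_intros \<eta>0 a\<eta>) (auto, real_asymp)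
  then have "((\<lambda>a. exp (1 + 2 * M * a * (\<eta> a)\<^sup>2) / (1 - M * \<eta> a) + 2 * exp (- a / 2)) \<longlongrightarrow> exp 1) at_top"
    by (simp add: mult.assoc)
  then have e1: "\<forall>\<^sub>F a in at_top. exp (1 + 2 * M * a * (\<eta> a)\<^sup>2) / (1 - M * \<eta> a) + 2 * exp (- a / 2) < exp 1 + \<epsilon>"
    using \<epsilon> by (intro order_tendstoD(2)[where y="exp 1"]) auto
  have e2: "\<forall>\<^sub>F a in at_top. \<eta> a < 1 / 2" "\<forall>\<^sub>F a in at_top. \<eta> a < 2 powr (- q) / 4"
    using \<eta>0 by (intro order_tendstoD(2)[where y=0]; simp)+
  have e3: "\<forall>\<^sub>F a in at_top. M * \<eta> a < 1 / 2"
    using tendsto_mult[OF tendsto_const[of M] \<eta>0] by (intro order_tendstoD(2)[where y=0]) auto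
  have e4: "\<forall>\<^sub>F a in at_top. 2 * q * \<eta> a * K < 1 / 4"
    using tendsto_mult[OF tendsto_const[of "2 * q * K"] \<eta>0]
    by (intro order_tendstoD(2)[where y=0]) (auto simp: mult_ac)
  have "\<forall>\<^sub>F a in at_top. 1 \<le> a \<and> exp (1 + 2 * M * a * (\<eta> a)\<^sup>2) / (1 - M * \<eta> a) + 2 * exp (- a / 2) < exp 1 + \<epsilon>
     \<and> \<eta> a < 1 / 2 \<and> \<eta> a < 2 powr (- q) / 4 \<and> M * \<eta> a < 1 / 2 \<and> 2 * q * \<eta> a * K < 1 / 4"
    using eventually_ge_at_top[of 1] e1 e2 e3 e4 by eventually_elim blast
  then obtain A where A: "\<And>a. A \<le> a \<Longrightarrow> 1 \<le> a \<and> exp (1 + 2 * M * a * (\<eta> a)\<^sup>2) / (1 - M * \<eta> a) + 2 * exp (- a / 2) < exp 1 + \<epsilon>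
     \<and> \<eta> a < 1 / 2 \<and> \<eta> a < 2 powr (- q) / 4 \<and> M * \<eta> a < 1 / 2 \<and> 2 * q * \<eta> a * K < 1 / 4"
    unfolding eventually_at_top_linorder by blast
  show ?thesis
  proof (rule that)
    show "1 \<le> A" using A[of A] by simp
    fix a w w'
    assume aA: "A \<le> a" and prof: "profile q w w'" and wa: "a - 2 * ln a \<le> \<bar>w a\<bar> powr (2 / q)"
    note B = A[OF aA]
    have a: "1 \<le> a" using B by blast
    have wa': "a * (1 - \<eta> a) \<le> \<bar>w a\<bar> powr (2 / q)"
    proof -
      have "a * (1 - \<eta> a) = a - 2 * ln a" using a by (simp add: \<eta>_def right_diff_distrib)
      then show ?thesis using wa by simp
    qed
    have \<eta>p: "0 \<le> \<eta> a" using a by (simp add: \<eta>_def)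
    define f where "f = (\<lambda>t. exp (\<bar>w t\<bar> powr (2 / q) - t))"
    define C where "C = exp (1 + 2 * M * a * (\<eta> a)\<^sup>2) / (1 - M * \<eta> a)"
    have near: "integral {a..K * a} f \<le> C"
    \<comment> \<open>The near estimate is stated for a nonnegative value at a; the other sign
      follows by reflecting the profile.\<close>
    proof (cases "w a \<ge> 0")
      case True
      show ?thesis unfolding f_def C_def M_def
        using B K wa' True by (intro profile_tail_near[OF q prof a]) (auto simp: M_def)
    next
      case False
      have "integral {a..K * a} (\<lambda>t. exp (\<bar>- w t\<bar> powr (2 / q) - t)) \<le> C" unfolding C_def M_def
        using B K wa' False by (intro profile_tail_near[OF q profile_minus[OF prof] a]) (auto simp: M_def)
      then show ?thesis by (simp add: f_def)
    qed
    have contf: "continuous_on S f" for S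
      unfolding f_def using q by (intro continuous_intros continuous_on_powr' profile_cont[OF q prof]) auto
    have [measurable]: "f \<in> borel_measurable borel" using contf by (intro borel_measurable_continuous_onI)
    have "(\<integral>\<^sup>+t. indicator {a..} t * ennreal (f t) \<partial>lborel) \<le>
       (\<integral>\<^sup>+t. indicator {a..K * a} t * ennreal (f t) + ennreal (exp (- (1 / 2) * t)) * indicator {K * a..} t \<partial>lborel)"
    proof (rule nn_integral_mono)
      fix t
      have "f t \<le> exp (- (1 / 2) * t)" if "K * a \<le> t"
        using profile_tail_far[OF q prof a \<eta>p _ wa', of t] B that by (simp add: f_def K_def)
      then show "indicator {a..} t * ennreal (f t) \<le> indicator {a..K * a} t * ennreal (f t) + ennreal (exp (- (1 / 2) * t)) * indicator {K * a..} t"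
        by (auto simp: indicator_def intro: ennreal_leI)
    qed
    also have "\<dots> = (\<integral>\<^sup>+t. indicator {a..K * a} t * ennreal (f t) \<partial>lborel) + ennreal (exp (- (1 / 2) * (K * a)) / (1 / 2))"
      by (subst nn_integral_add) (auto simp: nn_integral_exp_tail[of "1 / 2", simplified])
    also have "\<dots> \<le> ennreal C + ennreal (2 * exp (- a / 2))"
    proof (rule add_mono)
      show "(\<integral>\<^sup>+t. indicator {a..K * a} t * ennreal (f t) \<partial>lborel) \<le> ennreal C"
        by (intro set_nn_integral_le_integral contf near) (auto simp: f_def)
      have "1 * a \<le> K * a" using a K by (intro mult_right_mono) auto
      then show "ennreal (exp (- (1 / 2) * (K * a)) / (1 / 2)) \<le> ennreal (2 * exp (- a / 2))"
        by (intro ennreal_leI) simp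
    qed
    also have "\<dots> = ennreal (C + 2 * exp (- a / 2))"
      using B by (intro ennreal_plus[symmetric]) (auto simp: C_def)
    also have "\<dots> \<le> ennreal (exp 1 + \<epsilon>)" using B by (intro ennreal_leI) (auto simp: C_def)
    finally show "(\<integral>\<^sup>+t. indicator {a..} t * ennreal (exp (\<bar>w t\<bar> powr (2 / q) - t)) \<partial>lborel) \<le> ennreal (exp 1 + \<epsilon>)"
      by (simp add: f_def)
  qed
qed

lemma profile_measurable:
  assumes "0 < q" "q \<le> 1" "profile q w w'"
  shows "w \<in> borel_measurable borel"
  using profile_cont[OF assms] by (intro borel_measurable_continuous_onI)

lemma tendsto_abs_powr_0:
  assumes "(f \<longlongrightarrow> l) F" "0 < (r::real)"
  shows "((\<lambda>n. \<bar>f n :: real\<bar> powr r) \<longlongrightarrow> \<bar>l\<bar> powr r) F"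
  using assms by (intro tendsto_powr' tendsto_intros) auto

text \<open>Each profile is cut at the first a \<ge> A, if any, at which it reaches the threshold a
  - 2 * ln a. Before a the integrand has a fixed integrable majorant, so this part tends to the
  integral of exp (- t), which is 1; from a on \<open>profile_tail\<close> allows at most e, up to
  \<epsilon> / 2.\<close>

lemma moser_concentration:
  assumes q: "0 < q" "q \<le> 1" and prof: "\<And>n. profile q (w n) (w' n)"
    and lim: "\<And>t. 0 < t \<Longrightarrow> (\<lambda>n. w n t) \<longlonglongrightarrow> 0" and \<epsilon>: "0 < \<epsilon>"
  shows "\<forall>\<^sub>F n in sequentially. moser q (w n) \<le> ennreal (1 + exp 1 + \<epsilon>)"
proof -
  obtain A where A: "1 \<le> A" and tail: "\<And>a w w'. A \<le> a \<Longrightarrow> profile q w w' \<Longrightarrow> a - 2 * ln a \<le> \<bar>w a\<bar> powr (2 / q) \<Longrightarrow>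
    (\<integral>\<^sup>+t. indicator {a..} t * ennreal (exp (\<bar>w t\<bar> powr (2 / q) - t)) \<partial>lborel) \<le> ennreal (exp 1 + \<epsilon> / 2)"
    using profile_tail[OF q, of "\<epsilon> / 2"] \<epsilon> by auto
  \<comment> \<open>The first two terms dominate the integrand below the threshold. The third places
    the limit exp (- t) below D, so that truncating by D does not alter the limit.\<close>
  define D :: "real \<Rightarrow> ennreal" where "D t = indicator {0..A} t + ennreal (t powr (-2)) * indicator {A..} t + ennreal (exp (- 1 * t)) * indicator {0..} t" for t
  have Dint: "(\<integral>\<^sup>+t. D t \<partial>lborel) < \<infinity>"
  proof -
    have "(\<integral>\<^sup>+t. ennreal (t powr (-2)) * indicator {A..} t \<partial>lborel) = ennreal (0 - (- (A powr (-1))))"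
    proof (rule nn_integral_FTC_atLeast)
      show "((\<lambda>t. - (t powr (-1))) has_real_derivative t powr (-2)) (at t)" if "A \<le> t" for t

      proof -
        have "- (- 1 * t powr (- 1 - 1)) = t powr (-2)" by simp
        then show ?thesis
          using DERIV_minus[OF has_real_derivative_powr[of t "-1"]] that A by (simp only:)
      qed
      show "((\<lambda>t::real. - (t powr (-1))) \<longlongrightarrow> 0) at_top" by real_asymp
    qed auto
    moreover have "(\<integral>\<^sup>+t. ennreal (exp (- 1 * t)) * indicator {0..} t \<partial>lborel) < \<infinity>"
      by (subst nn_integral_exp_tail) auto
    moreover have "(\<integral>\<^sup>+t. indicator {0..A} t \<partial>lborel) < \<infinity>" using A by simp
    ultimately show ?thesis unfolding D_def by (subst nn_integral_add; (simp add: nn_integral_add)?)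
  qed
  have [measurable]: "D \<in> borel_measurable borel" unfolding D_def by measurable
  have [measurable]: "w n \<in> borel_measurable borel" for n by (rule profile_measurable[OF q prof])
  \<comment> \<open>Truncation by D, instead of restriction to t < a, gives domination for every n
    although the cut point moves with n.\<close>
  define g where "g n t = min (D t) (indicator {0<..} t * ennreal (exp (\<bar>w n t\<bar> powr (2 / q) - t)))" for n t
  have [measurable]: "g n \<in> borel_measurable borel" for n unfolding g_def by measurable
  have "(\<lambda>n. \<integral>\<^sup>+t. g n t \<partial>lborel) \<longlonglongrightarrow> (\<integral>\<^sup>+t. indicator {0<..} t * ennreal (exp (- 1 * t)) \<partial>lborel)"
  proof (rule nn_integral_dominated_convergence[where w=D])
    show "AE t in lborel. g n t \<le> D t" for n by (simp add: g_def)
    show "AE t in lborel. (\<lambda>n. g n t) \<longlonglongrightarrow> indicator {0<..} t * ennreal (exp (- 1 * t))"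
    proof (rule AE_I2)
      fix t :: real
      show "(\<lambda>n. g n t) \<longlonglongrightarrow> indicator {0<..} t * ennreal (exp (- 1 * t))"
      proof (cases "0 < t")
        case True
        have "(\<lambda>n. \<bar>w n t\<bar> powr (2 / q)) \<longlonglongrightarrow> \<bar>0\<bar> powr (2 / q)"
          using q by (intro tendsto_abs_powr_0 lim True) auto
        then have "(\<lambda>n. ennreal (exp (\<bar>w n t\<bar> powr (2 / q) - t))) \<longlonglongrightarrow> ennreal (exp (0 - t))"
          by (intro tendsto_ennrealI tendsto_intros) auto
        then have "(\<lambda>n. min (D t) (ennreal (exp (\<bar>w n t\<bar> powr (2 / q) - t)))) \<longlonglongrightarrow> min (D t) (ennreal (exp (0 - t)))"
          by (intro tendsto_min tendsto_const)
        moreover have "ennreal (exp (0 - t)) \<le> D t"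
          using True unfolding D_def by (intro add_increasing) auto
        then have "min (D t) (ennreal (exp (0 - t))) = ennreal (exp (- t))"
          by (simp add: min.absorb2)
        ultimately show ?thesis using True by (simp add: g_def)
      qed (simp add: g_def)
    qed
  qed (use Dint in auto)
  also have "(\<integral>\<^sup>+t. indicator {0<..} t * ennreal (exp (- 1 * t)) \<partial>lborel) = (\<integral>\<^sup>+t. ennreal (exp (- 1 * t)) * indicator {0..} t \<partial>lborel)"
    by (intro nn_integral_cong_AE) (use AE_lborel_singleton[of "0::real"] in \<open>auto simp: indicator_def elim!: eventually_mono\<close>)
  also have "\<dots> = ennreal 1" by (subst nn_integral_exp_tail) auto
  finally have "\<forall>\<^sub>F n in sequentially. (\<integral>\<^sup>+t. g n t \<partial>lborel) < ennreal (1 + \<epsilon> / 2)"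
    using \<epsilon> by (intro order_tendstoD(2)[where y="ennreal 1"]) (auto simp: ennreal_less_iff)
  then show ?thesis
  proof eventually_elim
    case (elim n)
    have ptle: "exp (\<bar>w n t\<bar> powr (2 / q) - t) \<le> 1" if "0 < t" for t
      using profile_powr_le[OF q prof, of t n] that by simp
    have key: "indicator {0<..} t * ennreal (exp (\<bar>w n t\<bar> powr (2 / q) - t)) = g n t"
      if "t < A \<or> \<bar>w n t\<bar> powr (2 / q) < t - 2 * ln t" for t
    proof -
      have "indicator {0<..} t * ennreal (exp (\<bar>w n t\<bar> powr (2 / q) - t)) \<le> D t"
      proof (cases "t \<le> A")
        case True
        then show ?thesis using ptle[of t] A by (auto simp: indicator_def D_def ennreal_le_1 add_increasing2)
      next
        case False
        then have "0 < t" using A by simp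
        have "exp (\<bar>w n t\<bar> powr (2 / q) - t) \<le> exp (- 2 * ln t)" using that False by simp
        also have "\<dots> = t powr (-2)" using \<open>0 < t\<close> by (simp add: powr_def)
        finally show ?thesis using False \<open>0 < t\<close> by (auto simp: indicator_def D_def intro!: add_increasing2 ennreal_leI)
      qed
      then show ?thesis by (simp add: g_def min.absorb2)
    qed
    \<comment> \<open>The points at or above the threshold. S is closed by continuity, so its
      infimum belongs to it and \<open>profile_tail\<close> applies there.\<close>
    define S where "S = {t. A \<le> t \<and> t - 2 * ln t \<le> \<bar>w n t\<bar> powr (2 / q)}"
    show ?case
    proof (cases "S = {}")
      case True
      have "moser q (w n) = (\<integral>\<^sup>+t. g n t \<partial>lborel)"
        unfolding moser_def
      proof (intro nn_integral_cong key)
        fix t :: real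
        show "t < A \<or> \<bar>w n t\<bar> powr (2 / q) < t - 2 * ln t"
          using True unfolding S_def by (metis (mono_tags, lifting) Collect_empty_eq not_less)
      qed
      also have "\<dots> \<le> ennreal (1 + exp 1 + \<epsilon>)" using elim
        by (intro less_imp_le[OF less_le_trans[OF elim]] ennreal_leI) (use \<epsilon> in \<open>auto intro: add_mono\<close>)
      finally show ?thesis .
    next
      case False
      have "closed S"
      proof -
        have "continuous_on {A..} (\<lambda>t. \<bar>w n t\<bar> powr (2 / q) - (t - 2 * ln t))"
          using A q by (intro continuous_intros continuous_on_powr' profile_cont[OF q prof]) auto
        then have "closed {t \<in> {A..}. 0 \<le> \<bar>w n t\<bar> powr (2 / q) - (t - 2 * ln t)}"
          by (intro continuous_on_closed_Collect_le continuous_on_const) auto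
        also have "{t \<in> {A..}. 0 \<le> \<bar>w n t\<bar> powr (2 / q) - (t - 2 * ln t)} = S" by (auto simp: S_def)
        finally show ?thesis .
      qed
      moreover have bdd: "bdd_below S" by (auto simp: S_def intro!: bdd_belowI[of _ A])
      ultimately have aS: "Inf S \<in> S" using False by (intro closed_contains_Inf)
      define a where "a = Inf S"
      have lt: "t \<notin> S" if "t < a" for t using cInf_lower[OF _ bdd, of t] that by (auto simp: a_def)
      have "moser q (w n) \<le> (\<integral>\<^sup>+t. g n t + indicator {a..} t * ennreal (exp (\<bar>w n t\<bar> powr (2 / q) - t)) \<partial>lborel)"
        unfolding moser_def
      proof (rule nn_integral_mono)
        fix t
        show "indicator {0<..} t * ennreal (exp (\<bar>w n t\<bar> powr (2 / q) - t)) \<le> g n t + indicator {a..} t * ennreal (exp (\<bar>w n t\<bar> powr (2 / q) - t))"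
        proof (cases "t < a")
          case True
          then have "t < A \<or> \<bar>w n t\<bar> powr (2 / q) < t - 2 * ln t" using lt[of t] by (force simp: S_def)
          from key[OF this] show ?thesis using True by simp
        qed (auto simp: indicator_def add_increasing)
      qed
      also have "\<dots> = (\<integral>\<^sup>+t. g n t \<partial>lborel) + (\<integral>\<^sup>+t. indicator {a..} t * ennreal (exp (\<bar>w n t\<bar> powr (2 / q) - t)) \<partial>lborel)"
        by (intro nn_integral_add) auto
      also have "\<dots> \<le> ennreal (1 + \<epsilon> / 2) + ennreal (exp 1 + \<epsilon> / 2)"
        using aS by (intro add_mono less_imp_le[OF elim] tail[OF _ prof]) (auto simp: S_def a_def)
      also have "\<dots> = ennreal (1 + exp 1 + \<epsilon>)" using \<epsilon> by (simp flip: ennreal_plus)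
      finally show ?thesis .
    qed
  qed
qed

text \<open>A nonzero limit at t0 fixes a share \<open>\<kappa>\<close> of the energy that all late
  profiles have spent by time t0. What remains only allows a growth rate \<open>\<sigma> < 1\<close>
  beyond some T, so the integrands are dominated by 1 up to T and by exp (- (1 - \<sigma>) * t)
  afterwards.\<close>

lemma moser_continuity:
  assumes q: "0 < q" "q \<le> 1" and prof: "\<And>n. profile q (w n) (w' n)"
    and lim: "\<And>t. 0 < t \<Longrightarrow> (\<lambda>n. w n t) \<longlonglongrightarrow> v t" and t0: "0 < t0" "v t0 \<noteq> 0"
  shows "(\<lambda>n. moser q (w n)) \<longlonglongrightarrow> moser q v"
proof -
  \<comment> \<open>The 4 makes room for \<open>\<bar>w n t0\<bar>\<close> being only larger than
    \<open>\<bar>v t0\<bar> / 2\<close>, which holds from some N on.\<close>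
  define \<kappa> where "\<kappa> = (v t0)\<^sup>2 / 4 / t0 powr q"
  have "\<kappa> > 0" using t0 by (simp add: \<kappa>_def)
  have "(\<lambda>n. \<bar>w n t0\<bar>) \<longlonglongrightarrow> \<bar>v t0\<bar>" by (intro tendsto_intros lim t0)
  then have "\<forall>\<^sub>F n in sequentially. \<bar>v t0\<bar> / 2 < \<bar>w n t0\<bar>" using t0 by (intro order_tendstoD(1)) auto
  then obtain N where N: "\<And>n. n \<ge> N \<Longrightarrow> \<bar>v t0\<bar> / 2 < \<bar>w n t0\<bar>" by (auto simp: eventually_sequentially)
  have \<kappa>: "\<kappa> \<le> (w n t0)\<^sup>2 / t0 powr q" if "n \<ge> N" for n
  proof -
    have "(v t0 / 2)\<^sup>2 \<le> (w n t0)\<^sup>2" using N[OF that] by (subst abs_le_square_iff[symmetric]) auto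
    then show ?thesis unfolding \<kappa>_def by (intro divide_right_mono) (auto simp: power_divide)
  qed
  have "\<kappa> \<le> 1"
  proof -
    have "(w N t0)\<^sup>2 / t0 powr q \<le> 1" using profile_sq_le[OF q prof, of t0 N] t0 by (simp add: field_simps)
    then show ?thesis using \<kappa>[of N] by linarith
  qed
  define \<theta> where "\<theta> = sqrt (1 - \<kappa>)"
  have \<theta>: "0 \<le> \<theta>" "\<theta> < 1" using \<open>\<kappa> > 0\<close> \<open>\<kappa> \<le> 1\<close> by (auto simp: \<theta>_def)
  \<comment> \<open>The increment after t0 contributes the factor \<open>\<theta>\<close>, and for t
    \<ge> T the value at t0 fits into the factor (1 - \<theta>) / 2; the sum (1 + \<theta>) / 2 is
    still below 1. T is chosen to make this fit.\<close>
  define \<sigma> where "\<sigma> = ((1 + \<theta>) / 2) powr (2 / q)"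
  have \<sigma>: "0 \<le> \<sigma>" "\<sigma> < 1"
    using \<theta> q powr_less_mono2[of "2 / q" "(1 + \<theta>) / 2" 1] by (auto simp: \<sigma>_def)
  define T where "T = t0 * (2 / (1 - \<theta>)) powr (2 / q)"
  have T: "t0 \<le> T"
  proof -
    have "1 \<le> (2 / (1 - \<theta>)) powr (2 / q)" using \<theta> q by (intro ge_one_powr_ge_zero) auto
    then have "t0 * 1 \<le> T" unfolding T_def using t0 by (intro mult_left_mono) auto
    then show ?thesis by simp
  qed
  have far: "\<bar>w n t\<bar> powr (2 / q) \<le> \<sigma> * t" if n: "n \<ge> N" and t: "T \<le> t" for n t
  proof -
    have t': "t0 \<le> t" "0 < t" using t T t0 by auto
    have "(w n t - w n t0)\<^sup>2 \<le> (t powr q - t0 powr q) * (1 - (w n t0)\<^sup>2 / t0 powr q)"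
      using profile_increment_split[OF q prof, of t0 t] t0 t' by simp
    also have "\<dots> \<le> (t powr q - t0 powr q) * (1 - \<kappa>)"
      using \<kappa>[OF n] t' t0 q by (intro mult_left_mono) (auto intro!: powr_mono2)
    also have "\<dots> \<le> t powr q * (1 - \<kappa>)" using \<open>\<kappa> \<le> 1\<close> by (intro mult_right_mono) auto
    also have "\<dots> = (\<theta> * t powr (q / 2))\<^sup>2"
      using \<open>\<kappa> \<le> 1\<close> t' by (simp add: \<theta>_def power_mult_distrib power2_eq_square mult_ac flip: powr_add)
    finally have 1: "\<bar>w n t - w n t0\<bar> \<le> \<theta> * t powr (q / 2)"
      using \<theta> by (subst (asm) abs_le_square_iff[symmetric]) (auto simp: abs_mult)
    have "\<bar>w n t0\<bar> \<le> t0 powr (q / 2)" using profile_abs_le[OF q prof] t0 by simp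
    also have "\<dots> \<le> (1 - \<theta>) / 2 * t powr (q / 2)"
    proof -
      have "t0 powr (q / 2) * (2 / (1 - \<theta>)) = T powr (q / 2)"
        unfolding T_def using t0 \<theta> q by (simp add: powr_mult powr_powr)
      also have "\<dots> \<le> t powr (q / 2)" using T t t0 q by (intro powr_mono2) auto
      finally show ?thesis using \<theta> by (simp add: field_simps)
    qed
    finally have "\<bar>w n t\<bar> \<le> \<theta> * t powr (q / 2) + (1 - \<theta>) / 2 * t powr (q / 2)" using 1 by linarith
    also have "\<dots> = (1 + \<theta>) / 2 * t powr (q / 2)" by (simp add: field_simps)
    finally have "\<bar>w n t\<bar> powr (2 / q) \<le> ((1 + \<theta>) / 2 * t powr (q / 2)) powr (2 / q)"
      using q by (intro powr_mono2) auto
    also have "\<dots> = \<sigma> * (t powr (q / 2)) powr (2 / q)" unfolding \<sigma>_def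
      by (rule powr_mult)
    also have "\<dots> = \<sigma> * t" using t' q by (simp add: powr_powr)
    finally show ?thesis .
  qed
  define D :: "real \<Rightarrow> ennreal" where "D t = indicator {0..T} t + ennreal (exp (- (1 - \<sigma>) * t)) * indicator {T..} t" for t
  have [measurable]: "w n \<in> borel_measurable borel" for n by (rule profile_measurable[OF q prof])
  have [measurable]: "D \<in> borel_measurable borel" unfolding D_def by measurable
  have Dint: "(\<integral>\<^sup>+t. D t \<partial>lborel) < \<infinity>"
    unfolding D_def using \<sigma> T t0 by (subst nn_integral_add) (auto simp: nn_integral_exp_tail[of "1 - \<sigma>", simplified] less_top)
  \<comment> \<open>Convergence is assumed for t > 0 only, so measurability is established for the
    limit set to 0 elsewhere.\<close>
  define V where "V t = (if 0 < t then v t else 0)" for t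
  have Vlim: "(\<lambda>n. indicator {0<..} t * w n t) \<longlonglongrightarrow> V t" for t
    using lim[of t] by (cases "0 < t") (auto simp: V_def)
  have [measurable]: "V \<in> borel_measurable borel"
    by (rule borel_measurable_LIMSEQ_real[OF Vlim]) measurable
  have "(\<lambda>n. moser q (w (n + N))) \<longlonglongrightarrow> moser q V"
    unfolding moser_def
  proof (rule nn_integral_dominated_convergence[where w=D])
    show "AE t in lborel. indicator {0<..} t * ennreal (exp (\<bar>w (n + N) t\<bar> powr (2 / q) - t)) \<le> D t" for n
    proof (rule AE_I2)
      fix t :: real
      consider "t \<le> 0" | "0 < t" "t \<le> T" | "T < t" "0 < t" by linarith
      then show "indicator {0<..} t * ennreal (exp (\<bar>w (n + N) t\<bar> powr (2 / q) - t)) \<le> D t"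
      proof cases
        case 2
        then show ?thesis using profile_powr_le[OF q prof, of t "n + N"]
          by (auto simp: D_def indicator_def ennreal_le_1 intro!: add_increasing2)
      next
        case 3
        then show ?thesis using far[of "n + N" t]
          by (auto simp: D_def indicator_def algebra_simps intro!: add_increasing ennreal_leI)
      qed simp
    qed
    show "AE t in lborel. (\<lambda>n. indicator {0<..} t * ennreal (exp (\<bar>w (n + N) t\<bar> powr (2 / q) - t)))
        \<longlonglongrightarrow> indicator {0<..} t * ennreal (exp (\<bar>V t\<bar> powr (2 / q) - t))"
    proof (rule AE_I2)
      fix t :: real
      show "(\<lambda>n. indicator {0<..} t * ennreal (exp (\<bar>w (n + N) t\<bar> powr (2 / q) - t)))
        \<longlonglongrightarrow> indicator {0<..} t * ennreal (exp (\<bar>V t\<bar> powr (2 / q) - t))"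
      proof (cases "0 < t")
        case True
        have "(\<lambda>n. w (n + N) t) \<longlonglongrightarrow> v t" using lim[OF True] by (rule LIMSEQ_ignore_initial_segment)
        then have "(\<lambda>n. ennreal (exp (\<bar>w (n + N) t\<bar> powr (2 / q) - t))) \<longlonglongrightarrow> ennreal (exp (\<bar>v t\<bar> powr (2 / q) - t))"
          using q by (intro tendsto_ennrealI tendsto_intros tendsto_abs_powr_0) auto
        then show ?thesis using True by (simp add: V_def)
      qed simp
    qed
  qed (use Dint in auto)
  also have "moser q V = moser q v" unfolding moser_def by (intro nn_integral_cong) (auto simp: V_def indicator_def)
  finally show ?thesis by (rule LIMSEQ_offset)
qed

section \<open>Test functions, radial integrals and rotations\<close>

lemma C_k_SucD: "C_k (Suc k) f \<Longrightarrow> C_k k f"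
proof (induction k arbitrary: f)
  case 0
  then obtain g where "\<And>x. GDERIV f x :> g x" by auto
  then have "continuous_on UNIV f"
    unfolding gderiv_def by (intro has_derivative_continuous_on) auto
  then show ?case by simp
next
  case (Suc k)
  from Suc.prems obtain g where g: "\<And>x. GDERIV f x :> g x" "\<And>i. C_k (Suc k) (\<lambda>x. g x $ i)"
    by (subst (asm) C_k.simps(2)) blast
  then have "C_k k (\<lambda>x. g x $ i)" for i by (intro Suc.IH) blast
  with g(1) show ?case by auto
qed

lemma C_k_SucI: "(\<And>x. GDERIV f x :> g x) \<Longrightarrow> (\<And>i. C_k k (\<lambda>x. g x $ i)) \<Longrightarrow> C_k (Suc k) f"
  by auto

lemma GDERIV_linear:
  assumes "GDERIV f x :> f'" "GDERIV g x :> g'"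
  shows "GDERIV (\<lambda>x. a * f x + b * g x) x :> a *\<^sub>R f' + b *\<^sub>R g'"
  using assms unfolding gderiv_def
  by (auto intro!: derivative_eq_intros simp: inner_add_right algebra_simps)

lemma C_k_linear: "C_k k f \<Longrightarrow> C_k k g \<Longrightarrow> C_k k (\<lambda>x. a * f x + b * g x)"
proof (induction k arbitrary: f g)
  case 0
  then show ?case by (auto intro!: continuous_intros)
next
  case (Suc k)
  obtain f' where f: "\<And>x. GDERIV f x :> f' x" "\<And>i. C_k k (\<lambda>x. f' x $ i)" using Suc.prems by auto
  obtain g' where g: "\<And>x. GDERIV g x :> g' x" "\<And>i. C_k k (\<lambda>x. g' x $ i)" using Suc.prems by auto
  have "GDERIV (\<lambda>x. a * f x + b * g x) x :> a *\<^sub>R f' x + b *\<^sub>R g' x" for x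
    by (intro GDERIV_linear f g)
  moreover have "C_k k (\<lambda>x. (a *\<^sub>R f' x + b *\<^sub>R g' x) $ i)" for i
    using Suc.IH[OF f(2) g(2), of i i] by simp
  ultimately show ?case by (rule C_k_SucI)
qed

lemma C_k_mult: "C_k k f \<Longrightarrow> C_k k g \<Longrightarrow> C_k k (\<lambda>x. f x * g x)"
proof (induction k arbitrary: f g)
  case 0
  then show ?case by (auto intro!: continuous_intros)
next
  case (Suc k)
  obtain f' where f: "\<And>x. GDERIV f x :> f' x" "\<And>i. C_k k (\<lambda>x. f' x $ i)" using Suc.prems by auto
  obtain g' where g: "\<And>x. GDERIV g x :> g' x" "\<And>i. C_k k (\<lambda>x. g' x $ i)" using Suc.prems by auto
  have "GDERIV (\<lambda>x. f x * g x) x :> f x *\<^sub>R g' x + g x *\<^sub>R f' x" for x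
    by (rule GDERIV_mult[OF f(1) g(1)])
  moreover have "C_k k (\<lambda>x. (f x *\<^sub>R g' x + g x *\<^sub>R f' x) $ i)" for i
  proof -
    have "C_k k (\<lambda>x. f x * g' x $ i)" "C_k k (\<lambda>x. g x * f' x $ i)"
      using Suc.IH[OF C_k_SucD[OF Suc.prems(1)] g(2)] Suc.IH[OF C_k_SucD[OF Suc.prems(2)] f(2)] by auto
    from C_k_linear[OF this, of 1 1] show ?thesis by simp
  qed
  ultimately show ?case by (rule C_k_SucI)
qed

lemma GDERIV_unique: "GDERIV f x :> a \<Longrightarrow> GDERIV f x :> b \<Longrightarrow> a = b"
proof -
  assume "GDERIV f x :> a" "GDERIV f x :> b"
  then have "(\<lambda>h. h \<bullet> a) = (\<lambda>h. h \<bullet> b)"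
    unfolding gderiv_def by (rule has_derivative_unique)
  then have "\<forall>h. h \<bullet> a = h \<bullet> b" by (simp add: fun_eq_iff)
  then show "a = b" by (simp only: vector_eq_ldot)
qed

lemma grad_eq: "GDERIV f x :> g \<Longrightarrow> grad f x = g"
  unfolding grad_def by (blast intro: GDERIV_unique)

lemma test_GDERIV:
  assumes "f \<in> test_functions"
  shows "GDERIV f x :> grad f x"
proof -
  have "C_k (Suc 0) f" using assms unfolding test_functions_def by blast
  then obtain g where "\<And>x. GDERIV f x :> g x" by auto
  then show ?thesis using grad_eq[of f x "g x"] by simp
qed

lemma test_grad_C_k:
  assumes "f \<in> test_functions"
  shows "C_k k (\<lambda>x. grad f x $ i)"
proof -
  have "C_k (Suc k) f" using assms unfolding test_functions_def by blast
  then obtain g where g: "\<And>x. GDERIV f x :> g x" "\<And>i. C_k k (\<lambda>x. g x $ i)" by auto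
  then have "grad f = g" using grad_eq by blast
  with g show ?thesis by simp
qed

lemma test_continuous: "f \<in> test_functions \<Longrightarrow> continuous_on S f"
proof -
  assume "f \<in> test_functions"
  then have "C_k 0 f" unfolding test_functions_def by blast
  then show ?thesis by (auto intro: continuous_on_subset)
qed

lemma test_grad_continuous: "f \<in> test_functions \<Longrightarrow> continuous_on S (grad f)"
proof -
  assume f: "f \<in> test_functions"
  have "continuous_on UNIV (\<lambda>x. grad f x $ i)" for i using test_grad_C_k[OF f, of 0 i] by simp
  then have "continuous_on UNIV (\<lambda>x. \<chi> i. grad f x $ i)" by (intro continuous_on_vec_lambda)
  then show ?thesis by (auto intro: continuous_on_subset)
qed

lemma test_linear:
  assumes "f \<in> test_functions" "g \<in> test_functions"
  shows "(\<lambda>x. a * f x + b * g x) \<in> test_functions"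
proof -
  define h where "h = (\<lambda>x. a * f x + b * g x)"
  define F where "F = closure {x. f x \<noteq> 0}"
  define G where "G = closure {x. g x \<noteq> 0}"
  have f: "\<forall>k. C_k k f" "compact F" "F \<subseteq> B" and g: "\<forall>k. C_k k g" "compact G" "G \<subseteq> B"
    using assms by (simp_all add: test_functions_def F_def G_def del: C_k.simps)
  have "{x. h x \<noteq> 0} \<subseteq> {x. f x \<noteq> 0} \<union> {x. g x \<noteq> 0}" by (auto simp: h_def)
  then have sub: "closure {x. h x \<noteq> 0} \<subseteq> F \<union> G"
    unfolding F_def G_def closure_Un[symmetric] by (rule closure_mono)
  have "compact ((F \<union> G) \<inter> closure {x. h x \<noteq> 0})"
    using f g by (intro compact_Int_closed compact_Un) auto
  then have "compact (closure {x. h x \<noteq> 0})" using sub by (simp add: inf.absorb2)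
  moreover have "\<forall>k. C_k k h"
    using f g C_k_linear unfolding h_def by blast
  moreover have "closure {x. h x \<noteq> 0} \<subseteq> B" using sub f(3) g(3) by blast
  ultimately have "h \<in> test_functions" unfolding test_functions_def mem_Collect_eq by blast
  then show ?thesis by (simp add: h_def)
qed

lemma test_grad_linear:
  assumes "f \<in> test_functions" "g \<in> test_functions"
  shows "grad (\<lambda>x. a * f x + b * g x) x = a *\<^sub>R grad f x + b *\<^sub>R grad g x"
  by (intro grad_eq GDERIV_linear test_GDERIV assms)

lemma test_diff:
  assumes "f \<in> test_functions" "g \<in> test_functions"
  shows "(\<lambda>x. f x - g x) \<in> test_functions"
  using test_linear[OF assms, of 1 "-1"] by simp

lemma test_support:
  assumes "f \<in> test_functions"
  obtains \<rho> where "0 < \<rho>" "\<rho> < 1" "\<And>x. \<rho> < norm x \<Longrightarrow> f x = 0" "\<And>x. \<rho> < norm x \<Longrightarrow> grad f x = 0"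
proof -
  let ?S = "closure {x. f x \<noteq> 0}"
  have S: "compact ?S" "?S \<subseteq> B" using assms unfolding test_functions_def by auto
  obtain \<rho> where \<rho>: "0 < \<rho>" "\<rho> < 1" "\<And>x. x \<in> ?S \<Longrightarrow> norm x \<le> \<rho>"
  proof (cases "?S = {}")
    case True
    then show ?thesis using that[of "1/2"] by auto
  next
    case False
    obtain y where y: "y \<in> ?S" "\<And>x. x \<in> ?S \<Longrightarrow> norm x \<le> norm y"
      using continuous_attains_sup[OF S(1) False, of norm] by (auto intro: continuous_intros)
    have "norm y < 1" using y S by auto
    show ?thesis
      by (rule that[of "max (1/2) (norm y)"]) (use y \<open>norm y < 1\<close> in \<open>auto simp: le_max_iff_disj\<close>)
  qed
  have z: "f x = 0" if "\<rho> < norm x" for x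
    using \<rho>(3)[of x] that closure_subset[of "{x. f x \<noteq> 0}"] by force
  have "grad f x = 0" if "\<rho> < norm x" for x
  proof (rule grad_eq)
    have "open {x :: real^2. \<rho> < norm x}" by (intro open_Collect_less continuous_intros)
    then have "(f has_derivative (\<lambda>h. 0)) (at x)"
      by (rule has_derivative_transform_within_open[OF has_derivative_const[of 0 "at x"]]) (use that z in auto)
    then show "GDERIV f x :> 0" by (simp add: gderiv_def)
  qed
  with \<rho> z that show ?thesis by blast
qed

lemma test_bounded:
  assumes "f \<in> test_functions"
  obtains C where "0 < C" "\<And>x. \<bar>f x\<bar> \<le> C" "\<And>x. norm (grad f x) \<le> C"
proof -
  obtain \<rho> where \<rho>: "0 < \<rho>" "\<rho> < 1" "\<And>x. \<rho> < norm x \<Longrightarrow> f x = 0" "\<And>x. \<rho> < norm x \<Longrightarrow> grad f x = 0"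
    by (rule test_support[OF assms]) (rule that)
  have "bounded (f ` cball 0 \<rho>)" "bounded (grad f ` cball 0 \<rho>)"
    by (intro compact_imp_bounded compact_continuous_image test_continuous test_grad_continuous assms; simp)+
  then obtain C1 C2 where C: "\<And>x. x \<in> cball 0 \<rho> \<Longrightarrow> norm (f x) \<le> C1" "\<And>x. x \<in> cball 0 \<rho> \<Longrightarrow> norm (grad f x) \<le> C2"
    unfolding bounded_iff by blast
  show ?thesis
  proof (rule that[of "max 1 (max C1 C2)"])
    show "\<bar>f x\<bar> \<le> max 1 (max C1 C2)" for x
      using C(1)[of x] \<rho>(3)[of x] by (cases "norm x \<le> \<rho>") (auto simp: not_le le_max_iff_disj)
    show "norm (grad f x) \<le> max 1 (max C1 C2)" for x
      using C(2)[of x] \<rho>(4)[of x] by (cases "norm x \<le> \<rho>") (auto simp: not_le le_max_iff_disj)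
  qed auto
qed

section \<open>Polar coordinates in the variable -2 ln |x|\<close>

lemma sets_B [measurable]: "B \<in> sets borel"
  by (intro borel_open open_ball)

text \<open>The image of planar measure on B under -2 * ln (norm x) has density pi * exp (- t) on
  the positive half-line. Both measures are finite on the rays {a<..} and determined by their values
  there, and on a ray the claim is the area of a disc of radius exp (- a / 2), or of B itself if a
  is negative.\<close>

lemma nn_integral_ball_radial:
  assumes [measurable]: "H \<in> borel_measurable borel"
  shows "(\<integral>\<^sup>+x. indicator B x * H (- 2 * ln (norm x)) \<partial>lborel)
    = ennreal pi * (\<integral>\<^sup>+t. indicator {0<..} t * (ennreal (exp (- t)) * H t) \<partial>lborel)"
proof -
  define T where "T = (\<lambda>x::real^2. - 2 * ln (norm x))"
  have [measurable]: "T \<in> borel_measurable borel" unfolding T_def by measurable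
  define M where "M = distr (density lborel (indicator B)) borel T"
  define N where "N = density lborel (\<lambda>t::real. ennreal pi * (indicator {0<..} t * ennreal (exp (- t))))"
  have eN: "emeasure N {a<..} = ennreal (pi * exp (- max a 0))" for a
  proof -
    have "emeasure N {a<..} = (\<integral>\<^sup>+t. ennreal pi * (ennreal (exp (- 1 * t)) * indicator {max a 0..} t) \<partial>lborel)"
      unfolding N_def
      by (subst emeasure_density, simp, simp, intro nn_integral_cong_AE)
        (use AE_lborel_singleton[of "max a 0"] in \<open>auto simp: indicator_def elim!: eventually_mono\<close>)
    also have "\<dots> = ennreal pi * ennreal (exp (- max a 0))"
      by (subst nn_integral_cmult, simp, subst nn_integral_exp_tail) auto
    finally show ?thesis by (simp add: ennreal_mult')
  qed
  have ball: "emeasure lborel (ball (0::real^2) r) = ennreal (pi * r\<^sup>2)" if "0 \<le> r" for r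
    using that by (subst emeasure_ball) (auto simp: unit_ball_vol_2)
  have eM: "emeasure M {a<..} = ennreal (pi * exp (- max a 0))" for a
  proof -
    have TB: "T -` {a<..} \<in> sets borel"
      using measurable_sets[of T borel borel "{a<..}"] by simp
    have "emeasure M {a<..} = (\<integral>\<^sup>+x. indicator B x * indicator (T -` {a<..}) x \<partial>lborel)"
      unfolding M_def using TB by (subst emeasure_distr, simp, simp, subst emeasure_density) (auto intro: borel_measurable_indicator)
    also have "\<dots> = (\<integral>\<^sup>+x. indicator (B \<inter> T -` {a<..}) x \<partial>lborel)"
      by (simp add: indicator_inter_arith)
    also have "\<dots> = emeasure lborel (B \<inter> T -` {a<..})"

    proof (rule nn_integral_indicator)
      show "B \<inter> T -` {a<..} \<in> sets lborel"
        unfolding sets_lborel by (intro sets.Int TB borel_open open_ball)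
    qed
    also have "\<dots> = emeasure lborel (ball (0::real^2) (exp (- max a 0 / 2)))"
    \<comment> \<open>At the origin ln 0 = 0 gives T the value 0 instead of \<infinity>; the
      exceptional set is null.\<close>
    proof (rule emeasure_eq_AE)
      show "AE x in lborel. (x \<in> B \<inter> T -` {a<..}) = (x \<in> ball 0 (exp (- max a 0 / 2)))"
        using AE_lborel_singleton[of "0::real^2"]
      proof eventually_elim
        case (elim x)
        have "norm x < exp (- max a 0 / 2) \<longleftrightarrow> ln (norm x) < - max a 0 / 2"
          using elim by (metis exp_less_cancel_iff exp_ln zero_less_norm_iff)
        moreover have "norm x < 1 \<longleftrightarrow> ln (norm x) < 0" using elim by simp
        ultimately show ?case by (auto simp: T_def max_def)
      qed
    qed (simp_all only: sets_lborel, auto intro!: sets.Int TB)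
    also have "\<dots> = ennreal (pi * exp (- max a 0))"
      by (subst ball) (auto simp: power2_eq_square simp flip: exp_add)
    finally show ?thesis .
  qed
  have "M = N"
    by (rule measure_eqI_lessThan) (auto simp: eM eN, auto simp: M_def N_def)
  have "(\<integral>\<^sup>+x. indicator B x * H (T x) \<partial>lborel) = (\<integral>\<^sup>+t. H t \<partial>M)"
    unfolding M_def by (subst nn_integral_distr, simp, simp, subst nn_integral_density) auto
  also have "\<dots> = (\<integral>\<^sup>+t. ennreal pi * (indicator {0<..} t * (ennreal (exp (- t)) * H t)) \<partial>lborel)"
    unfolding \<open>M = N\<close> N_def by (subst nn_integral_density) (auto simp: mult_ac)
  also have "\<dots> = ennreal pi * (\<integral>\<^sup>+t. indicator {0<..} t * (ennreal (exp (- t)) * H t) \<partial>lborel)"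
    by (rule nn_integral_cmult) measurable
  finally show ?thesis by (simp add: T_def)
qed

section \<open>Rotation invariance of planar Lebesgue measure\<close>

definition rot :: "real \<Rightarrow> real^2 \<Rightarrow> real^2"
  where "rot \<theta> x = vector [cos \<theta> * x $ 1 - sin \<theta> * x $ 2, sin \<theta> * x $ 1 + cos \<theta> * x $ 2]"

lemma rot_nth [simp]:
  "rot \<theta> x $ 1 = cos \<theta> * x $ 1 - sin \<theta> * x $ 2"
  "rot \<theta> x $ 2 = sin \<theta> * x $ 1 + cos \<theta> * x $ 2"
  by (simp_all add: rot_def)

lemma rot_rot: "rot \<theta> (rot \<phi> x) = rot (\<theta> + \<phi>) x"
  by (simp add: vec_eq_iff forall_2 cos_add sin_add algebra_simps)

lemma rot_0 [simp]: "rot 0 x = x"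
  by (simp add: vec_eq_iff forall_2)

lemma rot_inv [simp]: "rot (- \<theta>) (rot \<theta> x) = x" "rot \<theta> (rot (- \<theta>) x) = x"
  by (simp_all add: rot_rot)

lemma linear_rot: "linear (rot \<theta>)"
  by (intro linearI) (simp_all add: vec_eq_iff forall_2 algebra_simps)

lemma norm_rot [simp]: "norm (rot \<theta> x) = norm x"
proof -
  have n: "(norm y)\<^sup>2 = (y $ 1)\<^sup>2 + (y $ 2)\<^sup>2" for y :: "real^2"
    unfolding power2_norm_eq_inner by (simp add: inner_vec_def sum_2 power2_eq_square)
  have "(cos \<theta> * x $ 1 - sin \<theta> * x $ 2)\<^sup>2 + (sin \<theta> * x $ 1 + cos \<theta> * x $ 2)\<^sup>2
      = ((sin \<theta>)\<^sup>2 + (cos \<theta>)\<^sup>2) * ((x $ 1)\<^sup>2 + (x $ 2)\<^sup>2)"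
  proof -
    have "(c * a - s * b)\<^sup>2 + (s * a + c * b)\<^sup>2 = (s\<^sup>2 + c\<^sup>2) * (a\<^sup>2 + b\<^sup>2)" for a b c s :: real
      by (simp add: power2_eq_square algebra_simps)
    then show ?thesis .
  qed
  then have "(norm (rot \<theta> x))\<^sup>2 = (norm x)\<^sup>2"
    unfolding n rot_nth by simp
  then show ?thesis by simp
qed

lemma continuous_rot [continuous_intros]:
  fixes f :: "'a::t2_space \<Rightarrow> real"
  shows "continuous_on S f \<Longrightarrow> continuous_on S g \<Longrightarrow> continuous_on S (\<lambda>z. rot (f z) (g z))"
proof -
  assume *: "continuous_on S f" "continuous_on S g"
  have "continuous_on S (\<lambda>z. rot (f z) (g z) $ i)" for i
  proof -
    have "continuous_on S (\<lambda>z. rot (f z) (g z) $ 1)" "continuous_on S (\<lambda>z. rot (f z) (g z) $ 2)"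
      unfolding rot_nth by (intro continuous_intros *)+
    then show ?thesis using exhaust_2[of i] by metis
  qed
  then have "continuous_on S (\<lambda>z. \<chi> i. rot (f z) (g z) $ i)" by (intro continuous_on_vec_lambda)
  then show ?thesis by simp
qed

lemma rot_measurable [measurable]:
  assumes [measurable]: "f \<in> borel_measurable M" "g \<in> borel_measurable M"
  shows "(\<lambda>z. rot (f z) (g z)) \<in> borel_measurable M"
proof -
  have "(\<lambda>p. rot (fst p) (snd p)) \<in> borel_measurable borel"
    by (intro borel_measurable_continuous_onI continuous_intros)
  then have "(\<lambda>p. rot (fst p) (snd p)) \<circ> (\<lambda>z. (f z, g z)) \<in> borel_measurable M"
    by (intro measurable_comp[of _ _ borel]) auto
  then show ?thesis by (simp add: o_def)
qed

text \<open>Boxes determine \<open>lborel\<close>, and the preimage of a box is its image under a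
  linear map whose determinant has modulus 1.\<close>

lemma lborel_distr_rot: "distr lborel borel (rot \<theta>) = lborel"
proof (rule sym, rule lborel_eqI)
  fix l u :: "real^2" assume lu: "\<And>b. b \<in> Basis \<Longrightarrow> l \<bullet> b \<le> u \<bullet> b"
  have orth: "orthogonal_transformation (rot (- \<theta>))"
    by (simp add: orthogonal_transformation linear_rot)
  have det: "\<bar>det (matrix (rot (- \<theta>)))\<bar> = 1"
    using orthogonal_transformation_det[OF orth] .
  have pre: "rot \<theta> -` box l u = rot (- \<theta>) ` box l u"
  proof (intro set_eqI iffI)
    fix x assume "x \<in> rot \<theta> -` box l u"
    then show "x \<in> rot (- \<theta>) ` box l u" by (intro image_eqI[of _ _ "rot \<theta> x"]) auto
  next
    fix x assume "x \<in> rot (- \<theta>) ` box l u"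
    then show "x \<in> rot \<theta> -` box l u" by auto
  qed
  have meas: "rot (- \<theta>) ` box l u \<in> lmeasurable" "measure lebesgue (rot (- \<theta>) ` box l u) = measure lebesgue (box l u)"
    using measurable_linear_image[OF linear_rot, of "box l u" "- \<theta>"] measure_linear_image[OF linear_rot, of "box l u" "- \<theta>"] det by auto
  have ms: "rot \<theta> -` box l u \<in> sets borel"
    using measurable_sets[OF rot_measurable[of "\<lambda>_. \<theta>" "borel" "\<lambda>x. x"], of "box l u"] by auto
  have "emeasure (distr lborel borel (rot \<theta>)) (box l u) = emeasure lborel (rot \<theta> -` box l u)"
    by (subst emeasure_distr) auto
  also have "\<dots> = emeasure lebesgue (rot \<theta> -` box l u)" using ms by simp
  also have "\<dots> = emeasure lebesgue (box l u)"
    using meas unfolding pre by (simp add: emeasure_eq_measure2 fmeasurableD2)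
  also have "\<dots> = ennreal (\<Prod>b\<in>Basis. (u - l) \<bullet> b)"
    using emeasure_lborel_box[OF lu] by simp
  finally show "emeasure (distr lborel borel (rot \<theta>)) (box l u) = ennreal (\<Prod>b\<in>Basis. (u - l) \<bullet> b)"
    by simp
qed simp

lemma nn_integral_rot:
  assumes [measurable]: "f \<in> borel_measurable borel"
  shows "(\<integral>\<^sup>+x. f (rot \<theta> x) \<partial>lborel) = (\<integral>\<^sup>+x. f x \<partial>lborel)"
  by (subst (2) lborel_distr_rot[of \<theta>, symmetric], subst nn_integral_distr) auto

section \<open>The weighted Dirichlet form\<close>

text \<open>Difference quotients of a compactly supported function integrate to 0 by translation
  invariance, and the gradient bound makes them uniformly bounded, so dominated convergence applies.
  Fields glued along a cutoff have such a bounded gradient.\<close>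

lemma integral_grad_eq_0:
  fixes g :: "real^2 \<Rightarrow> real"
  assumes g: "\<And>x. GDERIV g x :> g' x" and L: "\<And>x. norm (g' x) \<le> L" and \<rho>: "\<And>x. \<rho> < norm x \<Longrightarrow> g x = 0"
  shows "integrable lborel (\<lambda>x. g' x $ i)" "(LINT x|lborel. g' x $ i) = 0"
proof -
  have contg: "continuous_on S g" for S
    using g unfolding gderiv_def by (intro has_derivative_continuous_on) (blast intro: has_derivative_at_withinI)
  then have [measurable]: "g \<in> borel_measurable borel" by (intro borel_measurable_continuous_onI)
  have intg: "integrable lborel g"
  proof -
    have "integrable lborel (\<lambda>x. indicator (cball 0 \<rho>) x *\<^sub>R g x)"
      by (intro borel_integrable_compact contg compact_cball)
    also have "(\<lambda>x. indicator (cball 0 \<rho>) x *\<^sub>R g x) = g"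
      using \<rho> by (auto simp: fun_eq_iff indicator_def not_le)
    finally show ?thesis .
  qed
  define e :: "real^2" where "e = axis i 1"
  have ne: "norm e = 1" by (simp add: e_def norm_axis_1)
  \<comment> \<open>Step lengths at most 1, so that all quotients are supported in the ball of
    radius \<rho> + 1.\<close>
  define h where "h = (\<lambda>n. inverse (real (Suc n)))"
  have h: "0 < h n" "h n \<le> 1" for n by (auto simp: h_def divide_simps)
  have hlim: "h \<longlonglongrightarrow> 0" unfolding h_def by (rule LIMSEQ_inverse_real_of_nat)
  define D where "D n x = (g (x + h n *\<^sub>R e) - g x) / h n" for n x
  have [measurable]: "D n \<in> borel_measurable borel" for n unfolding D_def by measurable
  have lim: "(\<lambda>n. D n x) \<longlonglongrightarrow> g' x $ i" for x
  proof -
    have "((\<lambda>t. x + t *\<^sub>R e) has_derivative (\<lambda>t. t *\<^sub>R e)) (at 0)"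
      by (auto intro!: derivative_eq_intros)
    moreover have "(g has_derivative (\<lambda>k. k \<bullet> g' x)) (at (x + 0 *\<^sub>R e))" using g by (simp add: gderiv_def)
    ultimately have "((\<lambda>t. g (x + t *\<^sub>R e)) has_derivative (\<lambda>t. (t *\<^sub>R e) \<bullet> g' x)) (at 0)"
      by (rule has_derivative_compose)
    then have "((\<lambda>t. g (x + t *\<^sub>R e)) has_real_derivative e \<bullet> g' x) (at 0)"
      by (simp add: has_field_derivative_def mult_commute_abs)
    then have "((\<lambda>t. (g (x + t *\<^sub>R e) - g x) / t) \<longlongrightarrow> e \<bullet> g' x) (at 0)"
      by (simp add: DERIV_def)
    then have "(\<lambda>n. (g (x + h n *\<^sub>R e) - g x) / h n) \<longlonglongrightarrow> e \<bullet> g' x"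
      by (rule filterlim_compose) (use h hlim in \<open>auto simp: filterlim_at order_less_imp_not_eq2 intro!: always_eventually\<close>)
    then show ?thesis by (simp add: D_def e_def inner_axis')
  qed
  have lip: "\<bar>g (x + t *\<^sub>R e) - g x\<bar> \<le> L * t" if "0 \<le> t" for x t
  proof -
    have "norm (g (x + t *\<^sub>R e) - g x) \<le> L * norm (x + t *\<^sub>R e - x)"
    proof (rule differentiable_bound[where S=UNIV])
      show "(g has_derivative (\<lambda>k. k \<bullet> g' y)) (at y within UNIV)" for y using g by (simp add: gderiv_def)
      show "onorm (\<lambda>k. k \<bullet> g' y) \<le> L" for y
      proof (rule onorm_le)
        fix k
        have "norm (k \<bullet> g' y) \<le> norm k * norm (g' y)" using Cauchy_Schwarz_ineq2[of k "g' y"] by simp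
        also have "\<dots> \<le> norm k * L" using L by (intro mult_left_mono) auto
        finally show "norm (k \<bullet> g' y) \<le> L * norm k" by (simp add: mult.commute)
      qed
    qed auto
    then show ?thesis using that ne by simp
  qed
  have bound: "norm (D n x) \<le> L * indicator (cball 0 (\<rho> + 1)) x" for n x
  proof (cases "norm x \<le> \<rho> + 1")
    case True
    then show ?thesis using lip[of "h n" x] h[of n] by (simp add: D_def field_simps)
  next
    case False
    have "norm x \<le> norm (x + h n *\<^sub>R e) + norm (h n *\<^sub>R e)"
      using norm_triangle_ineq4[of "x + h n *\<^sub>R e" "h n *\<^sub>R e"] by simp
    then have "\<rho> < norm (x + h n *\<^sub>R e)" "\<rho> < norm x" using False h[of n] ne by auto
    then show ?thesis using False by (simp add: D_def \<rho>)
  qed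
  have fin: "integrable lborel (\<lambda>x::real^2. L * indicator (cball 0 (\<rho> + 1)) x)"
    using emeasure_bounded_finite[OF bounded_cball[of "0::real^2" "\<rho> + 1"]]
    by (intro integrable_mult_right integrable_real_indicator) auto
  have [measurable]: "(\<lambda>x. g' x $ i) \<in> borel_measurable borel"
    by (rule borel_measurable_LIMSEQ_real[OF lim]) measurable
  have dc: "integrable lborel (\<lambda>x. g' x $ i)" "(\<lambda>n. LINT x|lborel. D n x) \<longlonglongrightarrow> (LINT x|lborel. g' x $ i)"
    by (rule integrable_dominated_convergence[where w="\<lambda>x. L * indicator (cball 0 (\<rho> + 1)) x" and s=D]
        integral_dominated_convergence[where w="\<lambda>x. L * indicator (cball 0 (\<rho> + 1)) x"];
      use fin lim bound in \<open>simp add: AE_I2\<close>)+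
  show "integrable lborel (\<lambda>x. g' x $ i)" by (rule dc)
  have "(LINT x|lborel. D n x) = 0" for n
  proof -
    have eq: "lborel = distr lborel borel ((+) (h n *\<^sub>R e))"
      by (rule lborel_distr_plus[symmetric])
    have "integrable lborel (\<lambda>x. g (h n *\<^sub>R e + x))"
      using intg by (subst (asm) eq) (simp add: integrable_distr_eq)
    moreover have "(LINT x|lborel. g (h n *\<^sub>R e + x)) = (LINT x|lborel. g x)"
      by (subst (2) eq, subst integral_distr) auto
    ultimately show ?thesis using intg by (simp add: D_def add.commute)
  qed
  with dc(2) show "(LINT x|lborel. g' x $ i) = 0" by (simp add: LIMSEQ_const_iff)
qed

section \<open>Integrals over the disc as Borel integrals over the plane\<close>

lemma nn_integral_lebesgue_on_B:
  assumes [measurable]: "f \<in> borel_measurable borel"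
  shows "(\<integral>\<^sup>+x. f x \<partial>lebesgue_on B) = (\<integral>\<^sup>+x. indicator B x * f x \<partial>lborel)"
proof -
  have "(\<integral>\<^sup>+x. f x \<partial>lebesgue_on B) = (\<integral>\<^sup>+x. f x * indicator B x \<partial>lebesgue)"
    by (intro nn_integral_restrict_space) auto
  also have "\<dots> = (\<integral>\<^sup>+x. f x * indicator B x \<partial>lborel)"
    by (intro nn_integral_completion)
  finally show ?thesis by (simp add: mult.commute)
qed

lemma
  fixes f :: "real^2 \<Rightarrow> real"
  assumes [measurable]: "f \<in> borel_measurable borel"
  shows integrable_lebesgue_on_B: "integrable (lebesgue_on B) f \<longleftrightarrow> integrable lborel (\<lambda>x. indicator B x * f x)"
    and integral_lebesgue_on_B: "(LINT x|lebesgue_on B. f x) = (LINT x|lborel. indicator B x * f x)"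
proof -
  have "integrable (lebesgue_on B) f \<longleftrightarrow> integrable lebesgue (\<lambda>x. indicator B x *\<^sub>R f x)"
    by (intro integrable_restrict_space) auto
  also have "\<dots> \<longleftrightarrow> integrable lborel (\<lambda>x. indicator B x *\<^sub>R f x)"
    by (intro integrable_completion) measurable
  finally show "integrable (lebesgue_on B) f \<longleftrightarrow> integrable lborel (\<lambda>x. indicator B x * f x)" by simp
  have "(LINT x|lebesgue_on B. f x) = (LINT x|lebesgue. indicator B x *\<^sub>R f x)"
    by (intro integral_restrict_space) auto
  also have "\<dots> = (LINT x|lborel. indicator B x *\<^sub>R f x)"
    by (intro integral_completion) measurable
  finally show "(LINT x|lebesgue_on B. f x) = (LINT x|lborel. indicator B x * f x)" by simp
qed

lemma weight_measurable [measurable]: "weight \<beta> \<in> borel_measurable borel"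
  unfolding weight_def by measurable

lemma borel_measurable_lebesgue_on: "f \<in> borel_measurable borel \<Longrightarrow> f \<in> borel_measurable (lebesgue_on S)"
  by (intro measurable_restrict_space1 measurable_completion) simp

text \<open>With the weight absorbed into the measure, the Dirichlet form is an inner product of
  vector fields. The measure is finite, since a power of the logarithm is integrable on the disc, so
  bounded fields are square integrable.\<close>

definition weight_measure :: "real \<Rightarrow> (real^2) measure"
  where "weight_measure \<beta> = density (lebesgue_on B) (\<lambda>x. ennreal (weight \<beta> x))"

lemma finite_weight_measure:
  assumes "0 \<le> \<beta>" "\<beta> < 1"
  shows "finite_measure (weight_measure \<beta>)"
proof
  have "emeasure (weight_measure \<beta>) (space (weight_measure \<beta>)) = (\<integral>\<^sup>+x. ennreal (weight \<beta> x) \<partial>lebesgue_on B)"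
    unfolding weight_measure_def by (subst emeasure_density) (auto intro!: nn_integral_cong borel_measurable_lebesgue_on)
  also have "\<dots> = (\<integral>\<^sup>+x. indicator B x * ennreal (\<bar>- 2 * ln (norm x) / - 2\<bar> powr \<beta>) \<partial>lborel)"
    by (subst nn_integral_lebesgue_on_B) (auto simp: weight_def)
  also have "\<dots> = ennreal pi * (\<integral>\<^sup>+t. indicator {0<..} t * (ennreal (exp (- t)) * ennreal (\<bar>t / -2\<bar> powr \<beta>)) \<partial>lborel)"
    by (rule nn_integral_ball_radial[of "\<lambda>t. ennreal (\<bar>t / -2\<bar> powr \<beta>)"]) measurable
  also have "\<dots> \<le> ennreal pi * (\<integral>\<^sup>+t. ennreal (exp (- (1/2) * t)) * indicator {0..} t \<partial>lborel)"
  proof (intro mult_left_mono nn_integral_mono)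
    fix t :: real
    show "indicator {0<..} t * (ennreal (exp (- t)) * ennreal (\<bar>t / -2\<bar> powr \<beta>)) \<le> ennreal (exp (- (1/2) * t)) * indicator {0..} t"
    proof (cases "0 < t")
      case True
      have "(t / 2) powr \<beta> \<le> (1 + t / 2) powr \<beta>" using True assms by (intro powr_mono2) auto
      also have "\<dots> \<le> (1 + t / 2) powr 1" using True assms by (intro powr_mono) auto
      also have "\<dots> \<le> exp (t / 2)" using True by (simp add: exp_ge_add_one_self)
      finally have "exp (- t) * (t / 2) powr \<beta> \<le> exp (- t) * exp (t / 2)" by (intro mult_left_mono) auto
      also have "\<dots> = exp (- (1/2) * t)" by (simp flip: exp_add)
      finally show ?thesis using True by (simp add: ennreal_mult'[symmetric])
    qed simp
  qed auto
  also have "\<dots> < \<infinity>" by (subst nn_integral_exp_tail) (auto simp: ennreal_mult_less_top)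
  finally show "emeasure (weight_measure \<beta>) (space (weight_measure \<beta>)) \<noteq> \<infinity>" by simp
qed

lemma integral_weight_measure:
  assumes "f \<in> borel_measurable borel"
  shows "(LINT x|weight_measure \<beta>. f x) = (LINT x|lebesgue_on B. f x * weight \<beta> x)"
  unfolding weight_measure_def
  by (subst integral_density) (auto intro!: borel_measurable_lebesgue_on assms simp: weight_def mult.commute)

lemma integral_weight_measure':
  assumes [measurable]: "f \<in> borel_measurable borel"
  shows "(LINT x|weight_measure \<beta>. f x) = (LINT x|lborel. indicator B x * (f x * weight \<beta> x))"
  by (simp add: integral_weight_measure integral_lebesgue_on_B)

lemma sets_weight_measure: "f \<in> borel_measurable borel \<Longrightarrow> f \<in> borel_measurable (weight_measure \<beta>)"
  unfolding weight_measure_def by (simp add: borel_measurable_lebesgue_on)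

text \<open>A class containing the gradients of test functions and also their products with cutoffs,
  which need not be gradients; the form is therefore defined on fields.\<close>

definition bounded_fields :: "(real^2 \<Rightarrow> real^2) set"
  where "bounded_fields = {V \<in> borel_measurable borel. \<exists>C. \<forall>x. norm (V x) \<le> C}"

definition field_inner :: "real \<Rightarrow> (real^2 \<Rightarrow> real^2) \<Rightarrow> (real^2 \<Rightarrow> real^2) \<Rightarrow> real"
  where "field_inner \<beta> V W = (LINT x|weight_measure \<beta>. V x \<bullet> W x)"

lemma bounded_fields_lin:
  assumes "V \<in> bounded_fields" "W \<in> bounded_fields"
  shows "(\<lambda>x. a *\<^sub>R V x + b *\<^sub>R W x) \<in> bounded_fields"
proof -
  obtain C D where C: "\<And>x. norm (V x) \<le> C" and D: "\<And>x. norm (W x) \<le> D" using assms by (auto simp: bounded_fields_def)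
  have "norm (a *\<^sub>R V x + b *\<^sub>R W x) \<le> \<bar>a\<bar> * C + \<bar>b\<bar> * D" for x
    using C[of x] D[of x] by (intro order_trans[OF norm_triangle_ineq] add_mono) (auto intro: mult_left_mono)
  then show ?thesis using assms by (auto simp: bounded_fields_def)
qed

lemma field_inner_commute: "field_inner \<beta> V W = field_inner \<beta> W V"
  by (simp add: field_inner_def inner_commute)

lemma field_inner_nonneg: "0 \<le> field_inner \<beta> V V"
  unfolding field_inner_def by (intro integral_nonneg_AE) auto

lemma test_grad_bounded_fields:
  assumes "f \<in> test_functions"
  shows "grad f \<in> bounded_fields"
proof -
  obtain C where "\<And>x. norm (grad f x) \<le> C" using test_bounded[OF assms] by metis
  moreover have "grad f \<in> borel_measurable borel"
    by (intro borel_measurable_continuous_onI test_grad_continuous assms)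
  ultimately show ?thesis by (auto simp: bounded_fields_def)
qed

lemma test_norm_field_inner:
  assumes "f \<in> test_functions"
  shows "test_norm \<beta> f = sqrt (field_inner \<beta> (grad f) (grad f))"
proof -
  have [measurable]: "grad f \<in> borel_measurable borel"
    using test_grad_bounded_fields[OF assms] by (simp add: bounded_fields_def)
  show ?thesis unfolding test_norm_def field_inner_def by (subst integral_weight_measure) (auto simp: power2_norm_eq_inner)
qed

lemma test_norm_nonneg: "0 \<le> test_norm \<beta> f"
  unfolding test_norm_def weight_def by (intro real_sqrt_ge_zero integral_nonneg_AE) auto

lemma test_norm_sq: "f \<in> test_functions \<Longrightarrow> (test_norm \<beta> f)\<^sup>2 = field_inner \<beta> (grad f) (grad f)"
  by (simp add: test_norm_field_inner field_inner_nonneg)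

context
  fixes \<beta> :: real
  assumes \<beta>: "0 \<le> \<beta>" "\<beta> < 1"
begin

interpretation finite_measure "weight_measure \<beta>" by (rule finite_weight_measure[OF \<beta>])

lemma bounded_fields_integrable:
  assumes "V \<in> bounded_fields" "W \<in> bounded_fields"
  shows "integrable (weight_measure \<beta>) (\<lambda>x. V x \<bullet> W x)"
proof -
  obtain C D where C: "\<And>x. norm (V x) \<le> C" and D: "\<And>x. norm (W x) \<le> D" using assms by (auto simp: bounded_fields_def)
  have [measurable]: "V \<in> borel_measurable borel" "W \<in> borel_measurable borel" using assms by (auto simp: bounded_fields_def)
  have "0 \<le> C" using C[of 0] norm_ge_zero[of "V 0"] by linarith
  have "norm (V x \<bullet> W x) \<le> C * D" for x
  proof -
    have "norm (V x \<bullet> W x) \<le> norm (V x) * norm (W x)" using Cauchy_Schwarz_ineq2[of "V x" "W x"] by simp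
    also have "\<dots> \<le> C * D" using C D \<open>0 \<le> C\<close> by (intro mult_mono) auto
    finally show ?thesis .
  qed
  then show ?thesis by (intro integrable_const_bound[of _ "C * D"] AE_I2 sets_weight_measure) auto
qed

lemma field_inner_lin:
  assumes "U \<in> bounded_fields" "V \<in> bounded_fields" "W \<in> bounded_fields"
  shows "field_inner \<beta> (\<lambda>x. a *\<^sub>R U x + b *\<^sub>R V x) W = a * field_inner \<beta> U W + b * field_inner \<beta> V W"
  using assms unfolding field_inner_def
  by (simp add: inner_add_left bounded_fields_integrable)

lemma field_inner_expand:
  assumes "V \<in> bounded_fields" "W \<in> bounded_fields"
  shows "field_inner \<beta> (\<lambda>x. a *\<^sub>R V x + b *\<^sub>R W x) (\<lambda>x. a *\<^sub>R V x + b *\<^sub>R W x)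
    = a\<^sup>2 * field_inner \<beta> V V + 2 * a * b * field_inner \<beta> V W + b\<^sup>2 * field_inner \<beta> W W"
proof -
  have "field_inner \<beta> V (\<lambda>x. a *\<^sub>R V x + b *\<^sub>R W x) = a * field_inner \<beta> V V + b * field_inner \<beta> V W"
    "field_inner \<beta> W (\<lambda>x. a *\<^sub>R V x + b *\<^sub>R W x) = a * field_inner \<beta> V W + b * field_inner \<beta> W W"
    using field_inner_lin[OF assms assms(1), of a b] field_inner_lin[OF assms assms(2), of a b] by (simp_all add: field_inner_commute)
  then show ?thesis using field_inner_lin[OF assms bounded_fields_lin[OF assms], of a b a b]
    by (simp add: power2_eq_square algebra_simps)
qed

lemma field_inner_Cauchy_Schwarz:
  assumes "V \<in> bounded_fields" "W \<in> bounded_fields"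
  shows "\<bar>field_inner \<beta> V W\<bar> \<le> sqrt (field_inner \<beta> V V) * sqrt (field_inner \<beta> W W)"
proof -
  have "(field_inner \<beta> V W)\<^sup>2 \<le> field_inner \<beta> V V * field_inner \<beta> W W"
  proof (cases "field_inner \<beta> W W = 0")
    case False
    then have W: "field_inner \<beta> W W > 0" using field_inner_nonneg[of \<beta> W] by linarith
    have "0 \<le> field_inner \<beta> (\<lambda>x. field_inner \<beta> W W *\<^sub>R V x + (- field_inner \<beta> V W) *\<^sub>R W x) (\<lambda>x. field_inner \<beta> W W *\<^sub>R V x + (- field_inner \<beta> V W) *\<^sub>R W x)"
      by (rule field_inner_nonneg)
    also have "\<dots> = field_inner \<beta> W W * (field_inner \<beta> W W * field_inner \<beta> V V - (field_inner \<beta> V W)\<^sup>2)"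
      unfolding field_inner_expand[OF assms] by (simp add: power2_eq_square algebra_simps)
    finally show ?thesis using W by (simp add: zero_le_mult_iff mult.commute)
  next
    \<comment> \<open>The form is only semidefinite on fields, so vanishing norm is treated apart:
      an affine function of s that is bounded below is constant.\<close>
    case True
    have "0 \<le> field_inner \<beta> V V + 2 * s * field_inner \<beta> V W" for s
      using field_inner_nonneg[of \<beta> "\<lambda>x. 1 *\<^sub>R V x + s *\<^sub>R W x"] field_inner_expand[OF assms, of 1 s] True by simp
    from this[of "- (field_inner \<beta> V V + 1) / (2 * field_inner \<beta> V W)"] have "field_inner \<beta> V W = 0"
      by (cases "field_inner \<beta> V W = 0") (auto simp: field_simps)
    then show ?thesis using True by simp
  qed
  then have "sqrt ((field_inner \<beta> V W)\<^sup>2) \<le> sqrt (field_inner \<beta> V V * field_inner \<beta> W W)" by (rule real_sqrt_le_mono)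
  then show ?thesis by (simp add: real_sqrt_mult)
qed

lemma test_norm_lin_sq:
  assumes "f \<in> test_functions" "g \<in> test_functions"
  shows "(test_norm \<beta> (\<lambda>x. a * f x + b * g x))\<^sup>2
    = a\<^sup>2 * (test_norm \<beta> f)\<^sup>2 + 2 * a * b * field_inner \<beta> (grad f) (grad g) + b\<^sup>2 * (test_norm \<beta> g)\<^sup>2"
proof -
  have "grad (\<lambda>x. a * f x + b * g x) = (\<lambda>x. a *\<^sub>R grad f x + b *\<^sub>R grad g x)"
    using test_grad_linear[OF assms] by blast
  then show ?thesis
    using test_linear[OF assms, of a b] assms by (simp add: test_norm_sq field_inner_expand test_grad_bounded_fields)
qed

lemma test_norm_triangle:
  assumes "f \<in> test_functions" "g \<in> test_functions"
  shows "test_norm \<beta> (\<lambda>x. a * f x + b * g x) \<le> \<bar>a\<bar> * test_norm \<beta> f + \<bar>b\<bar> * test_norm \<beta> g"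
proof (rule power2_le_imp_le)
  have "\<bar>field_inner \<beta> (grad f) (grad g)\<bar> \<le> test_norm \<beta> f * test_norm \<beta> g"
    using field_inner_Cauchy_Schwarz[OF test_grad_bounded_fields test_grad_bounded_fields, OF assms] assms by (simp add: test_norm_field_inner)
  then have "\<bar>a * b\<bar> * \<bar>field_inner \<beta> (grad f) (grad g)\<bar> \<le> \<bar>a * b\<bar> * (test_norm \<beta> f * test_norm \<beta> g)"
    by (intro mult_left_mono) auto
  then have "a * b * field_inner \<beta> (grad f) (grad g) \<le> \<bar>a * b\<bar> * (test_norm \<beta> f * test_norm \<beta> g)"
    by (metis abs_mult abs_ge_self order_trans)
  then show "(test_norm \<beta> (\<lambda>x. a * f x + b * g x))\<^sup>2 \<le> (\<bar>a\<bar> * test_norm \<beta> f + \<bar>b\<bar> * test_norm \<beta> g)\<^sup>2"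
    unfolding test_norm_lin_sq[OF assms] by (simp add: power2_sum power_mult_distrib abs_mult mult_ac)
  show "0 \<le> \<bar>a\<bar> * test_norm \<beta> f + \<bar>b\<bar> * test_norm \<beta> g" by (simp add: test_norm_nonneg)
qed

lemma test_norm_diff_le:
  assumes "f \<in> test_functions" "g \<in> test_functions"
  shows "\<bar>test_norm \<beta> f - test_norm \<beta> g\<bar> \<le> test_norm \<beta> (\<lambda>x. f x - g x)"
  using test_norm_triangle[OF test_diff[OF assms] assms(2), of 1 1]
    test_norm_triangle[OF test_diff[OF assms] assms(1), of "-1" 1] by simp

lemma test_norm_parallelogram:
  assumes "f \<in> test_functions" "g \<in> test_functions"
  shows "(test_norm \<beta> (\<lambda>x. f x - g x))\<^sup>2 + 4 * (test_norm \<beta> (\<lambda>x. 1/2 * f x + 1/2 * g x))\<^sup>2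
    = 2 * (test_norm \<beta> f)\<^sup>2 + 2 * (test_norm \<beta> g)\<^sup>2"
  using test_norm_lin_sq[OF assms, of 1 "-1"] test_norm_lin_sq[OF assms, of "1/2" "1/2"]
  by (simp add: power2_eq_square)

end

section \<open>Integration by parts away from the origin\<close>

definition cutoff :: "real \<Rightarrow> real \<Rightarrow> real \<Rightarrow> real"
  where "cutoff \<beta> \<epsilon> r = (max 0 (1 - \<epsilon> / r\<^sup>2))\<^sup>2 * (- ln r) powr \<beta>"

definition cutoff' :: "real \<Rightarrow> real \<Rightarrow> real \<Rightarrow> real"
  where "cutoff' \<beta> \<epsilon> r = 2 * max 0 (1 - \<epsilon> / r\<^sup>2) * (2 * \<epsilon> / r ^ 3) * (- ln r) powr \<beta>
    - (max 0 (1 - \<epsilon> / r\<^sup>2))\<^sup>2 * (\<beta> * (- ln r) powr (\<beta> - 1) / r)"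

text \<open>Squaring makes the positive part differentiable also at 0; this is why
  \<open>cutoff\<close> contains a square.\<close>

lemma DERIV_max_square: "((\<lambda>u::real. (max 0 u)\<^sup>2) has_real_derivative 2 * max 0 u) (at u)"
proof -
  consider "u > 0" | "u < 0" | "u = 0" by linarith
  then show ?thesis
  proof cases
    case 1
    have "((\<lambda>u::real. u\<^sup>2) has_real_derivative 2 * u) (at u)" by (auto intro!: derivative_eq_intros)
    then have "((\<lambda>u::real. (max 0 u)\<^sup>2) has_real_derivative 2 * u) (at u)"
      by (rule has_field_derivative_transform_within_open[where S="{0<..}"]) (use 1 in auto)
    then show ?thesis using 1 by simp
  next
    case 2
    have "((\<lambda>u::real. 0) has_real_derivative 0) (at u)" by simp
    then have "((\<lambda>u::real. (max 0 u)\<^sup>2) has_real_derivative 0) (at u)"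
      by (rule has_field_derivative_transform_within_open[where S="{..<0}"]) (use 2 in auto)
    then show ?thesis using 2 by simp
  next
    case 3
    have "((\<lambda>h::real. (max 0 h)\<^sup>2 / h) \<longlongrightarrow> 0) (at 0)"
    proof (rule Lim_null_comparison)
      show "\<forall>\<^sub>F h::real in at 0. norm ((max 0 h)\<^sup>2 / h) \<le> \<bar>h\<bar>"
        by (intro always_eventually allI) (auto simp: max_def power2_eq_square)
      show "((\<lambda>h::real. \<bar>h\<bar>) \<longlongrightarrow> 0) (at 0)" by (auto intro!: tendsto_eq_intros)
    qed
    then show ?thesis using 3 by (simp add: DERIV_def)
  qed
qed

lemma DERIV_cutoff:
  assumes "0 < r" "r < 1"
  shows "(cutoff \<beta> \<epsilon> has_real_derivative cutoff' \<beta> \<epsilon> r) (at r)"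
proof -
  have "((\<lambda>r. 1 - \<epsilon> / r\<^sup>2) has_real_derivative 2 * \<epsilon> / r ^ 3) (at r)"
    using assms by (auto intro!: derivative_eq_intros simp: field_simps power2_eq_square power3_eq_cube)
  from DERIV_chain'[OF this DERIV_max_square]
  have 1: "((\<lambda>r. (max 0 (1 - \<epsilon> / r\<^sup>2))\<^sup>2) has_real_derivative 2 * \<epsilon> / r ^ 3 * (2 * max 0 (1 - \<epsilon> / r\<^sup>2))) (at r)"
    by (simp add: mult.commute)
  have "- ln r > 0" using assms by simp
  then have "((\<lambda>r. (- ln r) powr \<beta>) has_real_derivative \<beta> * (- ln r) powr (\<beta> - 1) * (- (1 / r))) (at r)"
    using assms by (auto intro!: derivative_eq_intros)
  from DERIV_mult[OF 1 this] show ?thesis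
    unfolding cutoff_def[abs_def] cutoff'_def by (simp add: algebra_simps)
qed

lemma GDERIV_transform_open:
  assumes "GDERIV f x :> d" "open S" "x \<in> S" "\<And>y. y \<in> S \<Longrightarrow> f y = g y"
  shows "GDERIV g x :> d"
  using assms unfolding gderiv_def by (metis has_derivative_transform_within_open)

text \<open>The logarithm is singular at the origin, and (- ln r) powr \<beta> may have an unbounded
  derivative at the unit circle. The factor in \<open>cutoff\<close> removes the disc of radius sqrt
  \<epsilon> and the support of f removes an outer annulus; on the compact annulus A between them
  everything is continuous, hence bounded.\<close>

lemma cutoff_field:
  fixes f :: "real^2 \<Rightarrow> real"
  assumes f: "f \<in> test_functions" and \<epsilon>: "0 < \<epsilon>"
  obtains V' L where "\<And>x. GDERIV (\<lambda>x. cutoff \<beta> \<epsilon> (norm x) * grad f x $ i) x :> V' x"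
    "\<And>x. norm (V' x) \<le> L" "\<And>x. \<bar>cutoff \<beta> \<epsilon> (norm x) * grad f x $ i\<bar> \<le> L" "\<And>x. x \<notin> B \<Longrightarrow> V' x = 0"
proof -
  obtain \<rho> where \<rho>: "0 < \<rho>" "\<rho> < 1" "\<And>x. \<rho> < norm x \<Longrightarrow> grad f x = 0"
    by (rule test_support[OF f]) (rule that)
  have "C_k (Suc 0) (\<lambda>x. grad f x $ i)" by (rule test_grad_C_k[OF f])
  then obtain H where H: "\<And>x. GDERIV (\<lambda>x. grad f x $ i) x :> H x" "\<And>j. continuous_on UNIV (\<lambda>x. H x $ j)"
    by auto
  have contH: "continuous_on S H" for S
  proof -
    have "continuous_on UNIV (\<lambda>x. \<chi> j. H x $ j)" by (intro continuous_on_vec_lambda H)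
    then show ?thesis by (auto intro: continuous_on_subset)
  qed
  define A where "A = {x::real^2. sqrt \<epsilon> \<le> norm x \<and> norm x \<le> \<rho>}"
  have "A = cball 0 \<rho> - ball 0 (sqrt \<epsilon>)" by (auto simp: A_def)
  then have compA: "compact A" by (simp add: compact_diff)
  define V where "V x = cutoff \<beta> \<epsilon> (norm x) * grad f x $ i" for x
  define V1 where "V1 x = cutoff \<beta> \<epsilon> (norm x) *\<^sub>R H x + grad f x $ i *\<^sub>R (cutoff' \<beta> \<epsilon> (norm x) *\<^sub>R sgn x)" for x
  define V' where "V' x = (if x \<in> A then V1 x else 0)" for x
  have Apos: "0 < norm x" "norm x < 1" if "x \<in> A" for x
    using that \<rho> \<epsilon> real_sqrt_gt_zero[of \<epsilon>] unfolding A_def by auto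
  have V0: "V x = 0" if "norm x < sqrt \<epsilon>" for x
  proof -
    have "(norm x)\<^sup>2 \<le> (sqrt \<epsilon>)\<^sup>2" using that by (intro power_mono) auto
    then have "(norm x)\<^sup>2 \<le> \<epsilon>" using \<epsilon> by simp
    \<comment> \<open>At x = 0 the factor containing \<epsilon> is 1, as \<epsilon> / 0 = 0, but the
      value is still 0 because (- ln 0) powr \<beta> = 0 powr \<beta> = 0.\<close>
    then show ?thesis by (cases "x = 0") (auto simp: V_def cutoff_def max_def field_simps)
  qed
  have V: "GDERIV V x :> V' x" for x
  proof -
    consider "x \<in> A" | "norm x < sqrt \<epsilon>" | "\<rho> < norm x" by (cases "norm x < sqrt \<epsilon>"; cases "\<rho> < norm x") (auto simp: A_def not_less)
    then show ?thesis
    proof cases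
      case 1
      have "GDERIV (\<lambda>x. cutoff \<beta> \<epsilon> (norm x)) x :> cutoff' \<beta> \<epsilon> (norm x) *\<^sub>R sgn x"
        using Apos[OF 1] by (intro GDERIV_DERIV_compose GDERIV_norm DERIV_cutoff) auto
      from GDERIV_mult[OF this H(1)] show ?thesis
        using 1 by (simp add: V_def[abs_def] V'_def V1_def)
    next
      case 2
      have "GDERIV V x :> 0"
        by (rule GDERIV_transform_open[OF GDERIV_const[of 0], where S="ball 0 (sqrt \<epsilon>)"]) (use 2 V0 in auto)
      then show ?thesis using 2 by (simp add: V'_def A_def)
    next
      case 3
      have "open {x :: real^2. \<rho> < norm x}" by (intro open_Collect_less continuous_intros)
      then have "GDERIV V x :> 0"
        by (rule GDERIV_transform_open[OF GDERIV_const[of 0]]) (use 3 \<rho> in \<open>auto simp: V_def\<close>)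
      then show ?thesis using 3 by (simp add: V'_def A_def)
    qed
  qed
  have cont: "continuous_on A (\<lambda>x. cutoff \<beta> \<epsilon> (norm x))" "continuous_on A (\<lambda>x. cutoff' \<beta> \<epsilon> (norm x))"
    unfolding cutoff_def cutoff'_def
    by (intro continuous_intros; use Apos in force)+
  have "continuous_on A V1" unfolding V1_def sgn_div_norm
    by (intro continuous_intros cont contH test_grad_continuous f) (use Apos in force)+
  then have "bounded (V1 ` A)" by (intro compact_imp_bounded compact_continuous_image compA)
  then obtain L1 where L1: "\<And>x. x \<in> A \<Longrightarrow> norm (V1 x) \<le> L1"
    by (auto simp: bounded_iff)
  have "continuous_on A V" unfolding V_def
    by (intro continuous_intros cont test_grad_continuous f)
  then have "bounded (V ` A)" by (intro compact_imp_bounded compact_continuous_image compA)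
  then obtain L2 where L2: "\<And>x. x \<in> A \<Longrightarrow> norm (V x) \<le> L2"
    by (auto simp: bounded_iff)
  have V0': "V x = 0" if "x \<notin> A" for x
    using that V0[of x] \<rho>(3)[of x] by (auto simp: A_def V_def not_le)
  show ?thesis
  proof (rule that[of V' "max 0 (max L1 L2)"])
    show "GDERIV (\<lambda>x. cutoff \<beta> \<epsilon> (norm x) * grad f x $ i) x :> V' x" for x using V by (simp add: V_def[abs_def])
    show "norm (V' x) \<le> max 0 (max L1 L2)" for x
      using L1[of x] by (auto simp: V'_def le_max_iff_disj)
    show "\<bar>cutoff \<beta> \<epsilon> (norm x) * grad f x $ i\<bar> \<le> max 0 (max L1 L2)" for x
      using L2[of x] V0'[of x] unfolding V_def by (cases "x \<in> A") (auto simp: le_max_iff_disj)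
    show "V' x = 0" if "x \<notin> B" for x
      using that Apos[of x] by (auto simp: V'_def)
  qed
qed

text \<open>Integration by parts moves the derivative from g to the cut-off field, whose derivatives
  are bounded. Here smallness of g in L1 becomes smallness of the form; C depends on f and
  \<epsilon> but not on g.\<close>

lemma field_inner_cutoff_bound:
  fixes f :: "real^2 \<Rightarrow> real"
  assumes f: "f \<in> test_functions" and \<epsilon>: "0 < \<epsilon>"
  obtains C where "\<And>g. g \<in> test_functions \<Longrightarrow>
    \<bar>field_inner \<beta> (\<lambda>x. (max 0 (1 - \<epsilon> / (norm x)\<^sup>2))\<^sup>2 *\<^sub>R grad f x) (grad g)\<bar> \<le> C * (LINT x|lebesgue_on B. \<bar>g x\<bar>)"
proof -
  define V where "V i x = cutoff \<beta> \<epsilon> (norm x) * grad f x $ i" for i x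
  have "\<exists>V' L. (\<forall>x. GDERIV (V i) x :> V' x) \<and> (\<forall>x. norm (V' x) \<le> L) \<and> (\<forall>x. \<bar>V i x\<bar> \<le> L) \<and> (\<forall>x. x \<notin> B \<longrightarrow> V' x = 0)" for i
    by (rule cutoff_field[OF f \<epsilon>, of \<beta> i]) (unfold V_def, blast)
  then obtain V' L where V: "\<And>i x. GDERIV (V i) x :> V' i x" "\<And>i x. norm (V' i x) \<le> L i"
    "\<And>i x. \<bar>V i x\<bar> \<le> L i" "\<And>i x. x \<notin> B \<Longrightarrow> V' i x = 0" by metis
  have [measurable]: "grad f \<in> borel_measurable borel"
    by (intro borel_measurable_continuous_onI test_grad_continuous f)
  show ?thesis
  proof (rule that[of "\<Sum>i\<in>UNIV. L i"])
    fix g assume g: "g \<in> test_functions"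
    have [measurable]: "grad g \<in> borel_measurable borel" "g \<in> borel_measurable borel"
      by (intro borel_measurable_continuous_onI test_grad_continuous test_continuous g)+
    obtain \<rho> where \<rho>: "0 < \<rho>" "\<rho> < 1" "\<And>x. \<rho> < norm x \<Longrightarrow> g x = 0" "\<And>x. \<rho> < norm x \<Longrightarrow> grad g x = 0"
      by (rule test_support[OF g]) (rule that)
    obtain C where C: "0 < C" "\<And>x. \<bar>g x\<bar> \<le> C" "\<And>x. norm (grad g x) \<le> C"
      by (rule test_bounded[OF g]) (rule that)
    have L0: "0 \<le> L i" for i using V(3)[of i 0] by linarith
    have intg: "integrable lborel (\<lambda>x. indicator B x * \<bar>g x\<bar>)"
    proof -
      have "integrable lborel (\<lambda>x. indicator (cball 0 1) x *\<^sub>R \<bar>g x\<bar>)"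
        by (intro borel_integrable_compact continuous_intros test_continuous g compact_cball)
      then show ?thesis
        by (rule Bochner_Integration.integrable_bound) (auto split: split_indicator)
    qed
    have part: "integrable lborel (\<lambda>x. V i x * grad g x $ i)"
      "\<bar>LINT x|lborel. V i x * grad g x $ i\<bar> \<le> L i * (LINT x|lborel. indicator B x * \<bar>g x\<bar>)" for i
    proof -
      have D: "GDERIV (\<lambda>x. V i x * g x) x :> V i x *\<^sub>R grad g x + g x *\<^sub>R V' i x" for x
        by (intro GDERIV_mult V test_GDERIV g)
      have bd: "norm (V i x *\<^sub>R grad g x + g x *\<^sub>R V' i x) \<le> L i * C + C * L i" for x
        using V(2,3)[of i x] C(2,3)[of x] L0[of i] C(1)
        by (intro order_trans[OF norm_triangle_ineq] add_mono) (auto intro!: mult_mono)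
      have 1: "integrable lborel (\<lambda>x. (V i x *\<^sub>R grad g x + g x *\<^sub>R V' i x) $ i)"
        "(LINT x|lborel. (V i x *\<^sub>R grad g x + g x *\<^sub>R V' i x) $ i) = 0"
        by (rule integral_grad_eq_0[OF D bd, of \<rho>]; simp add: \<rho>)+
      have contV: "continuous_on UNIV (V i)"
        using V(1) unfolding gderiv_def by (intro has_derivative_continuous_on) auto
      have [measurable]: "V i \<in> borel_measurable borel" using contV by (rule borel_measurable_continuous_onI)
      have 2: "integrable lborel (\<lambda>x. V i x * grad g x $ i)"
      proof -
        have "integrable lborel (\<lambda>x. indicator (cball 0 1) x *\<^sub>R (V i x * grad g x $ i))"
          by (intro borel_integrable_compact continuous_intros test_grad_continuous g compact_cball continuous_on_subset[OF contV]) auto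
        also have "(\<lambda>x. indicator (cball 0 1) x *\<^sub>R (V i x * grad g x $ i)) = (\<lambda>x. V i x * grad g x $ i)"
          using \<rho> by (auto simp: fun_eq_iff indicator_def not_le)
        finally show ?thesis .
      qed
      then show "integrable lborel (\<lambda>x. V i x * grad g x $ i)" .
      have 3: "integrable lborel (\<lambda>x. g x * V' i x $ i)"
        using Bochner_Integration.integrable_diff[OF 1(1) 2] by simp
      have "(LINT x|lborel. V i x * grad g x $ i) = - (LINT x|lborel. g x * V' i x $ i)"
        using 1(2) 2 3 by simp
      then have "\<bar>LINT x|lborel. V i x * grad g x $ i\<bar> = \<bar>LINT x|lborel. g x * V' i x $ i\<bar>" by simp
      also have "\<dots> \<le> (LINT x|lborel. \<bar>g x * V' i x $ i\<bar>)" by (rule integral_abs_bound)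
      also have "\<dots> \<le> (LINT x|lborel. L i * (indicator B x * \<bar>g x\<bar>))"
      proof (rule integral_mono)
        show "integrable lborel (\<lambda>x. \<bar>g x * V' i x $ i\<bar>)" using 3 by simp
        show "integrable lborel (\<lambda>x. L i * (indicator B x * \<bar>g x\<bar>))" using intg by simp
        fix x
        have "\<bar>V' i x $ i\<bar> \<le> L i" using V(2)[of i x] component_le_norm_cart[of "V' i x" i] by linarith
        then have "\<bar>g x\<bar> * \<bar>V' i x $ i\<bar> \<le> \<bar>g x\<bar> * L i" by (intro mult_left_mono) auto
        then show "\<bar>g x * V' i x $ i\<bar> \<le> L i * (indicator B x * \<bar>g x\<bar>)"
          using V(4)[of x i] by (auto simp: indicator_def abs_mult mult.commute)
      qed
      finally show "\<bar>LINT x|lborel. V i x * grad g x $ i\<bar> \<le> L i * (LINT x|lborel. indicator B x * \<bar>g x\<bar>)" by simp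
    qed
    have "field_inner \<beta> (\<lambda>x. (max 0 (1 - \<epsilon> / (norm x)\<^sup>2))\<^sup>2 *\<^sub>R grad f x) (grad g)
      = (LINT x|lborel. indicator B x * ((((max 0 (1 - \<epsilon> / (norm x)\<^sup>2))\<^sup>2 *\<^sub>R grad f x) \<bullet> grad g x) * weight \<beta> x))"
      unfolding field_inner_def by (rule integral_weight_measure') measurable
    also have "\<dots> = (LINT x|lborel. (\<Sum>i\<in>UNIV. V i x * grad g x $ i))"
    proof (rule Bochner_Integration.integral_cong[OF refl])
      fix x :: "real^2"
      show "indicator B x * ((((max 0 (1 - \<epsilon> / (norm x)\<^sup>2))\<^sup>2 *\<^sub>R grad f x) \<bullet> grad g x) * weight \<beta> x)
        = (\<Sum>i\<in>UNIV. V i x * grad g x $ i)"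
      proof (cases "norm x \<le> \<rho>")
        case True
        then have nx: "norm x < 1" using \<rho> by simp
        have "\<bar>ln (norm x)\<bar> = - ln (norm x)"
          using nx by (cases "x = 0") (auto simp: ln_le_zero_iff abs_if)
        then have "weight \<beta> x = (- ln (norm x)) powr \<beta>" by (simp add: weight_def)
        then show ?thesis using nx
          by (simp add: V_def cutoff_def inner_vec_def sum_distrib_left sum_distrib_right mult_ac)
      next
        case False
        then show ?thesis by (simp add: \<rho>)
      qed
    qed
    also have "\<dots> = (\<Sum>i\<in>UNIV. LINT x|lborel. V i x * grad g x $ i)"
      by (rule Bochner_Integration.integral_sum) (rule part)
    also have "\<bar>\<dots>\<bar> \<le> (\<Sum>i\<in>UNIV. L i * (LINT x|lborel. indicator B x * \<bar>g x\<bar>))"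
      by (intro order_trans[OF sum_abs] sum_mono part)
    also have "\<dots> = (\<Sum>i\<in>UNIV. L i) * (LINT x|lborel. indicator B x * \<bar>g x\<bar>)"
      by (simp add: sum_distrib_right)
    also have "(LINT x|lborel. indicator B x * \<bar>g x\<bar>) = (LINT x|lebesgue_on B. \<bar>g x\<bar>)"
      by (simp add: integral_lebesgue_on_B)
    finally show "\<bar>field_inner \<beta> (\<lambda>x. (max 0 (1 - \<epsilon> / (norm x)\<^sup>2))\<^sup>2 *\<^sub>R grad f x) (grad g)\<bar> \<le> (\<Sum>i\<in>UNIV. L i) * (LINT x|lebesgue_on B. \<bar>g x\<bar>)" .
  qed
qed

definition cutoff_seq :: "nat \<Rightarrow> real^2 \<Rightarrow> real"
  where "cutoff_seq k x = (max 0 (1 - (1 / real (Suc k)) / (norm x)\<^sup>2))\<^sup>2"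

lemma cutoff_seq_bounds: "0 \<le> cutoff_seq k x" "cutoff_seq k x \<le> 1"
  unfolding cutoff_seq_def by (auto intro!: power_le_one)

lemma cutoff_seq_measurable [measurable]: "cutoff_seq k \<in> borel_measurable borel"
  unfolding cutoff_seq_def[abs_def] by measurable

lemma cutoff_seq_bounded_fields: "V \<in> bounded_fields \<Longrightarrow> (\<lambda>x. cutoff_seq k x *\<^sub>R V x) \<in> bounded_fields"
proof -
  assume V: "V \<in> bounded_fields"
  then obtain C where C: "\<And>x. norm (V x) \<le> C" by (auto simp: bounded_fields_def)
  have [measurable]: "V \<in> borel_measurable borel" using V by (auto simp: bounded_fields_def)
  have "norm (cutoff_seq k x *\<^sub>R V x) \<le> C" for x
  proof -
    have "cutoff_seq k x * norm (V x) \<le> 1 * norm (V x)" using cutoff_seq_bounds by (intro mult_right_mono) auto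
    then show ?thesis using cutoff_seq_bounds[of k x] C[of x] by simp
  qed
  then show ?thesis by (auto simp: bounded_fields_def)
qed

lemma test_measurable: "f \<in> test_functions \<Longrightarrow> f \<in> borel_measurable borel"
  by (intro borel_measurable_continuous_onI test_continuous)

lemma test_integrable:
  assumes f: "f \<in> test_functions"
  shows "integrable (lebesgue_on B) f"
proof -
  obtain \<rho> where \<rho>: "0 < \<rho>" "\<rho> < 1" "\<And>x. \<rho> < norm x \<Longrightarrow> f x = 0" "\<And>x. \<rho> < norm x \<Longrightarrow> grad f x = 0"
    by (rule test_support[OF f]) (rule that)
  have "integrable lborel (\<lambda>x. indicator (cball 0 \<rho>) x *\<^sub>R f x)"
    by (intro borel_integrable_compact test_continuous f compact_cball)
  also have "(\<lambda>x. indicator (cball 0 \<rho>) x *\<^sub>R f x) = (\<lambda>x. indicator B x * f x)"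
    using \<rho> by (auto simp: fun_eq_iff indicator_def not_le)
  finally show ?thesis using f by (simp add: integrable_lebesgue_on_B test_measurable)
qed

context
  fixes \<beta> :: real
  assumes \<beta>: "0 \<le> \<beta>" "\<beta> < 1"
begin

interpretation finite_measure "weight_measure \<beta>" by (rule finite_weight_measure[OF \<beta>])

lemma AE_weight_measure_nonzero: "AE x in weight_measure \<beta>. x \<noteq> 0"
proof -
  have "AE x in lebesgue. x \<noteq> (0::real^2)"
    using AE_lborel_singleton[of "0::real^2"] by (rule AE_completion)
  then have "AE x in lebesgue_on B. x \<noteq> 0" by (subst AE_restrict_space_iff) auto
  then show ?thesis unfolding weight_measure_def
    by (subst AE_density) (auto intro: borel_measurable_lebesgue_on)
qed

text \<open>Dominated convergence for the finite weight measure: the cutoffs lie between 0 and 1 and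
  tend to 1 off the origin, which is a null set.\<close>

lemma cutoff_seq_error:
  assumes V: "V \<in> bounded_fields"
  shows "(\<lambda>k. field_inner \<beta> (\<lambda>x. 1 *\<^sub>R V x + (-1) *\<^sub>R (cutoff_seq k x *\<^sub>R V x)) (\<lambda>x. 1 *\<^sub>R V x + (-1) *\<^sub>R (cutoff_seq k x *\<^sub>R V x))) \<longlonglongrightarrow> 0"
proof -
  obtain C where C: "\<And>x. norm (V x) \<le> C" using V by (auto simp: bounded_fields_def)
  have [measurable]: "V \<in> borel_measurable borel" using V by (auto simp: bounded_fields_def)
  define u where "u k x = (1 *\<^sub>R V x + (-1) *\<^sub>R (cutoff_seq k x *\<^sub>R V x)) \<bullet> (1 *\<^sub>R V x + (-1) *\<^sub>R (cutoff_seq k x *\<^sub>R V x))" for k x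
  have u: "u k x = (1 - cutoff_seq k x)\<^sup>2 * (norm (V x))\<^sup>2" for k x
  proof -
    have "1 *\<^sub>R V x + (-1) *\<^sub>R (cutoff_seq k x *\<^sub>R V x) = (1 - cutoff_seq k x) *\<^sub>R V x" by (simp add: scaleR_diff_left)
    then show ?thesis unfolding u_def power2_norm_eq_inner[symmetric]
      by (simp add: power_mult_distrib)
  qed
  have "(\<lambda>k. LINT x|weight_measure \<beta>. u k x) \<longlonglongrightarrow> (LINT x|weight_measure \<beta>. 0)"
  proof (rule integral_dominated_convergence[where w="\<lambda>_. C\<^sup>2"])
    show "AE x in weight_measure \<beta>. (\<lambda>k. u k x) \<longlonglongrightarrow> 0"
      using AE_weight_measure_nonzero
    proof eventually_elim
      case (elim x)
      have "(\<lambda>k. cutoff_seq k x) \<longlonglongrightarrow> (max 0 (1 - 0 / (norm x)\<^sup>2))\<^sup>2"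
        unfolding cutoff_seq_def using elim
        by (intro tendsto_intros LIMSEQ_Suc[OF lim_1_over_n]) auto
      then have "(\<lambda>k. (1 - cutoff_seq k x)\<^sup>2 * (norm (V x))\<^sup>2) \<longlonglongrightarrow> (1 - (max 0 (1 - 0 / (norm x)\<^sup>2))\<^sup>2)\<^sup>2 * (norm (V x))\<^sup>2"
        by (intro tendsto_intros)
      then show ?case by (simp add: u)
    qed
    show "AE x in weight_measure \<beta>. norm (u k x) \<le> C\<^sup>2" for k
    proof (rule AE_I2)
      fix x
      have "(1 - cutoff_seq k x)\<^sup>2 \<le> 1" using cutoff_seq_bounds[of k x] by (intro power_le_one) auto
      moreover have "(norm (V x))\<^sup>2 \<le> C\<^sup>2" using C[of x] by (intro power_mono) auto
      ultimately have "(1 - cutoff_seq k x)\<^sup>2 * (norm (V x))\<^sup>2 \<le> 1 * C\<^sup>2" by (intro mult_mono) auto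
      then show "norm (u k x) \<le> C\<^sup>2" by (simp add: u)
    qed
    show "(\<lambda>x. u k x) \<in> borel_measurable (weight_measure \<beta>)" for k
      unfolding u by (intro sets_weight_measure) measurable
  qed auto
  then show ?thesis by (simp add: field_inner_def u_def)
qed

text \<open>Weak convergence to 0 of a sequence that is bounded in energy and vanishes in L1. The
  gradient of f is split into a cut-off part, controlled by the L1 norm of d m through integration
  by parts, and a remainder that is small in the weighted norm, so that Cauchy-Schwarz bounds it
  uniformly in m.\<close>

lemma field_inner_tendsto_0:
  assumes f: "f \<in> test_functions" and d: "\<And>m. d m \<in> test_functions"
    and K: "\<And>m. test_norm \<beta> (d m) \<le> K" and d0: "(\<lambda>m. LINT x|lebesgue_on B. \<bar>d m x\<bar>) \<longlonglongrightarrow> 0"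
  shows "(\<lambda>m. field_inner \<beta> (grad f) (grad (d m))) \<longlonglongrightarrow> 0"
proof (rule LIMSEQ_I)
  fix r :: real assume r: "0 < r"
  define K1 where "K1 = \<bar>K\<bar> + 1"
  have K1: "K1 > 0" "\<And>m. test_norm \<beta> (d m) \<le> K1"
  proof -
    show "test_norm \<beta> (d m) \<le> K1" for m using K[of m] by (simp add: K1_def)
  qed (simp add: K1_def)
  note gf = test_grad_bounded_fields[OF f] and gd = test_grad_bounded_fields[OF d]
  let ?E = "\<lambda>k x. 1 *\<^sub>R grad f x + (-1) *\<^sub>R (cutoff_seq k x *\<^sub>R grad f x)"
  have "(\<lambda>k. sqrt (field_inner \<beta> (?E k) (?E k))) \<longlonglongrightarrow> sqrt 0"
    by (intro tendsto_real_sqrt cutoff_seq_error gf)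
  then have "\<forall>\<^sub>F k in sequentially. sqrt (field_inner \<beta> (?E k) (?E k)) < r / (2 * K1)"
    by (rule order_tendstoD(2)) (use r K1 in auto)
  then obtain k where k: "sqrt (field_inner \<beta> (?E k) (?E k)) < r / (2 * K1)"
    by (meson eventually_sequentially order_refl)
  obtain C where C: "\<And>g. g \<in> test_functions \<Longrightarrow> \<bar>field_inner \<beta> (\<lambda>x. cutoff_seq k x *\<^sub>R grad f x) (grad g)\<bar> \<le> C * (LINT x|lebesgue_on B. \<bar>g x\<bar>)"
    unfolding cutoff_seq_def by (rule field_inner_cutoff_bound[OF f, of "1 / real (Suc k)"]) auto
  have "(\<lambda>m. C * (LINT x|lebesgue_on B. \<bar>d m x\<bar>)) \<longlonglongrightarrow> C * 0" by (intro tendsto_intros d0)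
  then have "\<forall>\<^sub>F m in sequentially. C * (LINT x|lebesgue_on B. \<bar>d m x\<bar>) < r / 2"
    by (rule order_tendstoD(2)) (use r in auto)
  then obtain N where N: "\<And>m. m \<ge> N \<Longrightarrow> C * (LINT x|lebesgue_on B. \<bar>d m x\<bar>) < r / 2"
    by (auto simp: eventually_sequentially)
  show "\<exists>N. \<forall>m\<ge>N. norm (field_inner \<beta> (grad f) (grad (d m)) - 0) < r"
  proof (intro exI allI impI)
    fix m assume m: "N \<le> m"
    have Eb: "?E k \<in> bounded_fields" by (intro bounded_fields_lin gf cutoff_seq_bounded_fields)
    have "field_inner \<beta> (?E k) (grad (d m)) = field_inner \<beta> (grad f) (grad (d m)) - field_inner \<beta> (\<lambda>x. cutoff_seq k x *\<^sub>R grad f x) (grad (d m))"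
      using field_inner_lin[OF \<beta> gf cutoff_seq_bounded_fields[OF gf] gd, of 1 "-1" k m] by simp
    then have "\<bar>field_inner \<beta> (grad f) (grad (d m))\<bar> \<le> \<bar>field_inner \<beta> (?E k) (grad (d m))\<bar> + \<bar>field_inner \<beta> (\<lambda>x. cutoff_seq k x *\<^sub>R grad f x) (grad (d m))\<bar>"
      by linarith
    also have "\<bar>field_inner \<beta> (?E k) (grad (d m))\<bar> \<le> sqrt (field_inner \<beta> (?E k) (?E k)) * sqrt (field_inner \<beta> (grad (d m)) (grad (d m)))"
      by (rule field_inner_Cauchy_Schwarz[OF \<beta> Eb gd])
    also have "\<dots> \<le> r / (2 * K1) * K1"
      using k K1(2)[of m] r K1 test_norm_field_inner[OF d, of \<beta> m] test_norm_nonneg[of \<beta> "d m"]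
      by (intro mult_mono) auto
    also have "\<dots> = r / 2" using K1 by simp
    also have "\<bar>field_inner \<beta> (\<lambda>x. cutoff_seq k x *\<^sub>R grad f x) (grad (d m))\<bar> < r / 2"
      using C[OF d, of m] N[OF m] by linarith
    finally show "norm (field_inner \<beta> (grad f) (grad (d m)) - 0) < r" by simp
  qed
qed

text \<open>Closability of the Dirichlet form makes the limit in \<open>H10_norm\<close> independent of the representing
  sequence, so its definite description is not junk.\<close>

lemma test_norm_closable:
  assumes d: "\<And>m. d m \<in> test_functions"
    and cau: "\<And>e. e > 0 \<Longrightarrow> \<exists>N. \<forall>m\<ge>N. \<forall>n\<ge>N. test_norm \<beta> (\<lambda>x. d m x - d n x) < e"
    and d0: "(\<lambda>m. LINT x|lebesgue_on B. \<bar>d m x\<bar>) \<longlonglongrightarrow> 0"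
  shows "(\<lambda>m. test_norm \<beta> (d m)) \<longlonglongrightarrow> 0"
proof -
  obtain N1 where N1: "\<And>m n. m \<ge> N1 \<Longrightarrow> n \<ge> N1 \<Longrightarrow> test_norm \<beta> (\<lambda>x. d m x - d n x) < 1"
    using cau[of 1] by auto
  define K where "K = 1 + test_norm \<beta> (d N1)"
  have Kpos: "K > 0" using test_norm_nonneg[of \<beta> "d N1"] by (simp add: K_def)
  have K: "test_norm \<beta> (d m) \<le> K" if "m \<ge> N1" for m
    using test_norm_diff_le[OF \<beta> d d, of m N1] N1[OF that order_refl] by (simp add: K_def)
  have "(\<lambda>m. (test_norm \<beta> (d m))\<^sup>2) \<longlonglongrightarrow> 0"
  proof (rule LIMSEQ_I)
    fix r :: real assume r: "0 < r"
    obtain N2 where N2: "\<And>m n. m \<ge> N2 \<Longrightarrow> n \<ge> N2 \<Longrightarrow> test_norm \<beta> (\<lambda>x. d m x - d n x) < r / (2 * K)"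
      using cau[of "r / (2 * K)"] r Kpos by auto
    define N where "N = max N1 N2"
    show "\<exists>N. \<forall>m\<ge>N. norm ((test_norm \<beta> (d m))\<^sup>2 - 0) < r"
    proof (intro exI allI impI)
      fix n assume n: "N \<le> n"
      have "(\<lambda>m. field_inner \<beta> (grad (d n)) (grad (d (m + N)))) \<longlonglongrightarrow> 0"
      proof (rule field_inner_tendsto_0[OF d d, where K=K])
        show "test_norm \<beta> (d (m + N)) \<le> K" for m using K[of "m + N"] by (simp add: N_def)
        show "(\<lambda>m. LINT x|lebesgue_on B. \<bar>d (m + N) x\<bar>) \<longlonglongrightarrow> 0"
          using d0 by (rule LIMSEQ_ignore_initial_segment)
      qed
      \<comment> \<open>The squared norm of d n is its inner product with d n - d (m + N), which is
        small by the Cauchy property, plus its inner product with d (m + N), which tends to 0 in m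
        for fixed n.\<close>
      moreover have "(test_norm \<beta> (d n))\<^sup>2 - r / 2 \<le> field_inner \<beta> (grad (d n)) (grad (d (m + N)))" for m
      proof -
        let ?e = "\<lambda>x. d n x - d (m + N) x"
        have e: "?e \<in> test_functions" by (intro test_diff d)
        have "grad ?e = (\<lambda>x. 1 *\<^sub>R grad (d n) x + (-1) *\<^sub>R grad (d (m + N)) x)"
          using test_grad_linear[OF d d, of 1 n "-1" "m + N"] by (simp add: fun_eq_iff)
        then have "field_inner \<beta> (grad ?e) (grad (d n)) = field_inner \<beta> (grad (d n)) (grad (d n)) - field_inner \<beta> (grad (d (m + N))) (grad (d n))"
          using field_inner_lin[OF \<beta> test_grad_bounded_fields[OF d] test_grad_bounded_fields[OF d] test_grad_bounded_fields[OF d], of 1 n "-1" "m + N" n] by simp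
        then have "(test_norm \<beta> (d n))\<^sup>2 = field_inner \<beta> (grad ?e) (grad (d n)) + field_inner \<beta> (grad (d n)) (grad (d (m + N)))"
          by (simp add: test_norm_sq[OF d] field_inner_commute)
        moreover have "\<bar>field_inner \<beta> (grad ?e) (grad (d n))\<bar> \<le> test_norm \<beta> ?e * test_norm \<beta> (d n)"
          using field_inner_Cauchy_Schwarz[OF \<beta> test_grad_bounded_fields[OF e] test_grad_bounded_fields[OF d], of n]
          by (simp add: test_norm_field_inner[OF e] test_norm_field_inner[OF d])
        moreover have "test_norm \<beta> ?e * test_norm \<beta> (d n) \<le> r / (2 * K) * K"
        proof (rule mult_mono)
          have "N2 \<le> m + N" "N2 \<le> n" using n by (auto simp: N_def)
          then show "test_norm \<beta> ?e \<le> r / (2 * K)" using N2 by (meson less_imp_le)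
          show "test_norm \<beta> (d n) \<le> K" using K n by (simp add: N_def)
        qed (use r Kpos in \<open>auto simp: test_norm_nonneg\<close>)
        ultimately show ?thesis using Kpos by simp
      qed
      ultimately have "(test_norm \<beta> (d n))\<^sup>2 - r / 2 \<le> 0"
        by (intro tendsto_lowerbound[where F=sequentially]) auto
      then show "norm ((test_norm \<beta> (d n))\<^sup>2 - 0) < r" using r by simp
    qed
  qed
  from tendsto_real_sqrt[OF this] show ?thesis by (simp add: test_norm_nonneg)
qed

text \<open>The limit exists by the reverse triangle inequality. It is unique because the difference
  of two representing sequences is Cauchy and tends to 0 in L1, which is the situation of
  \<open>test_norm_closable\<close>. Any representing sequence may then be used to compute the
  norm.\<close>

lemma represents_norm_tendsto:
  assumes rep: "represents \<beta> \<phi> u"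
  shows "(\<lambda>n. test_norm \<beta> (\<phi> n)) \<longlonglongrightarrow> H10_norm \<beta> u"
proof -
  have conv: "convergent (\<lambda>n. test_norm \<beta> (\<psi> n))" if rp: "represents \<beta> \<psi> u" for \<psi>
  proof (rule Cauchy_convergent, rule metric_CauchyI)
    fix e :: real assume "0 < e"
    then obtain N where "\<forall>m\<ge>N. \<forall>n\<ge>N. test_norm \<beta> (\<lambda>x. \<psi> m x - \<psi> n x) < e"
      using rp unfolding represents_def by blast
    moreover have "dist (test_norm \<beta> (\<psi> m)) (test_norm \<beta> (\<psi> n)) \<le> test_norm \<beta> (\<lambda>x. \<psi> m x - \<psi> n x)" for m n
      using test_norm_diff_le[OF \<beta>, of "\<psi> m" "\<psi> n"] rp by (simp add: represents_def dist_real_def)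
    ultimately show "\<exists>N. \<forall>m\<ge>N. \<forall>n\<ge>N. dist (test_norm \<beta> (\<psi> m)) (test_norm \<beta> (\<psi> n)) < e"
      by (meson le_less_trans)
  qed
  have same: "a = b" if rp: "represents \<beta> \<psi> u" and ab: "(\<lambda>n. test_norm \<beta> (\<phi> n)) \<longlonglongrightarrow> a" "(\<lambda>n. test_norm \<beta> (\<psi> n)) \<longlonglongrightarrow> b" for \<psi> a b
  proof -
    have \<phi>: "\<And>n. \<phi> n \<in> test_functions" and \<psi>: "\<And>n. \<psi> n \<in> test_functions"
      using rep rp by (auto simp: represents_def)
    define d where "d n x = \<phi> n x - \<psi> n x" for n x
    have d: "d n \<in> test_functions" for n unfolding d_def[abs_def] by (intro test_diff \<phi> \<psi>)
    have "(\<lambda>n. test_norm \<beta> (d n)) \<longlonglongrightarrow> 0"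
    proof (rule test_norm_closable[OF d])
      fix e :: real assume "e > 0"
      then have "e / 2 > 0" by simp
      obtain N1 where N1: "\<And>m n. m \<ge> N1 \<Longrightarrow> n \<ge> N1 \<Longrightarrow> test_norm \<beta> (\<lambda>x. \<phi> m x - \<phi> n x) < e / 2"
        using rep \<open>e / 2 > 0\<close> unfolding represents_def by meson
      obtain N2 where N2: "\<And>m n. m \<ge> N2 \<Longrightarrow> n \<ge> N2 \<Longrightarrow> test_norm \<beta> (\<lambda>x. \<psi> m x - \<psi> n x) < e / 2"
        using rp \<open>e / 2 > 0\<close> unfolding represents_def by meson
      have "test_norm \<beta> (\<lambda>x. d m x - d n x) < e" if "m \<ge> max N1 N2" "n \<ge> max N1 N2" for m n
      proof -
        have "test_norm \<beta> (\<lambda>x. 1 * (\<phi> m x - \<phi> n x) + (-1) * (\<psi> m x - \<psi> n x)) \<le>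
          \<bar>1\<bar> * test_norm \<beta> (\<lambda>x. \<phi> m x - \<phi> n x) + \<bar>-1\<bar> * test_norm \<beta> (\<lambda>x. \<psi> m x - \<psi> n x)"
          by (intro test_norm_triangle[OF \<beta>] test_diff \<phi> \<psi>)
        moreover have "(\<lambda>x. 1 * (\<phi> m x - \<phi> n x) + (-1) * (\<psi> m x - \<psi> n x)) = (\<lambda>x. d m x - d n x)"
          by (auto simp: d_def)
        ultimately show ?thesis using N1[of m n] N2[of m n] that by simp
      qed
      then show "\<exists>N. \<forall>m\<ge>N. \<forall>n\<ge>N. test_norm \<beta> (\<lambda>x. d m x - d n x) < e" by blast
    next
      have iu: "integrable (lebesgue_on B) u" using rep by (simp add: represents_def)
      have "(\<lambda>n. (LINT x|lebesgue_on B. \<bar>\<phi> n x - u x\<bar>) + (LINT x|lebesgue_on B. \<bar>\<psi> n x - u x\<bar>)) \<longlonglongrightarrow> 0 + 0"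
        using rep rp by (intro tendsto_add) (auto simp: represents_def)
      then have s: "(\<lambda>n. (LINT x|lebesgue_on B. \<bar>\<phi> n x - u x\<bar>) + (LINT x|lebesgue_on B. \<bar>\<psi> n x - u x\<bar>)) \<longlonglongrightarrow> 0" by simp
      show "(\<lambda>m. LINT x|lebesgue_on B. \<bar>d m x\<bar>) \<longlonglongrightarrow> 0"
      proof (rule tendsto_sandwich[OF _ _ tendsto_const s])
        show "\<forall>\<^sub>F n in sequentially. 0 \<le> (LINT x|lebesgue_on B. \<bar>d n x\<bar>)" by simp
        show "\<forall>\<^sub>F n in sequentially. (LINT x|lebesgue_on B. \<bar>d n x\<bar>) \<le> (LINT x|lebesgue_on B. \<bar>\<phi> n x - u x\<bar>) + (LINT x|lebesgue_on B. \<bar>\<psi> n x - u x\<bar>)"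
        proof (intro always_eventually allI)
          fix n
          have i: "integrable (lebesgue_on B) (\<lambda>x. \<bar>\<phi> n x - u x\<bar>)" "integrable (lebesgue_on B) (\<lambda>x. \<bar>\<psi> n x - u x\<bar>)"
            by (intro integrable_abs Bochner_Integration.integrable_diff test_integrable \<phi> \<psi> iu)+
          have "(LINT x|lebesgue_on B. \<bar>d n x\<bar>) \<le> (LINT x|lebesgue_on B. \<bar>\<phi> n x - u x\<bar> + \<bar>\<psi> n x - u x\<bar>)"
            by (intro integral_mono integrable_abs Bochner_Integration.integrable_add i test_integrable d) (auto simp: d_def)
          then show "(LINT x|lebesgue_on B. \<bar>d n x\<bar>) \<le> (LINT x|lebesgue_on B. \<bar>\<phi> n x - u x\<bar>) + (LINT x|lebesgue_on B. \<bar>\<psi> n x - u x\<bar>)"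
            using i by simp
        qed
      qed
    qed
    moreover have "(\<lambda>n. \<bar>test_norm \<beta> (\<phi> n) - test_norm \<beta> (\<psi> n)\<bar>) \<longlonglongrightarrow> \<bar>a - b\<bar>"
      by (intro tendsto_intros ab)
    ultimately have "\<bar>a - b\<bar> \<le> 0"
      by (rule tendsto_le[OF sequentially_bot]) (auto simp: d_def[abs_def] intro!: always_eventually test_norm_diff_le[OF \<beta>] \<phi> \<psi>)
    then show ?thesis by simp
  qed
  obtain r where r: "(\<lambda>n. test_norm \<beta> (\<phi> n)) \<longlonglongrightarrow> r" using conv[OF rep] by (auto simp: convergent_def)
  have "H10_norm \<beta> u = r"
    unfolding H10_norm_def
  proof (rule the_equality)
    show "\<exists>\<phi>. represents \<beta> \<phi> u \<and> (\<lambda>n. test_norm \<beta> (\<phi> n)) \<longlonglongrightarrow> r" using rep r by blast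
    fix s assume "\<exists>\<phi>. represents \<beta> \<phi> u \<and> (\<lambda>n. test_norm \<beta> (\<phi> n)) \<longlonglongrightarrow> s"
    then show "s = r" using same[OF _ r] by blast
  qed
  then show ?thesis using r by simp
qed

end

section \<open>Circular means\<close>

definition unit_vec :: "real \<Rightarrow> real^2"
  where "unit_vec \<theta> = vector [cos \<theta>, sin \<theta>]"

lemma unit_vec_nth [simp]: "unit_vec \<theta> $ 1 = cos \<theta>" "unit_vec \<theta> $ 2 = sin \<theta>"
  by (simp_all add: unit_vec_def)

lemma norm_unit_vec [simp]: "norm (unit_vec \<theta>) = 1"
  unfolding norm_eq_1 by (simp add: inner_vec_def sum_2 flip: power2_eq_square)

lemma rot_unit_vec: "rot \<theta> (r *\<^sub>R unit_vec \<phi>) = r *\<^sub>R unit_vec (\<theta> + \<phi>)"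
  by (simp add: vec_eq_iff forall_2 cos_add sin_add algebra_simps)

lemma unit_vec_periodic: "unit_vec (\<theta> + 2 * pi) = unit_vec \<theta>"
  by (simp add: vec_eq_iff forall_2)

lemma continuous_unit_vec [continuous_intros]:
  fixes f :: "'a::t2_space \<Rightarrow> real"
  shows "continuous_on S f \<Longrightarrow> continuous_on S (\<lambda>z. unit_vec (f z))"
proof -
  assume *: "continuous_on S f"
  have "continuous_on S (\<lambda>z. unit_vec (f z) $ 1)" "continuous_on S (\<lambda>z. unit_vec (f z) $ 2)"
    unfolding unit_vec_nth by (intro continuous_intros *)+
  then have "continuous_on S (\<lambda>z. unit_vec (f z) $ i)" for i using exhaust_2[of i] by metis
  then have "continuous_on S (\<lambda>z. \<chi> i. unit_vec (f z) $ i)" by (intro continuous_on_vec_lambda)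
  then show ?thesis by simp
qed

lemma polar_form:
  fixes x :: "real^2"
  obtains \<theta> where "0 \<le> \<theta>" "\<theta> \<le> 2 * pi" "x = norm x *\<^sub>R unit_vec \<theta>"
proof (cases "x = 0")
  case True
  then show ?thesis using that[of 0] by simp
next
  case False
  have n: "(x $ 1)\<^sup>2 + (x $ 2)\<^sup>2 = (norm x)\<^sup>2"
    unfolding power2_norm_eq_inner by (simp add: inner_vec_def sum_2 power2_eq_square)
  have "(x $ 1 / norm x)\<^sup>2 + (x $ 2 / norm x)\<^sup>2 = ((x $ 1)\<^sup>2 + (x $ 2)\<^sup>2) / (norm x)\<^sup>2"
    by (simp only: power_divide add_divide_distrib)
  also have "\<dots> = 1" unfolding n using False by simp
  finally have "(x $ 1 / norm x)\<^sup>2 + (x $ 2 / norm x)\<^sup>2 = 1" .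
  then obtain t where t: "0 \<le> t" "t < 2 * pi" "x $ 1 / norm x = cos t" "x $ 2 / norm x = sin t"
    by (rule sincos_total_2pi)
  have "x = norm x *\<^sub>R unit_vec t" using False by (simp add: vec_eq_iff forall_2 flip: t(3,4))
  then show ?thesis using that[of t] t by simp
qed

lemma integral_periodic_shift:
  fixes g :: "real \<Rightarrow> real"
  assumes g: "continuous_on UNIV g" and per: "\<And>x. g (x + p) = g x" and c: "0 \<le> c" "c \<le> p"
  shows "integral {0..p} (\<lambda>x. g (x + c)) = integral {0..p} g"
proof -
  have int: "g integrable_on {a..b}" for a b
    by (intro integrable_continuous_real continuous_on_subset[OF g]) auto
  have shift: "integral {a..b} (\<lambda>x. g (x + d)) = integral {a + d..b + d} g" for a b d
    using integral_shift_Icc_real[of a b g d] by (simp add: o_def add.commute)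
  have "integral {0..p} (\<lambda>x. g (x + c)) = integral {c..p + c} g"
    using shift[of 0 p c] by simp
  also have "\<dots> = integral {c..p} g + integral {p..p + c} g"
    by (rule Henstock_Kurzweil_Integration.integral_combine[symmetric]) (use c int in auto)
  also have "integral {p..p + c} g = integral {0..c} g"
    using shift[of 0 c p] by (simp add: per add.commute)
  also have "integral {c..p} g + integral {0..c} g = integral {0..p} g"
    using Henstock_Kurzweil_Integration.integral_combine[of 0 c p g] c int by simp
  finally show ?thesis .
qed

definition circle_mean :: "(real^2 \<Rightarrow> real) \<Rightarrow> real \<Rightarrow> real"
  where "circle_mean f r = integral {0..2 * pi} (\<lambda>\<theta>. f (r *\<^sub>R unit_vec \<theta>)) / (2 * pi)"

text \<open>Starting the circle at x instead of on the positive axis shifts a periodic integrand. In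
  this form the mean is an average over rotations of the point, and invariance of planar measure can
  act on it.\<close>

lemma circle_mean_rot:
  assumes f: "continuous_on UNIV f"
  shows "circle_mean f (norm x) = integral {0..2 * pi} (\<lambda>\<theta>. f (rot \<theta> x)) / (2 * pi)"
proof -
  obtain \<theta>0 where \<theta>0: "0 \<le> \<theta>0" "\<theta>0 \<le> 2 * pi" "x = norm x *\<^sub>R unit_vec \<theta>0" by (rule polar_form)
  have "rot \<theta> x = norm x *\<^sub>R unit_vec (\<theta> + \<theta>0)" for \<theta>
    using rot_unit_vec[of \<theta> "norm x" \<theta>0] \<theta>0(3) by simp
  then show ?thesis unfolding circle_mean_def
    using integral_periodic_shift[of "\<lambda>\<theta>. f (norm x *\<^sub>R unit_vec \<theta>)" "2 * pi" \<theta>0] \<theta>0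
    by (simp add: unit_vec_periodic continuous_on_compose2[OF f] continuous_intros)
qed

section \<open>Averages over rotations under planar integrals\<close>

definition angle_measure :: "real measure"
  where "angle_measure = density lborel (\<lambda>\<theta>. ennreal (indicator {0..2 * pi} \<theta> / (2 * pi)))"

lemma sets_angle_measure [simp, measurable_cong]: "sets angle_measure = sets borel"
  by (simp add: angle_measure_def)

lemma nn_integral_angle_measure:
  assumes [measurable]: "f \<in> borel_measurable borel"
  shows "(\<integral>\<^sup>+\<theta>. f \<theta> \<partial>angle_measure) = ennreal (1 / (2 * pi)) * (\<integral>\<^sup>+\<theta>. indicator {0..2 * pi} \<theta> * f \<theta> \<partial>lborel)"
proof -
  have "(\<integral>\<^sup>+\<theta>. f \<theta> \<partial>angle_measure) = (\<integral>\<^sup>+\<theta>. ennreal (1 / (2 * pi)) * (indicator {0..2 * pi} \<theta> * f \<theta>) \<partial>lborel)"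
    unfolding angle_measure_def by (subst nn_integral_density) (auto intro!: nn_integral_cong split: split_indicator)
  then show ?thesis by (simp add: nn_integral_cmult)
qed

lemma nn_integral_angle_measure_continuous:
  assumes "continuous_on {0..2 * pi} f" "\<And>\<theta>. 0 \<le> f \<theta>" "f \<in> borel_measurable borel"
  shows "(\<integral>\<^sup>+\<theta>. ennreal (f \<theta>) \<partial>angle_measure) = ennreal (integral {0..2 * pi} f / (2 * pi))"
proof -
  have "(f has_integral integral {0..2 * pi} f) {0..2 * pi}"
    using assms by (intro integrable_integral integrable_continuous_real)
  from nn_integral_indicator_has_integral[OF _ this] show ?thesis
    using assms by (subst nn_integral_angle_measure) (auto simp: ennreal_mult'[symmetric])
qed

lemma prob_angle_measure: "emeasure angle_measure (space angle_measure) = 1"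
proof -
  have "emeasure angle_measure (space angle_measure) = (\<integral>\<^sup>+\<theta>. ennreal 1 \<partial>angle_measure)" by simp
  also have "\<dots> = ennreal (integral {0..2 * pi} (\<lambda>_. 1) / (2 * pi))"
    by (rule nn_integral_angle_measure_continuous) auto
  finally show ?thesis by simp
qed

lemma pair_sigma_finite_angle_measure: "pair_sigma_finite angle_measure (lborel :: (real^2) measure)"
proof -
  have "sigma_finite_measure angle_measure"
    by (intro finite_measure.axioms(1) finite_measureI) (simp add: prob_angle_measure)
  then show ?thesis by (intro pair_sigma_finite.intro sigma_finite_lborel)
qed

text \<open>Tonelli's theorem; since the angle measure has mass 1, averaging integrals with the
  common value C returns C.\<close>

lemma nn_integral_rotate_average:
  fixes F :: "real \<Rightarrow> real^2 \<Rightarrow> ennreal"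
  assumes F: "(\<lambda>(\<theta>, x). F \<theta> x) \<in> borel_measurable (borel \<Otimes>\<^sub>M borel)"
    and inv: "\<And>\<theta>. (\<integral>\<^sup>+x. F \<theta> x \<partial>lborel) = C"
  shows "(\<integral>\<^sup>+x. (\<integral>\<^sup>+\<theta>. F \<theta> x \<partial>angle_measure) \<partial>lborel) = C"
proof -
  interpret pair_sigma_finite angle_measure "lborel :: (real^2) measure" by (rule pair_sigma_finite_angle_measure)
  have "(\<lambda>(\<theta>, x). F \<theta> x) \<in> borel_measurable (angle_measure \<Otimes>\<^sub>M lborel)"
    using F by (simp add: measurable_cong_sets[OF sets_pair_measure_cong[OF sets_angle_measure sets_lborel] refl])
  from Fubini'[OF this] have "(\<integral>\<^sup>+x. (\<integral>\<^sup>+\<theta>. F \<theta> x \<partial>angle_measure) \<partial>lborel) = (\<integral>\<^sup>+\<theta>. (\<integral>\<^sup>+x. F \<theta> x \<partial>lborel) \<partial>angle_measure)" by simp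
  also have "\<dots> = C" using prob_angle_measure by (simp add: inv)
  finally show ?thesis .
qed

lemma indicator_B_rot [simp]: "indicator B (rot \<theta> x) = indicator B x"
  by (simp add: indicator_def)

text \<open>A factor depending on norm x alone is unchanged by rotations, so the mean over circles
  can be undone under the planar integral.\<close>

lemma nn_integral_circle_mean:
  assumes G: "continuous_on UNIV G" "\<And>x. 0 \<le> G x" and [measurable]: "H \<in> borel_measurable borel"
  shows "(\<integral>\<^sup>+x. indicator B x * (ennreal (circle_mean G (norm x)) * H (norm x)) \<partial>lborel)
    = (\<integral>\<^sup>+x. indicator B x * (ennreal (G x) * H (norm x)) \<partial>lborel)"
proof -
  have [measurable]: "G \<in> borel_measurable borel" by (intro borel_measurable_continuous_onI G)
  have circle_mean: "ennreal (circle_mean G (norm x)) = (\<integral>\<^sup>+\<theta>. ennreal (G (rot \<theta> x)) \<partial>angle_measure)" for x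
    unfolding circle_mean_rot[OF G(1)]
    by (rule nn_integral_angle_measure_continuous[symmetric])
      (auto intro!: continuous_on_compose2[OF G(1)] continuous_intros G)
  have "(\<integral>\<^sup>+x. indicator B x * (ennreal (circle_mean G (norm x)) * H (norm x)) \<partial>lborel)
    = (\<integral>\<^sup>+x. (\<integral>\<^sup>+\<theta>. indicator B x * (ennreal (G (rot \<theta> x)) * H (norm x)) \<partial>angle_measure) \<partial>lborel)"
  proof (rule nn_integral_cong)
    fix x :: "real^2"
    have "(\<integral>\<^sup>+\<theta>. (indicator B x * H (norm x)) * ennreal (G (rot \<theta> x)) \<partial>angle_measure) = (indicator B x * H (norm x)) * (\<integral>\<^sup>+\<theta>. ennreal (G (rot \<theta> x)) \<partial>angle_measure)"
      by (rule nn_integral_cmult) measurable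
    then show "indicator B x * (ennreal (circle_mean G (norm x)) * H (norm x)) = (\<integral>\<^sup>+\<theta>. indicator B x * (ennreal (G (rot \<theta> x)) * H (norm x)) \<partial>angle_measure)"
      by (simp add: circle_mean mult_ac)
  qed
  also have "\<dots> = (\<integral>\<^sup>+x. indicator B x * (ennreal (G x) * H (norm x)) \<partial>lborel)"
  proof (rule nn_integral_rotate_average)
    show "(\<lambda>(\<theta>, x). indicator B x * (ennreal (G (rot \<theta> x)) * H (norm x))) \<in> borel_measurable (borel \<Otimes>\<^sub>M borel)"
      by measurable
    show "(\<integral>\<^sup>+x. indicator B x * (ennreal (G (rot \<theta> x)) * H (norm x)) \<partial>lborel) = (\<integral>\<^sup>+x. indicator B x * (ennreal (G x) * H (norm x)) \<partial>lborel)" for \<theta>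
      using nn_integral_rot[of "\<lambda>x. indicator B x * (ennreal (G x) * H (norm x))" \<theta>] by simp
  qed
  finally show ?thesis .
qed

lemma AE_rot:
  assumes "AE x in lborel. P x"
  shows "AE x in lborel. P (rot \<theta> x)"
proof -
  obtain N where N: "{x \<in> space lborel. \<not> P x} \<subseteq> N" "emeasure lborel N = 0" "N \<in> sets lborel"
    using assms by (rule AE_E)
  have Nb: "N \<in> sets borel" using N by simp
  have "emeasure (distr lborel borel (rot \<theta>)) N = emeasure lborel (rot \<theta> -` N \<inter> space lborel)"
    by (rule emeasure_distr) (use Nb in auto)
  then have "emeasure lborel (rot \<theta> -` N) = 0" using N by (simp add: lborel_distr_rot)
  moreover have "rot \<theta> -` N \<in> sets lborel"
    using measurable_sets[of "rot \<theta>" borel borel N] Nb by simp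
  ultimately have "rot \<theta> -` N \<in> null_sets lborel" by (simp add: null_sets_def)
  then show ?thesis by (rule AE_I') (use N in auto)
qed

text \<open>A radial u is rotation invariant up to null sets, so all rotated copies of f have the
  same distance from u, and by the triangle inequality their average is no further away. Hence
  circular means converge to u whenever the test functions do.\<close>

lemma circle_mean_L1_contraction:
  assumes f: "continuous_on UNIV f" and [measurable]: "u \<in> borel_measurable borel"
    and rad: "AE x in lborel. x \<in> B \<longrightarrow> u x = v (norm x)"
  shows "(\<integral>\<^sup>+x. indicator B x * ennreal \<bar>circle_mean f (norm x) - u x\<bar> \<partial>lborel)
    \<le> (\<integral>\<^sup>+x. indicator B x * ennreal \<bar>f x - u x\<bar> \<partial>lborel)"
proof -
  have [measurable]: "f \<in> borel_measurable borel" by (intro borel_measurable_continuous_onI f)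
  have 1: "ennreal \<bar>circle_mean f (norm x) - c\<bar> \<le> (\<integral>\<^sup>+\<theta>. ennreal \<bar>f (rot \<theta> x) - c\<bar> \<partial>angle_measure)" for x c
  proof -
    have cont: "continuous_on S (\<lambda>\<theta>. f (rot \<theta> x))" for S
      by (intro continuous_on_compose2[OF f] continuous_intros) auto
    have "circle_mean f (norm x) - c = integral {0..2 * pi} (\<lambda>\<theta>. f (rot \<theta> x) - c) / (2 * pi)"
      unfolding circle_mean_rot[OF f]
      by (subst Henstock_Kurzweil_Integration.integral_diff) (auto intro!: integrable_continuous_real cont simp: field_simps)
    then have "\<bar>circle_mean f (norm x) - c\<bar> = \<bar>integral {0..2 * pi} (\<lambda>\<theta>. f (rot \<theta> x) - c)\<bar> / (2 * pi)" by simp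
    also have "\<dots> \<le> integral {0..2 * pi} (\<lambda>\<theta>. \<bar>f (rot \<theta> x) - c\<bar>) / (2 * pi)"
    proof (intro divide_right_mono)
      have "norm (integral {0..2 * pi} (\<lambda>\<theta>. f (rot \<theta> x) - c)) \<le> integral {0..2 * pi} (\<lambda>\<theta>. \<bar>f (rot \<theta> x) - c\<bar>)"
        by (rule integral_norm_bound_integral) (auto intro!: integrable_continuous_real continuous_intros cont)
      then show "\<bar>integral {0..2 * pi} (\<lambda>\<theta>. f (rot \<theta> x) - c)\<bar> \<le> integral {0..2 * pi} (\<lambda>\<theta>. \<bar>f (rot \<theta> x) - c\<bar>)"
        by simp
    qed simp
    finally have "ennreal \<bar>circle_mean f (norm x) - c\<bar> \<le> ennreal (integral {0..2 * pi} (\<lambda>\<theta>. \<bar>f (rot \<theta> x) - c\<bar>) / (2 * pi))"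
      by (rule ennreal_leI)
    also have "\<dots> = (\<integral>\<^sup>+\<theta>. ennreal \<bar>f (rot \<theta> x) - c\<bar> \<partial>angle_measure)"
      by (rule nn_integral_angle_measure_continuous[symmetric]) (auto intro!: continuous_intros cont)
    finally show ?thesis .
  qed
  have "(\<integral>\<^sup>+x. indicator B x * ennreal \<bar>circle_mean f (norm x) - u x\<bar> \<partial>lborel)
    \<le> (\<integral>\<^sup>+x. (\<integral>\<^sup>+\<theta>. indicator B x * ennreal \<bar>f (rot \<theta> x) - u x\<bar> \<partial>angle_measure) \<partial>lborel)"
    by (intro nn_integral_mono) (auto simp: nn_integral_cmult intro!: mult_left_mono 1)
  also have "\<dots> = (\<integral>\<^sup>+x. indicator B x * ennreal \<bar>f x - u x\<bar> \<partial>lborel)"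
  proof (rule nn_integral_rotate_average)
    show "(\<lambda>(\<theta>, x). indicator B x * ennreal \<bar>f (rot \<theta> x) - u x\<bar>) \<in> borel_measurable (borel \<Otimes>\<^sub>M borel)"
      by measurable
    fix \<theta>
    have "(\<integral>\<^sup>+x. indicator B x * ennreal \<bar>f (rot \<theta> x) - u x\<bar> \<partial>lborel) = (\<integral>\<^sup>+x. indicator B (rot \<theta> x) * ennreal \<bar>f (rot \<theta> x) - u (rot \<theta> x)\<bar> \<partial>lborel)"
      \<comment> \<open>The radial form is used at x and at the rotated point; each holds outside a
        null set, and the two points have the same norm.\<close>
      using rad AE_rot[OF rad, of \<theta>]
      by (intro nn_integral_cong_AE, eventually_elim) (auto simp: indicator_def)
    also have "\<dots> = (\<integral>\<^sup>+x. indicator B x * ennreal \<bar>f x - u x\<bar> \<partial>lborel)"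
      by (rule nn_integral_rot) measurable
    finally show "(\<integral>\<^sup>+x. indicator B x * ennreal \<bar>f (rot \<theta> x) - u x\<bar> \<partial>lborel) = (\<integral>\<^sup>+x. indicator B x * ennreal \<bar>f x - u x\<bar> \<partial>lborel)" .
  qed
  finally show ?thesis .
qed

text \<open>Jensen's inequality for the square, from integrating
  \<open>(g \<theta> - m)\<^sup>2 \<ge> 0\<close> with m the mean of g.\<close>

lemma circle_mean_square_le:
  assumes cont: "continuous_on {0..2 * pi} g"
  shows "(integral {0..2 * pi} g / (2 * pi))\<^sup>2 \<le> integral {0..2 * pi} (\<lambda>\<theta>. (g \<theta>)\<^sup>2) / (2 * pi)"
proof -
  define m where "m = integral {0..2 * pi} g / (2 * pi)"
  have m: "integral {0..2 * pi} g = m * (2 * pi)" by (simp add: m_def)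
  have g: "g integrable_on {0..2 * pi}" "(\<lambda>\<theta>. (g \<theta>)\<^sup>2) integrable_on {0..2 * pi}"
    by (intro integrable_continuous_real continuous_intros cont)+
  have "((\<lambda>\<theta>. (g \<theta>)\<^sup>2 - 2 * m * g \<theta> + m\<^sup>2) has_integral
     (integral {0..2 * pi} (\<lambda>\<theta>. (g \<theta>)\<^sup>2) - 2 * m * (integral {0..2 * pi} g) + (2 * pi - 0) *\<^sub>R m\<^sup>2)) {0..2 * pi}"
    using g has_integral_const_real[of "m\<^sup>2" 0 "2 * pi"]
    by (intro has_integral_add has_integral_diff has_integral_mult_right integrable_integral) (auto simp: mult.commute)
  then have "0 \<le> integral {0..2 * pi} (\<lambda>\<theta>. (g \<theta>)\<^sup>2) - 2 * m * (integral {0..2 * pi} g) + (2 * pi - 0) *\<^sub>R m\<^sup>2"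
  proof (rule has_integral_nonneg)
    fix \<theta>
    have "(g \<theta>)\<^sup>2 - 2 * m * g \<theta> + m\<^sup>2 = (g \<theta> - m)\<^sup>2" by (simp add: power2_eq_square algebra_simps)
    then show "0 \<le> (g \<theta>)\<^sup>2 - 2 * m * g \<theta> + m\<^sup>2" by simp
  qed
  then have "m\<^sup>2 * (2 * pi) \<le> integral {0..2 * pi} (\<lambda>\<theta>. (g \<theta>)\<^sup>2)"
    unfolding m by (simp add: power2_eq_square algebra_simps)
  then show ?thesis unfolding m_def[symmetric] by (simp add: field_simps)
qed

definition circle_mean' :: "(real^2 \<Rightarrow> real) \<Rightarrow> real \<Rightarrow> real"
  where "circle_mean' f r = integral {0..2 * pi} (\<lambda>\<theta>. unit_vec \<theta> \<bullet> grad f (r *\<^sub>R unit_vec \<theta>)) / (2 * pi)"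

lemma DERIV_circle_mean:
  assumes f: "f \<in> test_functions"
  shows "(circle_mean f has_real_derivative circle_mean' f r) (at r)"
proof -
  have "((\<lambda>r. integral (cbox 0 (2 * pi)) (\<lambda>\<theta>. f (r *\<^sub>R unit_vec \<theta>))) has_field_derivative
    integral (cbox 0 (2 * pi)) (\<lambda>\<theta>. unit_vec \<theta> \<bullet> grad f (r *\<^sub>R unit_vec \<theta>))) (at r within UNIV)"
  proof (rule leibniz_rule_field_derivative)
    fix r \<theta> :: real
    have "((\<lambda>r. r *\<^sub>R unit_vec \<theta>) has_derivative (\<lambda>t. t *\<^sub>R unit_vec \<theta>)) (at r)"
      by (auto intro!: derivative_eq_intros)
    moreover have "(f has_derivative (\<lambda>k. k \<bullet> grad f (r *\<^sub>R unit_vec \<theta>))) (at (r *\<^sub>R unit_vec \<theta>))"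
      using test_GDERIV[OF f] by (simp add: gderiv_def)
    ultimately have "((\<lambda>r. f (r *\<^sub>R unit_vec \<theta>)) has_derivative (\<lambda>t. (t *\<^sub>R unit_vec \<theta>) \<bullet> grad f (r *\<^sub>R unit_vec \<theta>))) (at r)"
      by (rule has_derivative_compose)
    then show "((\<lambda>r. f (r *\<^sub>R unit_vec \<theta>)) has_real_derivative unit_vec \<theta> \<bullet> grad f (r *\<^sub>R unit_vec \<theta>)) (at r within UNIV)"
      by (simp add: has_field_derivative_def mult_commute_abs)
  next
    show "(\<lambda>\<theta>. f (r *\<^sub>R unit_vec \<theta>)) integrable_on cbox 0 (2 * pi)" for r
      by (intro integrable_continuous continuous_on_compose2[OF test_continuous[OF f, of UNIV]] continuous_intros) auto
    show "continuous_on (UNIV \<times> cbox 0 (2 * pi)) (\<lambda>(r, \<theta>). unit_vec \<theta> \<bullet> grad f (r *\<^sub>R unit_vec \<theta>))"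
      unfolding split_beta
      by (intro continuous_intros continuous_on_compose2[OF test_grad_continuous[OF f, of UNIV]]) auto
  qed auto
  from DERIV_cdivide[OF this, of "2 * pi"] show ?thesis
    unfolding circle_mean_def[abs_def] circle_mean'_def by simp
qed

lemma continuous_circle_mean':
  assumes f: "f \<in> test_functions"
  shows "continuous_on UNIV (circle_mean' f)"
proof -
  have "continuous_on UNIV (\<lambda>r. integral (cbox 0 (2 * pi)) (\<lambda>\<theta>. unit_vec \<theta> \<bullet> grad f (r *\<^sub>R unit_vec \<theta>)))"
    by (rule integral_continuous_on_param)
      (auto simp: split_beta intro!: continuous_intros continuous_on_compose2[OF test_grad_continuous[OF f, of UNIV]])
  then show ?thesis unfolding circle_mean'_def[abs_def] by (auto intro!: continuous_intros)
qed

text \<open>Jensen's inequality on the circle after dropping the angular part of the gradient. This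
  is why passing to circular means does not increase the Dirichlet energy.\<close>

lemma circle_mean'_square_le:
  assumes f: "f \<in> test_functions"
  shows "(circle_mean' f r)\<^sup>2 \<le> circle_mean (\<lambda>x. (norm (grad f x))\<^sup>2) r"
proof -
  have cont: "continuous_on S (\<lambda>\<theta>. grad f (r *\<^sub>R unit_vec \<theta>))" for S
    by (intro continuous_on_compose2[OF test_grad_continuous[OF f, of UNIV]] continuous_intros) auto
  have "(circle_mean' f r)\<^sup>2 \<le> integral {0..2 * pi} (\<lambda>\<theta>. (unit_vec \<theta> \<bullet> grad f (r *\<^sub>R unit_vec \<theta>))\<^sup>2) / (2 * pi)"
    unfolding circle_mean'_def by (intro circle_mean_square_le continuous_intros cont)
  also have "\<dots> \<le> integral {0..2 * pi} (\<lambda>\<theta>. (norm (grad f (r *\<^sub>R unit_vec \<theta>)))\<^sup>2) / (2 * pi)"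
  proof (intro divide_right_mono integral_le integrable_continuous_real continuous_intros cont)
    fix \<theta>
    have "\<bar>unit_vec \<theta> \<bullet> grad f (r *\<^sub>R unit_vec \<theta>)\<bar> \<le> norm (grad f (r *\<^sub>R unit_vec \<theta>))"
      using Cauchy_Schwarz_ineq2[of "unit_vec \<theta>" "grad f (r *\<^sub>R unit_vec \<theta>)"] by simp
    then show "(unit_vec \<theta> \<bullet> grad f (r *\<^sub>R unit_vec \<theta>))\<^sup>2 \<le> (norm (grad f (r *\<^sub>R unit_vec \<theta>)))\<^sup>2"
      by (metis abs_ge_zero power2_abs power_mono)
  qed simp
  finally show ?thesis by (simp add: circle_mean_def)
qed

section \<open>Reduction to one variable\<close>

lemma alpha_pos: "\<beta> < 1 \<Longrightarrow> 0 < alpha \<beta>"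
  by (simp add: alpha_def)

text \<open>The factor between u and w for which
  \<open>alpha \<beta> * \<bar>u\<bar> powr (2 / (1 - \<beta>))\<close> becomes
  \<open>\<bar>w\<bar> powr (2 / (1 - \<beta>))\<close>.\<close>

definition profile_scale :: "real \<Rightarrow> real"
  where "profile_scale \<beta> = alpha \<beta> powr ((1 - \<beta>) / 2)"

lemma profile_scale_pos: "\<beta> < 1 \<Longrightarrow> 0 < profile_scale \<beta>"
  using alpha_pos[of \<beta>] by (auto simp: profile_scale_def)

lemma profile_scale_powr: "\<beta> < 1 \<Longrightarrow> profile_scale \<beta> powr (2 / (1 - \<beta>)) = alpha \<beta>"
proof -
  assume \<beta>: "\<beta> < 1"
  then have "(1 - \<beta>) / 2 * (2 / (1 - \<beta>)) = 1" by simp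
  then show ?thesis unfolding profile_scale_def powr_powr using alpha_pos[OF \<beta>] by (simp only: powr_one)
qed

text \<open>The value of \<open>alpha\<close> reaches the energy through this identity: the scale
  that normalises the exponent also turns the unit ball of the weighted norm into profiles of energy
  at most 1. This is what makes the exponent critical.\<close>

lemma profile_scale_sq: "\<beta> < 1 \<Longrightarrow> (profile_scale \<beta>)\<^sup>2 = 2 powr (1 - \<beta>) * (2 * pi * (1 - \<beta>))"
proof -
  assume \<beta>: "\<beta> < 1"
  have "(profile_scale \<beta>)\<^sup>2 = alpha \<beta> powr (1 - \<beta>)"
    using alpha_pos[OF \<beta>] by (simp add: profile_scale_def power2_eq_square flip: powr_add)
  also have "\<dots> = 2 powr (1 - \<beta>) * ((2 * pi * (1 - \<beta>)) powr (1 / (1 - \<beta>))) powr (1 - \<beta>)"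
    unfolding alpha_def by (rule powr_mult)
  also have "((2 * pi * (1 - \<beta>)) powr (1 / (1 - \<beta>))) powr (1 - \<beta>) = 2 * pi * (1 - \<beta>)"
    using \<beta> by (simp add: powr_powr)
  finally show ?thesis .
qed

lemma emeasure_lebesgue_B: "emeasure lebesgue B = ennreal pi"
proof -
  have "emeasure lebesgue B = emeasure lborel B" by simp
  also have "\<dots> = ennreal pi" by (subst emeasure_ball) (auto simp: unit_ball_vol_2)
  finally show ?thesis .
qed

lemma J_radial:
  assumes \<beta>: "\<beta> < 1" and [measurable]: "W \<in> borel_measurable borel"
  shows "J \<beta> (\<lambda>x. W (- 2 * ln (norm x)) / profile_scale \<beta>) = moser (1 - \<beta>) W"
proof -
  have eq: "alpha \<beta> * \<bar>s / profile_scale \<beta>\<bar> powr (2 / (1 - \<beta>)) = \<bar>s\<bar> powr (2 / (1 - \<beta>))" for s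
    using profile_scale_pos[OF \<beta>] profile_scale_powr[OF \<beta>] alpha_pos[OF \<beta>] by (simp add: abs_divide powr_divide)
  have "(\<integral>\<^sup>+x. ennreal (exp (alpha \<beta> * \<bar>W (- 2 * ln (norm x)) / profile_scale \<beta>\<bar> powr (2 / (1 - \<beta>)))) \<partial>lebesgue_on B)
    = (\<integral>\<^sup>+x. indicator B x * ennreal (exp (\<bar>W (- 2 * ln (norm x))\<bar> powr (2 / (1 - \<beta>)))) \<partial>lborel)"
    unfolding eq by (rule nn_integral_lebesgue_on_B) measurable
  also have "\<dots> = ennreal pi * (\<integral>\<^sup>+t. indicator {0<..} t * (ennreal (exp (- t)) * ennreal (exp (\<bar>W t\<bar> powr (2 / (1 - \<beta>))))) \<partial>lborel)"
    by (rule nn_integral_ball_radial[of "\<lambda>t. ennreal (exp (\<bar>W t\<bar> powr (2 / (1 - \<beta>))))"]) measurable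
  also have "(\<integral>\<^sup>+t. indicator {0<..} t * (ennreal (exp (- t)) * ennreal (exp (\<bar>W t\<bar> powr (2 / (1 - \<beta>))))) \<partial>lborel) = moser (1 - \<beta>) W"
    unfolding moser_def by (intro nn_integral_cong) (simp add: ennreal_mult'[symmetric] flip: exp_add)
  finally show ?thesis
    unfolding J_def emeasure_lebesgue_B
    using mult_divide_eq_ennreal[of "ennreal pi" "moser (1 - \<beta>) W"] by (simp add: mult.commute)
qed

lemma J_cong_AE: "AE x in lebesgue_on B. u x = v x \<Longrightarrow> J \<beta> u = J \<beta> v"
proof -
  assume uv: "AE x in lebesgue_on B. u x = v x"
  have "(\<integral>\<^sup>+x. ennreal (exp (alpha \<beta> * \<bar>u x\<bar> powr (2 / (1 - \<beta>)))) \<partial>lebesgue_on B)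
    = (\<integral>\<^sup>+x. ennreal (exp (alpha \<beta> * \<bar>v x\<bar> powr (2 / (1 - \<beta>)))) \<partial>lebesgue_on B)"
    by (rule nn_integral_cong_AE) (use uv in eventually_elim, simp)
  then show ?thesis by (simp add: J_def)
qed

definition mean_profile :: "real \<Rightarrow> (real^2 \<Rightarrow> real) \<Rightarrow> real \<Rightarrow> real"
  where "mean_profile \<beta> f t = profile_scale \<beta> * circle_mean f (exp (- t / 2))"

definition mean_profile' :: "real \<Rightarrow> (real^2 \<Rightarrow> real) \<Rightarrow> real \<Rightarrow> real"
  where "mean_profile' \<beta> f t = - (profile_scale \<beta> / 2) * (exp (- t / 2) * circle_mean' f (exp (- t / 2)))"

lemma test_norm_nn_integral:
  assumes \<beta>: "0 \<le> \<beta>" "\<beta> < 1" and f: "f \<in> test_functions"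
  shows "(\<integral>\<^sup>+x. ennreal ((norm (grad f x))\<^sup>2 * weight \<beta> x) \<partial>lebesgue_on B) = ennreal ((test_norm \<beta> f)\<^sup>2)"
proof -
  define G where "G x = (norm (grad f x))\<^sup>2" for x
  have [measurable]: "G \<in> borel_measurable borel" unfolding G_def
    by (intro borel_measurable_continuous_onI continuous_intros test_grad_continuous f)
  have int: "integrable (weight_measure \<beta>) G"
    using bounded_fields_integrable[OF \<beta> test_grad_bounded_fields[OF f] test_grad_bounded_fields[OF f]] by (simp add: G_def[abs_def] power2_norm_eq_inner)
  have "(\<integral>\<^sup>+x. ennreal (G x * weight \<beta> x) \<partial>lebesgue_on B) = (\<integral>\<^sup>+x. ennreal (G x) \<partial>weight_measure \<beta>)"
    unfolding weight_measure_def
    by (subst nn_integral_density)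
      (auto intro!: borel_measurable_lebesgue_on nn_integral_cong simp: weight_def ennreal_mult'' mult.commute)
  also have "\<dots> = ennreal (LINT x|weight_measure \<beta>. G x)" by (rule nn_integral_eq_integral[OF int]) (simp add: G_def)
  also have "(LINT x|weight_measure \<beta>. G x) = (test_norm \<beta> f)\<^sup>2"
    by (simp add: test_norm_sq[OF f] field_inner_def G_def power2_norm_eq_inner)
  finally show ?thesis by (simp add: G_def)
qed

text \<open>Up to the factor pi the energy of the profile is the weighted integral of the squared
  radial derivative of the circular mean, and this is at most the weighted integral of the squared
  gradient. The factor pi from \<open>nn_integral_ball_radial\<close> is carried on both sides and
  cancelled at the end.\<close>

lemma test_profile:
  assumes \<beta>: "0 \<le> \<beta>" "\<beta> < 1" and f: "f \<in> test_functions" and norm: "test_norm \<beta> f \<le> 1"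
  shows "profile (1 - \<beta>) (mean_profile \<beta> f) (mean_profile' \<beta> f)"
  unfolding profile_def
proof (intro conjI allI)
  show "(mean_profile \<beta> f has_real_derivative mean_profile' \<beta> f t) (at t)" for t
    unfolding mean_profile_def[abs_def] mean_profile'_def
    by (rule derivative_eq_intros DERIV_chain2[OF DERIV_circle_mean[OF f]] refl | simp)+
  have [measurable]: "circle_mean' f \<in> borel_measurable borel"
    by (intro borel_measurable_continuous_onI continuous_circle_mean' f)
  show "continuous_on UNIV (mean_profile' \<beta> f)"
    unfolding mean_profile'_def[abs_def]
    by (intro continuous_intros continuous_on_compose2[OF continuous_circle_mean'[OF f]]) auto
  obtain \<rho> where \<rho>: "0 < \<rho>" "\<rho> < 1" "\<And>x. \<rho> < norm x \<Longrightarrow> f x = 0" "\<And>x. \<rho> < norm x \<Longrightarrow> grad f x = 0"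
    by (rule test_support[OF f]) (rule that)
  have "f (1 *\<^sub>R unit_vec \<theta>) = 0" for \<theta> by (rule \<rho>(3)) (use \<rho> in simp)
  then show "mean_profile \<beta> f 0 = 0" by (simp add: mean_profile_def circle_mean_def)
  define G where "G x = (norm (grad f x))\<^sup>2" for x
  have contG: "continuous_on UNIV G" unfolding G_def by (intro continuous_intros test_grad_continuous f)
  have [measurable]: "G \<in> borel_measurable borel" by (intro borel_measurable_continuous_onI contG)
  \<comment> \<open>Collects the squared scale, the 1 / 4 from differentiating exp (- t / 2) and the
    1 / q of \<open>energy\<close>, with q = 1 - \<beta>.\<close>
  define k where "k = (profile_scale \<beta>)\<^sup>2 / (4 * (1 - \<beta>))"
  have k: "k = 2 powr (1 - \<beta>) * (pi / 2)"
  proof -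
    have "A * (2 * pi * c) / (4 * c) = A * (pi / 2)" if "c \<noteq> 0" for A c :: real
      using that by (simp add: field_simps)
    from this[of "1 - \<beta>"] show ?thesis unfolding k_def profile_scale_sq[OF \<beta>(2)] using \<beta> by simp
  qed
  define H where "H t = ennreal (k * (t powr \<beta> * (circle_mean' f (exp (- t / 2)))\<^sup>2))" for t
  have [measurable]: "H \<in> borel_measurable borel" unfolding H_def[abs_def] by measurable
  have e2: "exp (- t / 2) * exp (- t / 2) = exp (- t)" for t :: real by (simp flip: exp_add)
  have "ennreal pi * energy (1 - \<beta>) (mean_profile' \<beta> f) = ennreal pi * (\<integral>\<^sup>+t. indicator {0<..} t * (ennreal (exp (- t)) * H t) \<partial>lborel)"
  proof -
    have "t powr (1 - (1 - \<beta>)) * (mean_profile' \<beta> f t)\<^sup>2 / (1 - \<beta>) = exp (- t) * (k * (t powr \<beta> * (circle_mean' f (exp (- t / 2)))\<^sup>2))" for t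
      unfolding e2[symmetric] mean_profile'_def k_def by (simp add: power_mult_distrib power2_eq_square field_simps)
    then show ?thesis unfolding energy_def H_def by (simp add: ennreal_mult'[symmetric])
  qed
  also have "\<dots> = (\<integral>\<^sup>+x. indicator B x * H (- 2 * ln (norm x)) \<partial>lborel)"
    by (rule nn_integral_ball_radial[symmetric]) measurable
  also have "\<dots> = (\<integral>\<^sup>+x. indicator B x * (ennreal ((circle_mean' f (norm x))\<^sup>2) * ennreal (pi * \<bar>ln (norm x)\<bar> powr \<beta>)) \<partial>lborel)"
  proof (rule nn_integral_cong_AE)
    show "AE x in lborel. indicator B x * H (- 2 * ln (norm x)) = indicator B x * (ennreal ((circle_mean' f (norm x))\<^sup>2) * ennreal (pi * \<bar>ln (norm x)\<bar> powr \<beta>))"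
      using AE_lborel_singleton[of "0::real^2"]
    proof eventually_elim
      case (elim x)
      show ?case
      proof (cases "x \<in> B")
        case True
        have ln: "ln (norm x) < 0" using True elim by simp
        define A L C where "A = (2::real) powr (1 - \<beta>)" and "L = \<bar>ln (norm x)\<bar> powr \<beta>" and "C = (circle_mean' f (norm x))\<^sup>2"
        have 1: "(- 2 * ln (norm x)) powr \<beta> = 2 powr \<beta> * L"
          using powr_mult[of 2 "- ln (norm x)" \<beta>] ln by (simp add: L_def)
        \<comment> \<open>The substitution t = - 2 * ln r contributes 2 powr \<beta>, which combines
          with the 2 powr (1 - \<beta>) in k to give 2, so that only pi remains.\<close>
        have 2: "A * 2 powr \<beta> = 2" unfolding A_def by (simp flip: powr_add)
        have 3: "exp (- (- 2 * ln (norm x)) / 2) = norm x" using elim by simp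
        have "k * ((2 powr \<beta> * L) * C) = (A * 2 powr \<beta>) * (pi / 2 * (C * L))"
          by (simp only: k A_def[symmetric] mult_ac)
        then have "k * ((- 2 * ln (norm x)) powr \<beta> * (circle_mean' f (exp (- (- 2 * ln (norm x)) / 2)))\<^sup>2) = C * (pi * L)"
          unfolding 1 2 3 C_def[symmetric] by simp
        then have "H (- 2 * ln (norm x)) = ennreal (C * (pi * L))" unfolding H_def by simp
        also have "\<dots> = ennreal C * ennreal (pi * L)" by (rule ennreal_mult') (simp add: C_def)
        finally show ?thesis by (simp add: C_def L_def)
      qed simp
    qed
  qed
  also have "\<dots> \<le> (\<integral>\<^sup>+x. indicator B x * (ennreal (circle_mean G (norm x)) * ennreal (pi * \<bar>ln (norm x)\<bar> powr \<beta>)) \<partial>lborel)"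
    using circle_mean'_square_le[OF f] unfolding G_def
    by (intro nn_integral_mono mult_left_mono mult_right_mono ennreal_leI) auto
  also have "\<dots> = (\<integral>\<^sup>+x. indicator B x * (ennreal (G x) * ennreal (pi * \<bar>ln (norm x)\<bar> powr \<beta>)) \<partial>lborel)"
    by (rule nn_integral_circle_mean[OF contG, of "\<lambda>r. ennreal (pi * \<bar>ln r\<bar> powr \<beta>)"]) (auto simp: G_def)
  also have "\<dots> = (\<integral>\<^sup>+x. ennreal pi * ennreal (G x * weight \<beta> x) \<partial>lebesgue_on B)"
    by (subst nn_integral_lebesgue_on_B, measurable)
      (auto simp: weight_def G_def ennreal_mult'[symmetric] mult_ac intro!: nn_integral_cong)
  also have "\<dots> = ennreal pi * (\<integral>\<^sup>+x. ennreal (G x * weight \<beta> x) \<partial>lebesgue_on B)"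
    by (intro nn_integral_cmult borel_measurable_lebesgue_on) measurable
  also have "(\<integral>\<^sup>+x. ennreal (G x * weight \<beta> x) \<partial>lebesgue_on B) = ennreal ((test_norm \<beta> f)\<^sup>2)"
    unfolding G_def by (rule test_norm_nn_integral[OF \<beta> f])
  finally have "ennreal pi * energy (1 - \<beta>) (mean_profile' \<beta> f) \<le> ennreal pi * ennreal ((test_norm \<beta> f)\<^sup>2)" .
  then have "energy (1 - \<beta>) (mean_profile' \<beta> f) \<le> ennreal ((test_norm \<beta> f)\<^sup>2)"
    by (subst (asm) ennreal_mult_le_mult_iff) auto
  also have "\<dots> \<le> 1" using norm test_norm_nonneg[of \<beta> f] by (simp add: power_le_one ennreal_le_1)
  finally show "energy (1 - \<beta>) (mean_profile' \<beta> f) \<le> 1" .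
qed

lemma continuous_circle_mean:
  assumes f: "f \<in> test_functions"
  shows "continuous_on UNIV (circle_mean f)"
  by (rule DERIV_continuous_on[where D="circle_mean' f"]) (use DERIV_circle_mean[OF f] in simp)

lemma circle_mean_norm_continuous:
  assumes f: "f \<in> test_functions"
  shows "continuous_on S (\<lambda>x::real^2. circle_mean f (norm x))"
  by (rule continuous_on_compose2[OF continuous_circle_mean[OF f]]) (auto intro: continuous_intros)

lemma circle_mean_mean_profile:
  assumes "\<beta> < 1" "x \<noteq> 0"
  shows "circle_mean f (norm x) = mean_profile \<beta> f (- 2 * ln (norm x)) / profile_scale \<beta>"
  using assms profile_scale_pos[of \<beta>] by (simp add: mean_profile_def)

lemma AE_lebesgue_on_B:
  assumes "AE x in lborel. x \<in> B \<longrightarrow> P x"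
  shows "AE x in lebesgue_on B. P x"
proof -
  have "AE x in lebesgue. x \<in> B \<longrightarrow> P x" using assms by (rule AE_completion)
  then show ?thesis by (subst AE_restrict_space_iff) auto
qed

lemma AE_lebesgue_on_B_nonzero: "AE x in lebesgue_on B. x \<noteq> 0"
proof (rule AE_lebesgue_on_B)
  show "AE x in lborel. x \<in> B \<longrightarrow> x \<noteq> 0"
    using AE_lborel_singleton[of "0::real^2"] by eventually_elim simp
qed

lemma J_circle_mean:
  assumes \<beta>: "0 \<le> \<beta>" "\<beta> < 1" and f: "f \<in> test_functions"
  shows "J \<beta> (\<lambda>x. circle_mean f (norm x)) = moser (1 - \<beta>) (mean_profile \<beta> f)"
proof -
  have "J \<beta> (\<lambda>x. circle_mean f (norm x)) = J \<beta> (\<lambda>x. mean_profile \<beta> f (- 2 * ln (norm x)) / profile_scale \<beta>)"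
  proof (rule J_cong_AE)
    show "AE x in lebesgue_on B. circle_mean f (norm x) = mean_profile \<beta> f (- 2 * ln (norm x)) / profile_scale \<beta>"
      using AE_lebesgue_on_B_nonzero by eventually_elim (rule circle_mean_mean_profile[OF \<beta>(2)])
  qed
  also have "\<dots> = moser (1 - \<beta>) (mean_profile \<beta> f)"
  proof (rule J_radial[OF \<beta>(2)])
    have "continuous_on UNIV (\<lambda>t. circle_mean f (exp (- t / 2)))"
      by (rule continuous_on_compose2[OF continuous_circle_mean[OF f]]) (auto intro!: continuous_intros)
    then show "mean_profile \<beta> f \<in> borel_measurable borel" unfolding mean_profile_def[abs_def]
      by (intro borel_measurable_continuous_onI continuous_intros)
  qed
  finally show ?thesis .
qed

section \<open>The unit ball of the radial space\<close>

definition L1_dist :: "(real^2 \<Rightarrow> real) \<Rightarrow> (real^2 \<Rightarrow> real) \<Rightarrow> real"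
  where "L1_dist f u = (LINT x|lebesgue_on B. \<bar>f x - u x\<bar>)"

lemma L1_dist_nonneg: "0 \<le> L1_dist f u"
  unfolding L1_dist_def by simp

lemma L1_dist_triangle:
  assumes "integrable (lebesgue_on B) f" "integrable (lebesgue_on B) g" "integrable (lebesgue_on B) h"
  shows "L1_dist f h \<le> L1_dist f g + L1_dist g h"
proof -
  have "L1_dist f h \<le> (LINT x|lebesgue_on B. \<bar>f x - g x\<bar> + \<bar>g x - h x\<bar>)"
    unfolding L1_dist_def using assms by (intro integral_mono) auto
  also have "\<dots> = L1_dist f g + L1_dist g h" unfolding L1_dist_def using assms by (intro Bochner_Integration.integral_add) auto
  finally show ?thesis .
qed

lemma L1_dist_lin:
  assumes "integrable (lebesgue_on B) f" "integrable (lebesgue_on B) g" "integrable (lebesgue_on B) u"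
    and ab: "0 \<le> a" "0 \<le> b" "a + b = 1"
  shows "L1_dist (\<lambda>x. a * f x + b * g x) u \<le> a * L1_dist f u + b * L1_dist g u"
proof -
  have "L1_dist (\<lambda>x. a * f x + b * g x) u \<le> (LINT x|lebesgue_on B. a * \<bar>f x - u x\<bar> + b * \<bar>g x - u x\<bar>)"
    unfolding L1_dist_def
  proof (intro integral_mono)
    fix x
    have "u x = a * u x + b * u x" using ab(3) by (simp flip: distrib_right)
    then have "a * f x + b * g x - u x = a * (f x - u x) + b * (g x - u x)" by (simp add: algebra_simps)
    then have "\<bar>a * f x + b * g x - u x\<bar> \<le> \<bar>a * (f x - u x)\<bar> + \<bar>b * (g x - u x)\<bar>" by simp
    then show "\<bar>a * f x + b * g x - u x\<bar> \<le> a * \<bar>f x - u x\<bar> + b * \<bar>g x - u x\<bar>"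
      using ab by (simp add: abs_mult)
  qed (use assms in auto)
  also have "\<dots> = a * L1_dist f u + b * L1_dist g u" unfolding L1_dist_def using assms
    by (subst Bochner_Integration.integral_add) auto
  finally show ?thesis .
qed

lemma test_scale: "f \<in> test_functions \<Longrightarrow> (\<lambda>x. a * f x) \<in> test_functions"
  using test_linear[of f f a 0] by simp

text \<open>The set of admissible approximants is convex, so a sequence of almost minimisers of the norm
  over its shrinking parts is Cauchy by the parallelogram law: no weak compactness is needed.\<close>

lemma H10_unit_ball_closed:
  assumes \<beta>: "0 \<le> \<beta>" "\<beta> < 1" and U: "integrable (lebesgue_on B) U"
    and approx: "\<And>e. 0 < e \<Longrightarrow> \<exists>f\<in>test_functions. test_norm \<beta> f \<le> 1 \<and> L1_dist f U < e"
  shows "U \<in> H10 \<beta>" "H10_norm \<beta> U \<le> 1"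
proof -
  define C where "C n = {f \<in> test_functions. test_norm \<beta> f \<le> 1 \<and> L1_dist f U \<le> 1 / real (Suc n)}" for n
  define Q where "Q f = (test_norm \<beta> f)\<^sup>2" for f
  define d where "d n = Inf (Q ` C n)" for n
  have Cne: "C n \<noteq> {}" for n using approx[of "1 / real (Suc n)"] by (force simp: C_def)
  have bdd: "bdd_below (Q ` C n)" for n by (rule bdd_belowI[of _ 0]) (auto simp: Q_def)
  have dle: "d n \<le> Q f" if "f \<in> C n" for n f unfolding d_def by (intro cInf_lower bdd imageI that)
  have Cmono: "C m \<subseteq> C n" if "n \<le> m" for n m
  proof
    fix f assume f: "f \<in> C m"
    have "1 / real (Suc m) \<le> 1 / real (Suc n)" using that by (intro divide_left_mono) auto
    then show "f \<in> C n" using f by (auto simp: C_def)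
  qed
  have Q1: "Q f \<le> 1" if "f \<in> C n" for f n
    using that test_norm_nonneg[of \<beta> f] by (auto simp: Q_def C_def power_le_one)
  have "\<exists>f\<in>C n. Q f < d n + 1 / real (Suc n)" for n
    using cInf_lessD[of "Q ` C n" "d n + 1 / real (Suc n)"] Cne[of n] by (auto simp: d_def)
  then obtain y where y: "\<And>n. y n \<in> C n" "\<And>n. Q (y n) < d n + 1 / real (Suc n)" by metis
  have yt: "y n \<in> test_functions" for n using y(1) by (auto simp: C_def)
  \<comment> \<open>The sets C n shrink, so their infima increase; being bounded by 1 they converge,
    and the differences d m - d n in \<open>key\<close> become small.\<close>
  have incd: "incseq d"
    unfolding incseq_def d_def
    by (intro allI impI cInf_superset_mono image_mono Cmono bdd) (simp_all add: Cne)
  have d1: "d n \<le> 1" for n using dle[OF y(1)] Q1[OF y(1)] by (rule order_trans)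
  have Cd: "Cauchy d"
  proof -
    obtain L where "d \<longlonglongrightarrow> L" by (rule incseq_convergent[OF incd, of 1]) (use d1 in auto)
    then show ?thesis by (rule LIMSEQ_imp_Cauchy)
  qed
  have key: "(test_norm \<beta> (\<lambda>x. y m x - y n x))\<^sup>2 \<le> 2 * \<bar>d m - d n\<bar> + 4 / real (Suc N)" if mn: "N \<le> n" "n \<le> m" for N n m
  proof -
    have yC: "y n \<in> C n" "y m \<in> C n" using y(1) Cmono[OF mn(2)] by auto
    let ?h = "\<lambda>x. 1/2 * y m x + 1/2 * y n x"
    have hC: "?h \<in> C n"
    proof -
      have "test_norm \<beta> ?h \<le> \<bar>1/2\<bar> * test_norm \<beta> (y m) + \<bar>1/2\<bar> * test_norm \<beta> (y n)"
        by (rule test_norm_triangle[OF \<beta> yt yt])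
      moreover have "L1_dist ?h U \<le> 1/2 * L1_dist (y m) U + 1/2 * L1_dist (y n) U"
        by (rule L1_dist_lin) (auto intro: test_integrable yt U)
      ultimately show ?thesis using yC test_linear[OF yt yt, of "1/2" m "1/2" n] by (auto simp: C_def)
    qed
    have "(test_norm \<beta> (\<lambda>x. y m x - y n x))\<^sup>2 = 2 * Q (y m) + 2 * Q (y n) - 4 * Q ?h"
      using test_norm_parallelogram[OF \<beta> yt yt, of m n] by (simp add: Q_def)
    also have "\<dots> \<le> 2 * (d m + 1 / real (Suc m)) + 2 * (d n + 1 / real (Suc n)) - 4 * d n"
    proof -
      have "2 * a + 2 * b - 4 * c \<le> 2 * a' + 2 * b' - 4 * d'" if "a < a'" "b < b'" "d' \<le> c" for a b c a' b' d' :: real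
        using that by linarith
      from this[OF y(2) y(2) dle[OF hC]] show ?thesis .
    qed
    also have "\<dots> \<le> 2 * \<bar>d m - d n\<bar> + 4 / real (Suc N)"
    proof -
      have "1 / real (Suc m) \<le> 1 / real (Suc N)" "1 / real (Suc n) \<le> 1 / real (Suc N)"
        using mn by (intro divide_left_mono; simp)+
      moreover have "2 * (a + x) + 2 * (b + z) - 4 * b \<le> 2 * s + 4 * w" if "x \<le> w" "z \<le> w" "a - b \<le> s" for a b x z w s :: real
        using that by argo
      ultimately have "2 * (d m + 1 / real (Suc m)) + 2 * (d n + 1 / real (Suc n)) - 4 * d n \<le> 2 * \<bar>d m - d n\<bar> + 4 * (1 / real (Suc N))"
        using abs_ge_self by blast
      then show ?thesis by simp
    qed
    finally show ?thesis .
  qed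
  have sym: "test_norm \<beta> (\<lambda>x. y m x - y n x) = test_norm \<beta> (\<lambda>x. y n x - y m x)" for m n
  proof -
    have "(test_norm \<beta> (\<lambda>x. y m x - y n x))\<^sup>2 = (test_norm \<beta> (\<lambda>x. y n x - y m x))\<^sup>2"
      using test_norm_parallelogram[OF \<beta> yt yt, of m n] test_norm_parallelogram[OF \<beta> yt yt, of n m]
      by (simp add: add.commute)
    then show ?thesis by (simp add: test_norm_nonneg)
  qed
  have cau: "\<exists>N. \<forall>m\<ge>N. \<forall>n\<ge>N. test_norm \<beta> (\<lambda>x. y m x - y n x) < e" if e: "0 < e" for e
  proof -
    have e2: "0 < e\<^sup>2 / 4" using e by simp
    obtain N1 where N1: "\<And>m n. N1 \<le> m \<Longrightarrow> N1 \<le> n \<Longrightarrow> \<bar>d m - d n\<bar> < e\<^sup>2 / 4"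
      using metric_CauchyD[OF Cd e2] by (auto simp: dist_real_def)
    obtain N2 where N2: "4 / (e\<^sup>2 / 4) < real N2" using reals_Archimedean2 by blast
    define N where "N = max N1 N2"
    have "4 / (e\<^sup>2 / 4) < real (Suc N)" using N2 by (simp add: N_def)
    then have N': "4 / real (Suc N) < e\<^sup>2 / 4" using e2 by (simp add: field_simps)
    have *: "test_norm \<beta> (\<lambda>x. y m x - y n x) < e" if "N \<le> n" "n \<le> m" for m n
    proof -
      have "\<bar>d m - d n\<bar> < e\<^sup>2 / 4" using that by (intro N1) (auto simp: N_def)
      then have "(test_norm \<beta> (\<lambda>x. y m x - y n x))\<^sup>2 < e\<^sup>2"
      proof -
        have "T < 4 * c" if "T \<le> 2 * a + b" "a < c" "b < c" "0 < c" for T a b c :: real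
          using that by argo
        from this[OF key[OF that] \<open>\<bar>d m - d n\<bar> < e\<^sup>2 / 4\<close> N' e2] show ?thesis by simp
      qed
      then show ?thesis using e by (simp add: power_less_imp_less_base)
    qed
    have "test_norm \<beta> (\<lambda>x. y m x - y n x) < e" if "N \<le> n" "N \<le> m" for m n
      using *[of n m] *[of m n] that sym[of m n] by (cases "n \<le> m") auto
    then show ?thesis by blast
  qed
  have "(\<lambda>n. L1_dist (y n) U) \<longlonglongrightarrow> 0"
  proof (rule tendsto_sandwich[OF _ _ tendsto_const LIMSEQ_Suc[OF lim_1_over_n]])
    show "\<forall>\<^sub>F n in sequentially. 0 \<le> L1_dist (y n) U" by (simp add: L1_dist_nonneg)
    show "\<forall>\<^sub>F n in sequentially. L1_dist (y n) U \<le> 1 / real (Suc n)" using y(1) by (simp add: C_def)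
  qed
  then have rep: "represents \<beta> y U"
    unfolding represents_def using yt cau U by (simp add: L1_dist_def)
  then show "U \<in> H10 \<beta>" by (auto simp: H10_def)
  show "H10_norm \<beta> U \<le> 1"
    by (rule tendsto_upperbound[OF represents_norm_tendsto[OF \<beta> rep]]) (use y(1) in \<open>auto simp: C_def\<close>)
qed

text \<open>Norms along a representing sequence have a limit at most 1 but may themselves exceed 1,
  so each function is divided by the maximum of 1 and its norm; these divisors tend to 1.\<close>

lemma H10_unit_ball_approx:
  assumes \<beta>: "0 \<le> \<beta>" "\<beta> < 1" and u: "u \<in> H10 \<beta>" "H10_norm \<beta> u \<le> 1"
  obtains \<psi> where "\<And>n. \<psi> n \<in> test_functions" "\<And>n. test_norm \<beta> (\<psi> n) \<le> 1" "(\<lambda>n. L1_dist (\<psi> n) u) \<longlonglongrightarrow> 0"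
proof -
  obtain \<phi> where rep: "represents \<beta> \<phi> u" using u by (auto simp: H10_def)
  have \<phi>: "\<phi> n \<in> test_functions" for n using rep by (simp add: represents_def)
  have iu: "integrable (lebesgue_on B) u" using rep by (simp add: represents_def)
  define s where "s n = max 1 (test_norm \<beta> (\<phi> n))" for n
  have s: "1 \<le> s n" for n by (simp add: s_def)
  have "s \<longlonglongrightarrow> max 1 (H10_norm \<beta> u)"
    unfolding s_def by (intro tendsto_max tendsto_const represents_norm_tendsto[OF \<beta> rep])
  then have s1: "s \<longlonglongrightarrow> 1" using u(2) by (simp add: max.absorb1)
  have i1: "(\<lambda>n. 1 / s n) \<longlonglongrightarrow> 1 / 1" by (intro tendsto_divide tendsto_const s1) simp
  have s01: "0 \<le> 1 / s n" "0 \<le> 1 - 1 / s n" for n using s[of n] by auto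
  show ?thesis
  proof (rule that[of "\<lambda>n x. 1 / s n * \<phi> n x"])
    show "(\<lambda>x. 1 / s n * \<phi> n x) \<in> test_functions" for n by (rule test_scale[OF \<phi>])
    show "test_norm \<beta> (\<lambda>x. 1 / s n * \<phi> n x) \<le> 1" for n
    proof -
      have "test_norm \<beta> (\<lambda>x. 1 / s n * \<phi> n x + 0 * \<phi> n x) \<le> \<bar>1 / s n\<bar> * test_norm \<beta> (\<phi> n) + \<bar>0\<bar> * test_norm \<beta> (\<phi> n)"
        by (rule test_norm_triangle[OF \<beta> \<phi> \<phi>])
      also have "\<dots> = test_norm \<beta> (\<phi> n) / s n" using s[of n] by simp
      also have "\<dots> \<le> 1"
      proof -
        have "test_norm \<beta> (\<phi> n) \<le> s n" unfolding s_def by (rule max.cobounded2)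
        then show ?thesis using s[of n] by (simp add: divide_le_eq)
      qed
      finally show ?thesis by simp
    qed
    have 0: "integrable (lebesgue_on B) (\<lambda>_. 0 :: real)" by simp
    \<comment> \<open>The rescaled function is a convex combination of \<phi> n and 0, and the
      weight of 0 tends to 0.\<close>
    have le: "L1_dist (\<lambda>x. 1 / s n * \<phi> n x) u \<le> 1 / s n * L1_dist (\<phi> n) u + (1 - 1 / s n) * L1_dist (\<lambda>_. 0) u" for n
      using L1_dist_lin[OF test_integrable[OF \<phi>] 0 iu s01, of n n n] by simp
    have "(\<lambda>n. L1_dist (\<phi> n) u) \<longlonglongrightarrow> 0" using rep by (simp add: represents_def L1_dist_def)
    then have "(\<lambda>n. 1 / s n * L1_dist (\<phi> n) u + (1 - 1 / s n) * L1_dist (\<lambda>_. 0) u) \<longlonglongrightarrow> 1 / 1 * 0 + (1 - 1 / 1) * L1_dist (\<lambda>_. 0) u"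
      by (intro tendsto_intros i1)
    then have lim: "(\<lambda>n. 1 / s n * L1_dist (\<phi> n) u + (1 - 1 / s n) * L1_dist (\<lambda>_. 0) u) \<longlonglongrightarrow> 0" by simp
    show "(\<lambda>n. L1_dist (\<lambda>x. 1 / s n * \<phi> n x) u) \<longlonglongrightarrow> 0"
    proof (rule tendsto_sandwich[OF _ _ tendsto_const lim])
      show "\<forall>\<^sub>F n in sequentially. 0 \<le> L1_dist (\<lambda>x. 1 / s n * \<phi> n x) u"
        by (intro always_eventually allI L1_dist_nonneg)
      show "\<forall>\<^sub>F n in sequentially. L1_dist (\<lambda>x. 1 / s n * \<phi> n x) u \<le> 1 / s n * L1_dist (\<phi> n) u + (1 - 1 / s n) * L1_dist (\<lambda>_. 0) u"
        by (intro always_eventually allI le)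
    qed
  qed
qed

lemma circle_mean_norm_integrable:
  assumes f: "f \<in> test_functions"
  shows "integrable (lebesgue_on B) (\<lambda>x. circle_mean f (norm x))"
proof -
  have [measurable]: "(\<lambda>x::real^2. circle_mean f (norm x)) \<in> borel_measurable borel"
    by (intro borel_measurable_continuous_onI circle_mean_norm_continuous f)
  have "integrable lborel (\<lambda>x::real^2. indicator (cball 0 1) x *\<^sub>R circle_mean f (norm x))"
    by (intro borel_integrable_compact circle_mean_norm_continuous f compact_cball)
  then have "integrable lborel (\<lambda>x::real^2. indicator B x * circle_mean f (norm x))"
    by (rule Bochner_Integration.integrable_bound) (auto split: split_indicator)
  then show ?thesis by (subst integrable_lebesgue_on_B) auto
qed

text \<open>The contraction property is stated for Borel functions, whereas u is only Lebesgue
  measurable; u is replaced by an a.e. equal Borel function u', which inherits the radial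
  form.\<close>

lemma L1_dist_circ_le:
  assumes f: "f \<in> test_functions" and u: "integrable (lebesgue_on B) u"
    and rad: "AE x in lebesgue_on B. u x = v (norm x)"
  shows "L1_dist (\<lambda>x. circle_mean f (norm x)) u \<le> L1_dist f u"
proof -
  have "(\<lambda>x. indicator B x *\<^sub>R u x) \<in> borel_measurable lebesgue"
    using borel_measurable_integrable[OF u] by (subst (asm) borel_measurable_restrict_space_iff) auto
  from completion_ex_borel_measurable_real[OF this]
  obtain u' where "u' \<in> borel_measurable lborel" and u': "AE x in lborel. indicator B x *\<^sub>R u x = u' x"
    by blast
  then have [measurable]: "u' \<in> borel_measurable borel" by simp
  have um: "u \<in> borel_measurable (lebesgue_on B)" by (rule borel_measurable_integrable[OF u])
  have u'm: "u' \<in> borel_measurable (lebesgue_on B)" by (rule borel_measurable_lebesgue_on) measurable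
  have eq: "AE x in lebesgue_on B. u x = u' x"
  proof (rule AE_lebesgue_on_B)
    show "AE x in lborel. x \<in> B \<longrightarrow> u x = u' x" using u' by eventually_elim auto
  qed
  have "AE x in lebesgue. x \<in> B \<longrightarrow> u x = v (norm x)"
    using rad by (subst (asm) AE_restrict_space_iff) auto
  then have "AE x in lborel. x \<in> B \<longrightarrow> u x = v (norm x)" by (simp add: AE_completion_iff)
  then have rad': "AE x in lborel. x \<in> B \<longrightarrow> u' x = v (norm x)" using u' by eventually_elim auto
  have iu': "integrable (lebesgue_on B) u'"
    using u integrable_cong_AE[OF um u'm eq] by blast
  have L: "ennreal (L1_dist g u) = (\<integral>\<^sup>+x. indicator B x * ennreal \<bar>g x - u' x\<bar> \<partial>lborel)"
    if g: "integrable (lebesgue_on B) g" and [measurable]: "g \<in> borel_measurable borel" for g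
  proof -
    have "L1_dist g u = L1_dist g u'"
      unfolding L1_dist_def
    proof (rule integral_cong_AE)
      show "AE x in lebesgue_on B. \<bar>g x - u x\<bar> = \<bar>g x - u' x\<bar>" using eq by eventually_elim simp
      have gm: "g \<in> borel_measurable (lebesgue_on B)" by (rule borel_measurable_integrable[OF g])
      show "(\<lambda>x. \<bar>g x - u x\<bar>) \<in> borel_measurable (lebesgue_on B)" using gm um by measurable
      show "(\<lambda>x. \<bar>g x - u' x\<bar>) \<in> borel_measurable (lebesgue_on B)" using gm u'm by measurable
    qed
    also have "ennreal \<dots> = (\<integral>\<^sup>+x. ennreal \<bar>g x - u' x\<bar> \<partial>lebesgue_on B)"
      unfolding L1_dist_def
      by (rule nn_integral_eq_integral[symmetric])
        (intro integrable_abs Bochner_Integration.integrable_diff g iu', simp)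
    also have "\<dots> = (\<integral>\<^sup>+x. indicator B x * ennreal \<bar>g x - u' x\<bar> \<partial>lborel)"
      by (rule nn_integral_lebesgue_on_B) measurable
    finally show ?thesis .
  qed
  have "ennreal (L1_dist (\<lambda>x. circle_mean f (norm x)) u) \<le> ennreal (L1_dist f u)"
    unfolding L[OF test_integrable[OF f] test_measurable[OF f]]
      L[OF circle_mean_norm_integrable[OF f] borel_measurable_continuous_onI[OF circle_mean_norm_continuous[OF f]]]
    by (rule circle_mean_L1_contraction[OF test_continuous[OF f] _ rad']) measurable
  then show ?thesis using L1_dist_nonneg by simp
qed

text \<open>Fatou's lemma. Lower semicontinuity is the right direction, because approximants only
  have to stay above a level below the supremum.\<close>

lemma J_liminf:
  assumes u: "AE x in lebesgue_on B. (\<lambda>n. g n x) \<longlonglongrightarrow> u x" and \<beta>: "\<beta> < 1"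
    and [measurable]: "\<And>n. g n \<in> borel_measurable borel"
  shows "J \<beta> u \<le> liminf (\<lambda>n. J \<beta> (g n))"
proof -
  define F where "F n x = ennreal (exp (alpha \<beta> * \<bar>g n x\<bar> powr (2 / (1 - \<beta>))))" for n x
  have "(\<integral>\<^sup>+x. ennreal (exp (alpha \<beta> * \<bar>u x\<bar> powr (2 / (1 - \<beta>)))) \<partial>lebesgue_on B) = (\<integral>\<^sup>+x. liminf (\<lambda>n. F n x) \<partial>lebesgue_on B)"
  proof (rule nn_integral_cong_AE)
    show "AE x in lebesgue_on B. ennreal (exp (alpha \<beta> * \<bar>u x\<bar> powr (2 / (1 - \<beta>)))) = liminf (\<lambda>n. F n x)"
      using u
    proof eventually_elim
      case (elim x)
      have "(\<lambda>n. F n x) \<longlonglongrightarrow> ennreal (exp (alpha \<beta> * \<bar>u x\<bar> powr (2 / (1 - \<beta>))))"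
        unfolding F_def using \<beta> by (intro tendsto_ennrealI tendsto_intros tendsto_abs_powr_0 elim) auto
      then show ?case by (simp add: lim_imp_Liminf)
    qed
  qed
  also have "\<dots> \<le> liminf (\<lambda>n. \<integral>\<^sup>+x. F n x \<partial>lebesgue_on B)"
    by (rule nn_integral_liminf) (auto simp: F_def intro!: borel_measurable_lebesgue_on)
  finally have le: "(\<integral>\<^sup>+x. ennreal (exp (alpha \<beta> * \<bar>u x\<bar> powr (2 / (1 - \<beta>)))) \<partial>lebesgue_on B) \<le> liminf (\<lambda>n. \<integral>\<^sup>+x. F n x \<partial>lebesgue_on B)" .
  have Jg: "J \<beta> (g n) = (\<integral>\<^sup>+x. F n x \<partial>lebesgue_on B) / ennreal pi" for n
    by (simp add: J_def F_def emeasure_lebesgue_B)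
  \<comment> \<open>Strict inequalities in [0,\<infinity>] pass through division by pi, also when a
    is \<infinity>.\<close>
  have div: "C < a / ennreal pi \<longleftrightarrow> C * ennreal pi < a" for C a
  proof -
    have id: "a / ennreal pi * ennreal pi = a"
      by (simp add: ennreal_divide_times)
    show ?thesis
    proof
      assume "C < a / ennreal pi"
      then have "C * ennreal pi < a / ennreal pi * ennreal pi" by (intro ennreal_mult_strict_right_mono) auto
      then show "C * ennreal pi < a" unfolding id .
    next
      assume *: "C * ennreal pi < a"
      show "C < a / ennreal pi"
      proof (rule ccontr)
        assume "\<not> C < a / ennreal pi"
        then have "a / ennreal pi * ennreal pi \<le> C * ennreal pi" by (intro mult_right_mono) auto
        with * show False unfolding id by simp
      qed
    qed
  qed
  show ?thesis
  proof (subst le_Liminf_iff, intro allI impI)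
    fix C assume C: "C < J \<beta> u"
    have "C * ennreal pi < (\<integral>\<^sup>+x. ennreal (exp (alpha \<beta> * \<bar>u x\<bar> powr (2 / (1 - \<beta>)))) \<partial>lebesgue_on B)"
      using C unfolding J_def emeasure_lebesgue_B div .
    then have "C * ennreal pi < liminf (\<lambda>n. \<integral>\<^sup>+x. F n x \<partial>lebesgue_on B)" using le by (rule less_le_trans)
    then have "\<forall>\<^sub>F n in sequentially. C * ennreal pi < (\<integral>\<^sup>+x. F n x \<partial>lebesgue_on B)" by (rule less_LiminfD)
    then show "\<forall>\<^sub>F n in sequentially. C < J \<beta> (g n)"
      unfolding Jg div .
  qed
qed

text \<open>Circular means of approximating test functions converge to u a.e. along a subsequence,
  and Fatou's lemma keeps them above the level C. The test function f is returned with its distance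
  from its mean, because membership in \<open>H10\<close> is expressed by test functions while the
  profile belongs to the mean.\<close>

lemma H10_rad_approx:
  assumes \<beta>: "0 \<le> \<beta>" "\<beta> < 1" and u: "u \<in> H10_rad \<beta>" "H10_norm \<beta> u \<le> 1" and C: "C < J \<beta> u" and e: "0 < e"
  obtains f where "f \<in> test_functions" "test_norm \<beta> f \<le> 1" "C < moser (1 - \<beta>) (mean_profile \<beta> f)"
    "L1_dist f (\<lambda>x. circle_mean f (norm x)) < e"
proof -
  obtain v where uH: "u \<in> H10 \<beta>" and v: "AE x in lebesgue_on B. u x = v (norm x)" using u by (auto simp: H10_rad_def)
  have iu: "integrable (lebesgue_on B) u" using uH by (auto simp: H10_def represents_def)
  obtain \<psi> where \<psi>: "\<And>n. \<psi> n \<in> test_functions" "\<And>n. test_norm \<beta> (\<psi> n) \<le> 1" "(\<lambda>n. L1_dist (\<psi> n) u) \<longlonglongrightarrow> 0"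
    by (rule H10_unit_ball_approx[OF \<beta> uH u(2)]) (rule that)
  define g where "g n x = circle_mean (\<psi> n) (norm x)" for n and x :: "real^2"
  have gi: "integrable (lebesgue_on B) (g n)" for n unfolding g_def by (intro circle_mean_norm_integrable \<psi>)
  have gl: "L1_dist (g n) u \<le> L1_dist (\<psi> n) u" for n unfolding g_def by (rule L1_dist_circ_le[OF \<psi>(1) iu v])
  have g0: "(\<lambda>n. L1_dist (g n) u) \<longlonglongrightarrow> 0"
    by (rule tendsto_sandwich[OF _ _ tendsto_const \<psi>(3)]) (auto simp: L1_dist_nonneg gl)
  have "\<exists>r. strict_mono r \<and> (AE x in lebesgue_on B. (\<lambda>n. g (r n) x - u x) \<longlonglongrightarrow> 0)"
    by (rule tendsto_L1_AE_subseq) (use gi iu g0 in \<open>auto simp: L1_dist_def\<close>)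
  then obtain r where r: "strict_mono r" "AE x in lebesgue_on B. (\<lambda>n. g (r n) x - u x) \<longlonglongrightarrow> 0" by blast
  have "J \<beta> u \<le> liminf (\<lambda>n. J \<beta> (g (r n)))"
  proof (rule J_liminf[OF _ \<beta>(2)])
    show "AE x in lebesgue_on B. (\<lambda>n. g (r n) x) \<longlonglongrightarrow> u x" using r(2) by eventually_elim (rule LIM_zero_cancel)
    show "g (r n) \<in> borel_measurable borel" for n unfolding g_def
      by (intro borel_measurable_continuous_onI circle_mean_norm_continuous \<psi>)
  qed
  then have e1: "\<forall>\<^sub>F n in sequentially. C < J \<beta> (g (r n))" by (intro less_LiminfD less_le_trans[OF C])
  have "(\<lambda>n. L1_dist (\<psi> (r n)) u) \<longlonglongrightarrow> 0" using LIMSEQ_subseq_LIMSEQ[OF \<psi>(3) r(1)] by (simp add: o_def)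
  then have e2: "\<forall>\<^sub>F n in sequentially. L1_dist (\<psi> (r n)) u < e / 2" by (rule order_tendstoD(2)) (use e in auto)
  obtain n where n: "C < J \<beta> (g (r n))" "L1_dist (\<psi> (r n)) u < e / 2"
    using eventually_happens[OF eventually_conj[OF e1 e2]] by auto
  show ?thesis
  proof (rule that[OF \<psi>(1,2), of "r n"])
    show "C < moser (1 - \<beta>) (mean_profile \<beta> (\<psi> (r n)))" using n(1) J_circle_mean[OF \<beta> \<psi>(1), of "r n"] by (simp add: g_def[abs_def])
    have "L1_dist (\<psi> (r n)) (g (r n)) \<le> L1_dist (\<psi> (r n)) u + L1_dist u (g (r n))"
      by (rule L1_dist_triangle) (auto intro: test_integrable \<psi> iu gi)
    also have "L1_dist u (g (r n)) = L1_dist (g (r n)) u" by (simp add: L1_dist_def abs_minus_commute)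
    also have "\<dots> \<le> L1_dist (\<psi> (r n)) u" by (rule gl)
    finally show "L1_dist (\<psi> (r n)) (\<lambda>x. circle_mean (\<psi> (r n)) (norm x)) < e" using n(2) by (simp add: g_def)
  qed
qed

section \<open>Smooth profiles\<close>

text \<open>k-fold differentiability at the points of S. Level 0 is void, so continuity is drawn
  from level 1; the set S allows gluing along an open cover.\<close>

primrec D_k :: "nat \<Rightarrow> (real \<Rightarrow> real) \<Rightarrow> real set \<Rightarrow> bool"
  where
    "D_k 0 f S \<longleftrightarrow> True"
  | "D_k (Suc k) f S \<longleftrightarrow> (\<exists>g. (\<forall>x\<in>S. (f has_real_derivative g x) (at x)) \<and> D_k k g S)"

lemma D_k_SucI: "(\<And>x. x \<in> S \<Longrightarrow> (f has_real_derivative g x) (at x)) \<Longrightarrow> D_k k g S \<Longrightarrow> D_k (Suc k) f S"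
  unfolding D_k.simps by blast

lemma D_k_SucE:
  assumes "D_k (Suc k) f S"
  obtains g where "\<And>x. x \<in> S \<Longrightarrow> (f has_real_derivative g x) (at x)" "D_k k g S"
  using assms unfolding D_k.simps by blast

lemma D_k_SucD: "D_k (Suc k) f S \<Longrightarrow> D_k k f S"
proof (induction k arbitrary: f)
  case (Suc k)
  obtain g where "\<And>x. x \<in> S \<Longrightarrow> (f has_real_derivative g x) (at x)" "D_k (Suc k) g S"
    by (rule D_k_SucE[OF Suc.prems]) (rule that)
  then show ?case using Suc.IH by (intro D_k_SucI)
qed simp

lemma D_k_cong:
  assumes "open S" "\<And>x. x \<in> S \<Longrightarrow> f x = g x" "D_k k f S"
  shows "D_k k g S"
proof (cases k)
  case (Suc j)
  obtain f' where f': "\<And>x. x \<in> S \<Longrightarrow> (f has_real_derivative f' x) (at x)" "D_k j f' S"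
    by (rule D_k_SucE[OF assms(3)[unfolded Suc]]) (rule that)
  show ?thesis unfolding Suc
  proof (rule D_k_SucI[OF _ f'(2)])
    fix x assume "x \<in> S"
    then show "(g has_real_derivative f' x) (at x)"
      by (intro has_field_derivative_transform_within_open[OF f'(1) assms(1)]) (auto simp: assms(2))
  qed
qed simp

lemma D_k_lin: "D_k k f S \<Longrightarrow> D_k k g S \<Longrightarrow> D_k k (\<lambda>x. a * f x + b * g x) S"
proof (induction k arbitrary: f g)
  case (Suc k)
  obtain f' where f': "\<And>x. x \<in> S \<Longrightarrow> (f has_real_derivative f' x) (at x)" "D_k k f' S"
    by (rule D_k_SucE[OF Suc.prems(1)]) (rule that)
  obtain g' where g': "\<And>x. x \<in> S \<Longrightarrow> (g has_real_derivative g' x) (at x)" "D_k k g' S"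
    by (rule D_k_SucE[OF Suc.prems(2)]) (rule that)
  show ?case
    by (rule D_k_SucI[OF _ Suc.IH[OF f'(2) g'(2)]]) (intro DERIV_add DERIV_cmult f'(1) g'(1))
qed simp

lemma D_k_mult: "D_k k f S \<Longrightarrow> D_k k g S \<Longrightarrow> D_k k (\<lambda>x. f x * g x) S"
proof (induction k arbitrary: f g)
  case (Suc k)
  obtain f' where f': "\<And>x. x \<in> S \<Longrightarrow> (f has_real_derivative f' x) (at x)" "D_k k f' S"
    by (rule D_k_SucE[OF Suc.prems(1)]) (rule that)
  obtain g' where g': "\<And>x. x \<in> S \<Longrightarrow> (g has_real_derivative g' x) (at x)" "D_k k g' S"
    by (rule D_k_SucE[OF Suc.prems(2)]) (rule that)
  have "D_k k (\<lambda>x. 1 * (f' x * g x) + 1 * (g' x * f x)) S"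
    by (intro D_k_lin Suc.IH D_k_SucD[OF Suc.prems(1)] D_k_SucD[OF Suc.prems(2)] f'(2) g'(2))
  then have "D_k k (\<lambda>x. f' x * g x + g' x * f x) S" by simp
  then show ?case
    by (rule D_k_SucI[rotated]) (intro DERIV_mult f'(1) g'(1))
qed simp

lemma D_k_const: "D_k k (\<lambda>x. c) S"
proof (induction k arbitrary: c)
  case (Suc k)
  show ?case by (rule D_k_SucI[OF _ Suc.IH[of 0]]) simp
qed simp

lemma D_k_affine: "D_k k (\<lambda>x. a * x + b) S"
proof (cases k)
  case (Suc j)
  show ?thesis unfolding Suc
    by (rule D_k_SucI[OF _ D_k_const[of j a]]) (auto intro!: derivative_eq_intros)
qed simp

lemma D_k_compose: "D_k k f T \<Longrightarrow> D_k k g S \<Longrightarrow> (\<And>x. x \<in> S \<Longrightarrow> g x \<in> T) \<Longrightarrow> D_k k (\<lambda>x. f (g x)) S"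
proof (induction k arbitrary: f)
  case (Suc k)
  obtain f' where f': "\<And>x. x \<in> T \<Longrightarrow> (f has_real_derivative f' x) (at x)" "D_k k f' T"
    by (rule D_k_SucE[OF Suc.prems(1)]) (rule that)
  obtain g' where g': "\<And>x. x \<in> S \<Longrightarrow> (g has_real_derivative g' x) (at x)" "D_k k g' S"
    by (rule D_k_SucE[OF Suc.prems(2)]) (rule that)
  have "D_k k (\<lambda>x. f' (g x) * g' x) S"
  proof (rule D_k_mult[OF _ g'(2)])
    show "D_k k (\<lambda>x. f' (g x)) S"
      by (rule Suc.IH[OF f'(2) D_k_SucD[OF Suc.prems(2)] Suc.prems(3)])
  qed
  then show ?case
  proof (rule D_k_SucI[rotated])
    fix x assume x: "x \<in> S"
    show "((\<lambda>x. f (g x)) has_real_derivative f' (g x) * g' x) (at x)"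
      by (rule DERIV_chain2[OF f'(1)[OF Suc.prems(3)[OF x]] g'(1)[OF x]])
  qed
qed simp

text \<open>On the overlap the two derivatives agree by uniqueness, so they glue to one function to
  which the induction hypothesis applies.\<close>

lemma D_k_union:
  "open S \<Longrightarrow> open T \<Longrightarrow> D_k k f S \<Longrightarrow> D_k k f T \<Longrightarrow> D_k k f (S \<union> T)"
proof (induction k arbitrary: f)
  case (Suc k)
  obtain f' where f': "\<And>x. x \<in> T \<Longrightarrow> (f has_real_derivative f' x) (at x)" "D_k k f' T"
    by (rule D_k_SucE[OF Suc.prems(4)]) (rule that)
  obtain g' where g': "\<And>x. x \<in> S \<Longrightarrow> (f has_real_derivative g' x) (at x)" "D_k k g' S"
    by (rule D_k_SucE[OF Suc.prems(3)]) (rule that)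
  define h where "h x = (if x \<in> S then g' x else f' x)" for x
  have S: "h x = g' x" if "x \<in> S" for x using that by (simp add: h_def)
  have T: "h x = f' x" if "x \<in> T" for x
  proof (cases "x \<in> S")
    case True
    then show ?thesis using DERIV_unique[OF g'(1)[OF True] f'(1)[OF that]] by (simp add: h_def)
  qed (simp add: h_def)
  have "D_k k h S" by (rule D_k_cong[OF Suc.prems(1) _ g'(2)]) (simp add: S)
  moreover have "D_k k h T" by (rule D_k_cong[OF Suc.prems(2) _ f'(2)]) (simp add: T)
  ultimately have "D_k k h (S \<union> T)" by (rule Suc.IH[OF Suc.prems(1,2)])
  then show ?case
  proof (rule D_k_SucI[rotated])
    fix x assume "x \<in> S \<union> T"
    then show "(f has_real_derivative h x) (at x)"
    proof
      assume "x \<in> S" then show ?thesis using g'(1)[of x] S[of x] by simp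
    next
      assume "x \<in> T" then show ?thesis using f'(1)[of x] T[of x] by simp
    qed
  qed
qed simp

lemma D_k_powr: "D_k k (\<lambda>x. x powr a) {0<..}"
proof (induction k arbitrary: a)
  case (Suc k)
  have "D_k k (\<lambda>x. a * x powr (a - 1) + 0 * 0) {0<..}"
    by (rule D_k_lin[OF Suc.IH D_k_const])
  then show ?case
  proof (rule D_k_SucI[rotated])
    fix x :: real assume "x \<in> {0<..}"
    then show "((\<lambda>x. x powr a) has_real_derivative a * x powr (a - 1) + 0 * 0) (at x)"
      using has_real_derivative_powr[of x a] by simp
  qed
qed simp

lemma D_k_ln: "D_k k ln {0<..}"
proof (cases k)
  case (Suc j)
  show ?thesis unfolding Suc
  proof (rule D_k_SucI[OF _ D_k_powr[of j "-1"]])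
    fix x :: real assume "x \<in> {0<..}"
    then show "(ln has_real_derivative x powr -1) (at x)"
      using DERIV_ln[of x] by (simp add: powr_minus)
  qed
qed simp

section \<open>Smooth bumps and smooth radial functions\<close>

definition bump :: "real \<Rightarrow> real"
  where "bump x = (if x \<le> 0 then 0 else exp (- (1 / x)))"

lemma bump_bounds: "0 \<le> bump x" "bump x \<le> 1"
  by (auto simp: bump_def)

text \<open>Dividing by powers x ^ j gives a family whose derivatives are linear combinations of its
  members, so one induction on k with j arbitrary covers \<open>bump\<close>, the case j =
  0.\<close>

lemma D_k_bump_aux: "D_k k (\<lambda>x. if x \<le> 0 then 0 else exp (- (1 / x)) / x ^ j) UNIV"
proof (induction k arbitrary: j)
  case (Suc k)
  let ?b = "\<lambda>j x. if x \<le> 0 then 0 else exp (- (1 / x)) / x ^ j :: real"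
  have "D_k k (\<lambda>x. 1 * ?b (j + 2) x + (- real j) * ?b (Suc j) x) UNIV"
    by (rule D_k_lin[OF Suc.IH Suc.IH])
  then show ?case
  proof (rule D_k_SucI[rotated])
    fix x :: real
    consider "x < 0" | "x = 0" | "x > 0" by linarith
    then show "(?b j has_real_derivative 1 * ?b (j + 2) x + (- real j) * ?b (Suc j) x) (at x)"
    proof cases
      case 1
      have "(?b j has_real_derivative 0) (at x)"
        by (rule has_field_derivative_transform_within_open[OF DERIV_const[of 0], where S="{..<0}"]) (use 1 in auto)
      then show ?thesis using 1 by simp
    next
      case 3
      have "((\<lambda>x. exp (- (1 / x)) / x ^ j) has_real_derivative exp (- (1 / x)) / x ^ (j + 2) - real j * (exp (- (1 / x)) / x ^ Suc j)) (at x)"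
      proof -
        have e: "((\<lambda>x. exp (- (1 / x))) has_real_derivative exp (- (1 / x)) / x\<^sup>2) (at x)"
          using 3 by (auto intro!: derivative_eq_intros simp: power2_eq_square)
        have "real j * x ^ (j - Suc 0) = real j * x ^ j / x"
          using 3 by (cases j) auto
        then have p: "((\<lambda>x. x ^ j) has_real_derivative real j * x ^ j / x) (at x)"
          using DERIV_pow[of j x UNIV] by simp
        have "x ^ j \<noteq> 0" using 3 by simp
        have eq: "(E / x\<^sup>2 * X - E * (m * X / x)) / (X * X) = E / (X * x\<^sup>2) - m * (E / (x * X))"
          if "X \<noteq> 0" for E X m :: real
          using that 3 by (simp add: field_simps power2_eq_square)
        show ?thesis
          using DERIV_divide[OF e p \<open>x ^ j \<noteq> 0\<close>] unfolding eq[OF \<open>x ^ j \<noteq> 0\<close>] power_add power_Suc .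
      qed
      then have "(?b j has_real_derivative exp (- (1 / x)) / x ^ (j + 2) - real j * (exp (- (1 / x)) / x ^ Suc j)) (at x)"
        by (rule has_field_derivative_transform_within_open[where S="{0<..}"]) (use 3 in auto)
      then show ?thesis using 3 by simp
    next
      case 2
      \<comment> \<open>At 0 the difference quotient from the right is the next member of the
        family, which tends to 0; from the left it vanishes.\<close>
      have "((\<lambda>h::real. exp (- (1 / h)) / h ^ Suc j) \<longlongrightarrow> 0) (at_right 0)"
        by real_asymp
      moreover have "\<forall>\<^sub>F h::real in at_right 0. exp (- (1 / h)) / h ^ Suc j = ?b j h / h"
        using eventually_at_right_less[of 0] by eventually_elim simp
      ultimately have r: "((\<lambda>h. ?b j h / h) \<longlongrightarrow> 0) (at_right 0)" by (rule Lim_transform_eventually)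
      have "\<forall>\<^sub>F h::real in at_left 0. 0 = ?b j h / h"
        using eventually_at_left_real[of "-1" "0::real", simplified] by eventually_elim simp
      then have l: "((\<lambda>h. ?b j h / h) \<longlongrightarrow> 0) (at_left 0)" by (rule Lim_transform_eventually[OF tendsto_const])
      have "((\<lambda>h. ?b j h / h) \<longlongrightarrow> 0) (at 0)" using l r by (simp add: filterlim_split_at)
      then show ?thesis using 2 by (simp add: DERIV_def cong: if_cong)
    qed
  qed
qed simp

lemma D_k_bump: "D_k k bump UNIV"
  using D_k_bump_aux[of k 0] unfolding bump_def[abs_def] power_0 div_by_1 .

lemma C_k_coord: "C_k k (\<lambda>x. x $ i)"
proof -
  have const: "C_k k (\<lambda>x. c)" for k c
  proof (induction k arbitrary: c)
    case (Suc k)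
    show ?case by (rule C_k_SucI[of _ "\<lambda>_. 0"]) (auto intro: GDERIV_const Suc)
  qed simp
  show ?thesis
  proof (cases k)
    case 0
    then show ?thesis by (auto intro!: continuous_intros)
  next
    case (Suc j)
    have "GDERIV (\<lambda>x. x $ i) x :> axis i 1" for x :: "real^2"
      unfolding gderiv_def inner_axis by (simp add: bounded_linear_imp_has_derivative bounded_linear_vec_nth)
    then show ?thesis unfolding Suc by (rule C_k_SucI) (rule const)
  qed
qed

lemma D_k_UNIV_SucE:
  assumes "D_k (Suc k) f UNIV"
  obtains g where "\<And>x. (f has_real_derivative g x) (at x)" "D_k k g UNIV"
  using assms unfolding D_k.simps by blast

text \<open>Using x \<bullet> x instead of the norm avoids the singularity at the origin. The
  gradient is 2 * g (x \<bullet> x) times x with g the derivative of G, and g is again smooth, so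
  the induction varies G.\<close>

lemma C_k_radial: "(\<And>k. D_k k G UNIV) \<Longrightarrow> C_k k (\<lambda>x. G (x \<bullet> x))"
proof (induction k arbitrary: G)
  case 0
  obtain g where g: "\<And>x. (G has_real_derivative g x) (at x)"
    by (rule D_k_UNIV_SucE[OF 0[of "Suc 0"]]) (rule that)
  have "continuous_on UNIV G" by (rule DERIV_continuous_on[where D=g]) (use g in simp)
  then have "continuous_on UNIV (\<lambda>x::real^2. G (x \<bullet> x))"
    by (rule continuous_on_compose2) (auto intro: continuous_intros)
  then show ?case by simp
next
  case (Suc k)
  obtain g where g: "\<And>x. (G has_real_derivative g x) (at x)"
    by (rule D_k_UNIV_SucE[OF Suc.prems[of "Suc 0"]]) (rule that)
  have gk: "D_k j g UNIV" for j
  proof -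
    obtain g' where g': "\<And>x. (G has_real_derivative g' x) (at x)" "D_k j g' UNIV"
      by (rule D_k_UNIV_SucE[OF Suc.prems[of "Suc j"]]) (rule that)
    have "g' = g"
    proof
      fix x show "g' x = g x" by (rule DERIV_unique[OF g'(1) g])
    qed
    with g' show ?thesis by simp
  qed
  have c: "C_k k (\<lambda>x. ((2 * g (x \<bullet> x)) *\<^sub>R x) $ i)" for i
  proof -
    have "C_k k (\<lambda>x. 2 * (g (x \<bullet> x) * x $ i) + 0 * (x $ i))"
      by (rule C_k_linear[OF C_k_mult[OF Suc.IH[OF gk] C_k_coord] C_k_coord])
    then show ?thesis by (simp add: mult.assoc)
  qed
  have "GDERIV (\<lambda>x. G (x \<bullet> x)) x :> (2 * g (x \<bullet> x)) *\<^sub>R x" for x :: "real^2"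
  proof -
    have "GDERIV (\<lambda>x. x \<bullet> x) x :> 2 *\<^sub>R x"
      unfolding gderiv_def by (auto intro!: derivative_eq_intros simp: inner_commute)
    from GDERIV_DERIV_compose[OF this g] show ?thesis by (simp add: mult.commute)
  qed
  then show ?case using c by (rule C_k_SucI)
qed

text \<open>w vanishes up to a and is constant from b on, so f is zero near the unit circle and
  constant near the origin, and in between it is a smooth function of x \<bullet> x. The norm
  identity is the substitution t = - 2 * ln (norm x), whose constants cancel by
  \<open>profile_scale_sq\<close>.\<close>

lemma smooth_profile_test:
  assumes \<beta>: "0 \<le> \<beta>" "\<beta> < 1" and v: "\<And>k. D_k k v UNIV" and ab: "0 < a" "a < b"
    and supp: "\<And>t. t < a \<or> b < t \<Longrightarrow> v t = 0"
    and w: "\<And>t. (w has_real_derivative v t) (at t)" and w0: "w 0 = 0"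
  obtains f where "f \<in> test_functions" "\<And>x. x \<noteq> 0 \<Longrightarrow> f x = w (- 2 * ln (norm x)) / profile_scale \<beta>"
    "ennreal ((test_norm \<beta> f)\<^sup>2) = energy (1 - \<beta>) v"
proof -
  define c where "c = 1 / profile_scale \<beta>"
  have c: "c > 0" using profile_scale_pos[OF \<beta>(2)] by (simp add: c_def)
  have contw: "continuous_on S w" for S
    by (rule DERIV_continuous_on[where D=v]) (rule has_field_derivative_at_within[OF w])
  have wz: "(w has_real_derivative 0) (at x)" if "x < a \<or> b < x" for x
    using w[of x] supp[OF that] by simp
  have w_low: "w t = 0" if "t \<le> a" for t
  proof -
    have "w x = w 0" if "x \<le> a" for x
    proof -
      have "w y = w a" if "y \<le> a" for y
      proof (cases "y = a")
        case False
        then show ?thesis using that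
          by (intro DERIV_isconst_end[symmetric, of y a w] contw) (use wz in auto)
      qed simp
      from this[OF that] this[of 0] ab show ?thesis by simp
    qed
    then show ?thesis using that w0 by simp
  qed
  have w_high: "w t = w b" if "b \<le> t" for t
  proof (cases "t = b")
    case False
    then show ?thesis using that
      by (intro DERIV_isconst_end[of b t w] contw) (use wz in auto)
  qed simp
  \<comment> \<open>The variable is s = x \<bullet> x, for which - 2 * ln (norm x) = - ln s. The
    constant branch extends the function across s = 0 to the whole line, as
    \<open>C_k_radial\<close> requires.\<close>
  define G where "G s = (if s \<le> exp (- b) then c * w b else c * w (- ln s))" for s
  have G1: "G s = c * w (- ln s)" if "0 < s" for s
  proof (cases "s \<le> exp (- b)")
    case True
    then have "ln s \<le> - b" using ln_mono[of s "exp (- b)"] that by simp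
    then show ?thesis using True w_high[of "- ln s"] by (simp add: G_def)
  qed (simp add: G_def)
  have wk: "D_k k w UNIV" for k
    by (rule D_k_SucD, rule D_k_SucI[OF w v])
  have Gk: "D_k k G UNIV" for k
  proof -
    have "D_k k G {..<exp (- b)}"
      by (rule D_k_cong[OF _ _ D_k_const[of k "c * w b"]]) (auto simp: G_def)
    moreover have "D_k k G {0<..}"
    proof (rule D_k_cong[of _ "\<lambda>s. c * w (- 1 * ln s + 0 * 0) + 0 * 0"])
      have "D_k k (\<lambda>s. - 1 * ln s + 0 * 0) {0<..}" by (rule D_k_lin[OF D_k_ln D_k_const])
      then have "D_k k (\<lambda>s. w (- 1 * ln s + 0 * 0)) {0<..}"
        by (rule D_k_compose[OF wk]) simp
      then show "D_k k (\<lambda>s. c * w (- 1 * ln s + 0 * 0) + 0 * 0) {0<..}"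
        by (rule D_k_lin[OF _ D_k_const])
    qed (auto simp: G1)
    ultimately have "D_k k G ({..<exp (- b)} \<union> {0<..})" by (intro D_k_union) auto
    moreover have "{..<exp (- b)} \<union> {0<..} = (UNIV :: real set)"
      by (auto simp: not_less) (meson exp_gt_zero le_less_trans not_le)
    ultimately show ?thesis by simp
  qed
  define f where "f x = G (x \<bullet> x)" for x :: "real^2"
  have fx: "f x = c * w (- 2 * ln (norm x))" if "x \<noteq> 0" for x
  proof -
    have "ln (x \<bullet> x) = 2 * ln (norm x)" using that by (simp add: ln_realpow flip: power2_norm_eq_inner)
    then show ?thesis using that G1[of "x \<bullet> x"] by (simp add: f_def)
  qed
  have f0: "f x = 0" if "exp (- a / 2) \<le> norm x" for x
  proof -
    have "x \<noteq> 0" using that exp_gt_zero[of "- a / 2"] by (auto simp del: exp_gt_zero)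
    then have "- a / 2 \<le> ln (norm x)" using that by (subst ln_ge_iff) auto
    then show ?thesis using fx[OF \<open>x \<noteq> 0\<close>] w_low[of "- 2 * ln (norm x)"] by simp
  qed
  have ft: "f \<in> test_functions"
  proof -
    have sub: "closure {x. f x \<noteq> 0} \<subseteq> cball 0 (exp (- a / 2))"
    proof (rule closure_minimal)
      show "{x. f x \<noteq> 0} \<subseteq> cball 0 (exp (- a / 2))"
      proof
        fix x assume "x \<in> {x. f x \<noteq> 0}"
        then have "\<not> exp (- a / 2) \<le> norm x" using f0 by blast
        then show "x \<in> cball 0 (exp (- a / 2))" by simp
      qed
    qed simp
    then have "compact (cball 0 (exp (- a / 2)) \<inter> closure {x. f x \<noteq> 0})" by (intro compact_Int_closed) auto
    then have "compact (closure {x. f x \<noteq> 0})" using sub by (simp add: inf.absorb2)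
    moreover have "closure {x. f x \<noteq> 0} \<subseteq> B"
    proof -
      have "exp (- a / 2) < 1" using ab by simp
      then have "cball 0 (exp (- a / 2)) \<subseteq> B"
        unfolding subset_iff mem_cball mem_ball using le_less_trans by blast
      with sub show ?thesis by (rule order_trans)
    qed
    moreover have "\<forall>k. C_k k f" unfolding f_def using C_k_radial[OF Gk] by blast
    ultimately show ?thesis unfolding test_functions_def mem_Collect_eq by blast
  qed
  have grad: "(norm (grad f x))\<^sup>2 = 4 * c\<^sup>2 * (v (- 2 * ln (norm x)))\<^sup>2 / (norm x)\<^sup>2" if x: "x \<noteq> 0" for x
  proof -
    have "GDERIV norm x :> sgn x" using x by (rule GDERIV_norm)
    moreover have "((\<lambda>r. c * w (- 2 * ln r)) has_real_derivative c * (v (- 2 * ln (norm x)) * (- 2 * (1 / norm x)))) (at (norm x))"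
      using x by (intro DERIV_cmult DERIV_chain2[OF w]) (auto intro!: derivative_eq_intros)
    ultimately have "GDERIV (\<lambda>x. c * w (- 2 * ln (norm x))) x :> (c * (v (- 2 * ln (norm x)) * (- 2 * (1 / norm x)))) *\<^sub>R sgn x"
      by (rule GDERIV_DERIV_compose)
    then have "GDERIV f x :> (c * (v (- 2 * ln (norm x)) * (- 2 * (1 / norm x)))) *\<^sub>R sgn x"
      by (rule GDERIV_transform_open[where S="- {0}"]) (use x in \<open>simp_all add: fx open_Compl\<close>)
    then have "grad f x = (c * (v (- 2 * ln (norm x)) * (- 2 * (1 / norm x)))) *\<^sub>R sgn x" by (rule grad_eq)
    then have "norm (grad f x) = \<bar>c * (v (- 2 * ln (norm x)) * (- 2 * (1 / norm x)))\<bar>" using x by (simp add: norm_sgn)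
    then show ?thesis by (simp add: power_mult_distrib power_divide)
  qed
  \<comment> \<open>Squared gradient times weight in the variable t; exp t stands for the inverse
    square of the norm and will cancel the density exp (- t).\<close>
  define H where "H t = ennreal (4 * c\<^sup>2 * (v t)\<^sup>2 * exp t * \<bar>t / 2\<bar> powr \<beta>)" for t
  have "continuous_on UNIV v"
  proof -
    obtain v' where "\<And>x. (v has_real_derivative v' x) (at x)" by (rule D_k_UNIV_SucE[OF v[of "Suc 0"]]) (rule that)
    then show ?thesis by (intro DERIV_continuous_on[where D=v']) simp
  qed
  then have [measurable]: "v \<in> borel_measurable borel" by (rule borel_measurable_continuous_onI)
  have [measurable]: "H \<in> borel_measurable borel" unfolding H_def[abs_def] by measurable
  have "ennreal ((test_norm \<beta> f)\<^sup>2) = (\<integral>\<^sup>+x. indicator B x * ennreal ((norm (grad f x))\<^sup>2 * weight \<beta> x) \<partial>lborel)"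
  proof -
    have [measurable]: "grad f \<in> borel_measurable borel"
      by (intro borel_measurable_continuous_onI test_grad_continuous ft)
    show ?thesis unfolding test_norm_nn_integral[OF \<beta> ft, symmetric] by (rule nn_integral_lebesgue_on_B) measurable
  qed
  also have "\<dots> = (\<integral>\<^sup>+x. indicator B x * H (- 2 * ln (norm x)) \<partial>lborel)"
  proof (rule nn_integral_cong_AE)
    show "AE x in lborel. indicator B x * ennreal ((norm (grad f x))\<^sup>2 * weight \<beta> x) = indicator B x * H (- 2 * ln (norm x))"
      using AE_lborel_singleton[of "0::real^2"]
    proof eventually_elim
      case (elim x)
      have "exp (- 2 * ln (norm x)) = 1 / (norm x)\<^sup>2"
      proof -
        have "exp (- 2 * ln (norm x)) = inverse (exp (2 * ln (norm x)))" by (simp add: exp_minus)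
        also have "exp (2 * ln (norm x)) = (norm x)\<^sup>2" using elim by (simp add: exp_double)
        finally show ?thesis by (simp add: inverse_eq_divide)
      qed
      then show ?case using grad[OF elim] by (simp add: H_def weight_def)
    qed
  qed
  also have "\<dots> = ennreal pi * (\<integral>\<^sup>+t. indicator {0<..} t * (ennreal (exp (- t)) * H t) \<partial>lborel)"
    by (rule nn_integral_ball_radial) measurable
  also have "\<dots> = (\<integral>\<^sup>+t. ennreal pi * (indicator {0<..} t * (ennreal (exp (- t)) * H t)) \<partial>lborel)"
    by (rule nn_integral_cmult[symmetric]) measurable
  also have "\<dots> = energy (1 - \<beta>) v"
    unfolding energy_def
  proof (rule nn_integral_cong)
    fix t :: real
    show "ennreal pi * (indicator {0<..} t * (ennreal (exp (- t)) * H t)) = indicator {0<..} t * ennreal (t powr (1 - (1 - \<beta>)) * (v t)\<^sup>2 / (1 - \<beta>))"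
    proof (cases "0 < t")
      case True
      define P where "P = (2::real) powr \<beta>"
      have P: "P > 0" "2 powr (1 - \<beta>) = 2 / P" by (auto simp: P_def powr_diff)
      have c2: "c\<^sup>2 = P / (4 * pi * (1 - \<beta>))"
        unfolding c_def power_divide profile_scale_sq[OF \<beta>(2)] P(2) by simp
      have t2: "\<bar>t / 2\<bar> powr \<beta> = t powr \<beta> / P" using True by (simp add: P_def powr_divide)
      have ee: "exp (- t) * exp t = 1" by (simp flip: exp_add)
      have "pi * (exp (- t) * (4 * c\<^sup>2 * (v t)\<^sup>2 * exp t * \<bar>t / 2\<bar> powr \<beta>)) = (exp (- t) * exp t) * (pi * (4 * c\<^sup>2 * (v t)\<^sup>2 * (\<bar>t / 2\<bar> powr \<beta>)))"
        by (simp only: mult_ac)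
      also have "\<dots> = t powr \<beta> * (v t)\<^sup>2 / (1 - \<beta>)"
        unfolding ee c2 t2 using P by simp
      finally show ?thesis using True by (simp add: H_def ennreal_mult'[symmetric])
    qed simp
  qed
  finally have "ennreal ((test_norm \<beta> f)\<^sup>2) = energy (1 - \<beta>) v" .
  then show ?thesis using that[OF ft] fx by (simp add: c_def)
qed

lemma J_smooth_profile:
  assumes \<beta>: "0 \<le> \<beta>" "\<beta> < 1" and fx: "\<And>x. x \<noteq> 0 \<Longrightarrow> f x = w (- 2 * ln (norm x)) / profile_scale \<beta>"
    and w: "w \<in> borel_measurable borel"
  shows "J \<beta> f = moser (1 - \<beta>) w"
proof -
  have "J \<beta> f = J \<beta> (\<lambda>x. w (- 2 * ln (norm x)) / profile_scale \<beta>)"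
  proof (rule J_cong_AE)
    show "AE x in lebesgue_on B. f x = w (- 2 * ln (norm x)) / profile_scale \<beta>"
      using AE_lebesgue_on_B_nonzero by eventually_elim (rule fx)
  qed
  then show ?thesis using J_radial[OF \<beta>(2) w] by simp
qed

text \<open>Jensen's inequality, from the tangent line of exp at the mean value c of g.\<close>

lemma integral_exp_ge:
  fixes g :: "real \<Rightarrow> real"
  assumes ab: "a < b" and g: "continuous_on {a..b} g" and c: "(g has_integral (b - a) * c) {a..b}"
  shows "(b - a) * exp c \<le> integral {a..b} (\<lambda>t. exp (g t))"
proof -
  have "((\<lambda>t. exp c * (1 - c) + exp c * g t) has_integral ((b - a) *\<^sub>R (exp c * (1 - c)) + exp c * ((b - a) * c))) {a..b}"
    using has_integral_const_real[of "exp c * (1 - c)" a b] ab by (intro has_integral_add has_integral_mult_right c) auto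
  moreover have "(b - a) *\<^sub>R (exp c * (1 - c)) + exp c * ((b - a) * c) = (b - a) * exp c" by (simp add: algebra_simps)
  ultimately have i: "((\<lambda>t. exp c * (1 - c) + exp c * g t) has_integral (b - a) * exp c) {a..b}" by simp
  have "((\<lambda>t. exp (g t)) has_integral integral {a..b} (\<lambda>t. exp (g t))) {a..b}"
    by (intro integrable_integral integrable_continuous_real continuous_intros g)
  then show ?thesis
  proof (rule has_integral_le[OF i])
    fix t
    have "exp c * (1 + (g t - c)) \<le> exp c * exp (g t - c)" using exp_ge_add_one_self[of "g t - c"] by (intro mult_left_mono) auto
    also have "\<dots> = exp (g t)" by (simp flip: exp_add)
    finally show "exp c * (1 - c) + exp c * g t \<le> exp (g t)" by (simp add: algebra_simps)
  qed
qed

section \<open>A trial profile above the concentration level\<close>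

text \<open>In terms of \<open>\<bar>w\<bar>\<^bsup>2/q\<^esup>\<close> the trial profile is the same for all \<open>q\<close>: \<open>h t\<^sup>2 / 7\<close>, then \<open>h t\<close>, then
  \<open>9 h\<close>, with \<open>h = 15/16\<close>. Its energy is \<open>h\<^sup>q (1 + (q / 4) ln (9 / 7))\<close>, which is at most 1 for all \<open>q\<close>
  because \<open>9 / 7 \<le> (16 / 15)\<^sup>4\<close>.\<close>

definition trial :: "real \<Rightarrow> real \<Rightarrow> real"
  where "trial q t = (if t \<le> 7 then (15 / 112) powr (q / 2) * t powr q
    else if t \<le> 9 then (15 / 16) powr (q / 2) * t powr (q / 2)
    else (15 / 16) powr (q / 2) * 9 powr (q / 2))"

text \<open>At the corners 0, 7 and 9 the value is 0. The smooth approximations in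
  \<open>sharp_smooth_profile\<close> vanish there too, so they converge at every point.\<close>

definition trial' :: "real \<Rightarrow> real \<Rightarrow> real"
  where "trial' q t = (if 0 < t \<and> t < 7 then (15 / 112) powr (q / 2) * (q * t powr (q - 1))
    else if 7 < t \<and> t < 9 then (15 / 16) powr (q / 2) * (q / 2 * t powr (q / 2 - 1)) else 0)"

lemma trial_powr:
  assumes q: "0 < q" and t: "0 \<le> t"
  shows "\<bar>trial q t\<bar> powr (2 / q) = (if t \<le> 7 then 15 / 112 * t\<^sup>2 else if t \<le> 9 then 15 / 16 * t else 15 / 16 * 9)"
proof -
  have e: "(x powr (q / 2)) powr (2 / q) = x" if "0 \<le> x" for x :: real
    using that q by (simp add: powr_powr)
  have e2: "(x powr q) powr (2 / q) = x\<^sup>2" if "0 \<le> x" for x :: real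
    using that q by (cases "x = 0") (auto simp: powr_powr powr_numeral)
  show ?thesis using t by (simp add: trial_def powr_mult e e2)
qed

lemma trial_match:
  fixes q :: real
  shows "(15 / 112) powr (q / 2) * 7 powr q = (15 / 16) powr (q / 2) * 7 powr (q / 2)"
proof -
  have "(7::real) powr q = 7 powr (q / 2) * 7 powr (q / 2)" by (simp flip: powr_add)
  moreover have "(15 / 112 * 7) powr (q / 2) = (15 / 112) powr (q / 2) * 7 powr (q / 2)" by (rule powr_mult)
  ultimately show ?thesis by simp
qed

lemma trial_continuous:
  assumes q: "0 < q"
  shows "continuous_on {0..} (trial q)"
proof -
  have "continuous_on ({0..7} \<union> {7..}) (trial q)"
    unfolding trial_def[abs_def]
  proof (rule continuous_on_cases)
    have "continuous_on ({7..9} \<union> {9..}) (\<lambda>t. if t \<le> 9 then (15 / 16) powr (q / 2) * t powr (q / 2) else (15 / 16) powr (q / 2) * 9 powr (q / 2))"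
      using q by (intro continuous_on_cases) (auto intro!: continuous_intros continuous_on_powr')
    moreover have "{7..9} \<union> {9..} = {7::real..}" by auto
    ultimately show "continuous_on {7..} (\<lambda>t. if t \<le> 9 then (15 / 16) powr (q / 2) * t powr (q / 2) else (15 / 16) powr (q / 2) * 9 powr (q / 2))"
      by simp
    show "continuous_on {0..7} (\<lambda>t. (15 / 112) powr (q / 2) * t powr q)"
      using q by (intro continuous_intros continuous_on_powr') auto
    show "\<forall>x. x \<in> {0..7} \<and> \<not> x \<le> 7 \<or> x \<in> {7..} \<and> x \<le> 7 \<longrightarrow> (15 / 112) powr (q / 2) * x powr q =
      (if x \<le> 9 then (15 / 16) powr (q / 2) * x powr (q / 2) else (15 / 16) powr (q / 2) * 9 powr (q / 2))"
    proof (intro allI impI)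
      fix x :: real assume "x \<in> {0..7} \<and> \<not> x \<le> 7 \<or> x \<in> {7..} \<and> x \<le> 7"
      then have "x = 7" by auto
      then show "(15 / 112) powr (q / 2) * x powr q =
        (if x \<le> 9 then (15 / 16) powr (q / 2) * x powr (q / 2) else (15 / 16) powr (q / 2) * 9 powr (q / 2))"
        using trial_match[of q] by simp
    qed
  qed auto
  moreover have "{0..7} \<union> {7..} = {0::real..}" by auto
  ultimately show ?thesis by simp
qed

lemma trial'_has_integral:
  assumes q: "0 < q" and t: "0 \<le> t"
  shows "(trial' q has_integral trial q t) {0..t}"
proof -
  have "(trial' q has_integral (trial q t - trial q 0)) {0..t}"
  proof (rule fundamental_theorem_of_calculus_interior_strong[of "{7, 9}"])
    show "continuous_on {0..t} (trial q)" by (rule continuous_on_subset[OF trial_continuous[OF q]]) auto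
    fix x assume x: "x \<in> {0<..<t} - {7, 9}"
    have "(trial q has_real_derivative trial' q x) (at x)"
    proof -
      consider "0 < x" "x < 7" | "7 < x" "x < 9" | "9 < x" using x by fastforce
      then show ?thesis
      proof cases
        case 1
        have "((\<lambda>t. (15 / 112) powr (q / 2) * t powr q) has_real_derivative trial' q x) (at x)"
          using 1 by (auto intro!: derivative_eq_intros simp: trial'_def)
        then show ?thesis
          by (rule has_field_derivative_transform_within_open[where S="{0<..<7}"]) (use 1 in \<open>auto simp: trial_def\<close>)
      next
        case 2
        have "((\<lambda>t. (15 / 16) powr (q / 2) * t powr (q / 2)) has_real_derivative trial' q x) (at x)"
          using 2 by (auto intro!: derivative_eq_intros simp: trial'_def)
        then show ?thesis
          by (rule has_field_derivative_transform_within_open[where S="{7<..<9}"]) (use 2 in \<open>auto simp: trial_def\<close>)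
      next
        case 3
        have "((\<lambda>t. (15 / 16) powr (q / 2) * 9 powr (q / 2)) has_real_derivative trial' q x) (at x)"
          using 3 by (simp add: trial'_def)
        then show ?thesis
          by (rule has_field_derivative_transform_within_open[where S="{9<..}"]) (use 3 in \<open>auto simp: trial_def\<close>)
      qed
    qed
    then show "(trial q has_vector_derivative trial' q x) (at x)"
      by (simp add: has_real_derivative_iff_has_vector_derivative)
  qed (use t in auto)
  then show ?thesis using q by (simp add: trial_def)
qed

lemma trial_energy:
  assumes q: "0 < q" "q \<le> 1"
  shows "energy q (trial' q) \<le> 1"
proof -
  define h where "h = (15 / 16 :: real) powr q"
  have sq: "((15 / 112) powr (q / 2))\<^sup>2 * 7 powr q = h" "((15 / 16) powr (q / 2))\<^sup>2 = h"
  proof -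
    have "((15 / 112 :: real) powr (q / 2))\<^sup>2 = (15 / 112) powr q" by (simp add: power2_eq_square flip: powr_add)
    moreover have "(15 / 112 :: real) powr q * 7 powr q = (15 / 112 * 7) powr q" by (rule powr_mult[symmetric])
    ultimately show "((15 / 112) powr (q / 2))\<^sup>2 * 7 powr q = h" by (simp add: h_def)
    show "((15 / 16) powr (q / 2))\<^sup>2 = h" by (simp add: h_def power2_eq_square flip: powr_add)
  qed
  have i1: "((\<lambda>t. ((15 / 112) powr (q / 2))\<^sup>2 * (q * t powr (q - 1))) has_integral h) {0..7}"
  proof -
    have "((\<lambda>t. q * t powr (q - 1)) has_integral (7 powr q - 0 powr q)) {0..7}"
    proof (rule fundamental_theorem_of_calculus_interior)
      show "continuous_on {0..7} (\<lambda>t. t powr q)" using q by (intro continuous_on_powr' continuous_intros) auto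
      show "((\<lambda>t. t powr q) has_vector_derivative q * x powr (q - 1)) (at x)" if "x \<in> {0<..<7}" for x
        using that by (auto simp flip: has_real_derivative_iff_has_vector_derivative intro!: derivative_eq_intros)
    qed simp
    from has_integral_mult_right[OF this, of "((15 / 112) powr (q / 2))\<^sup>2"] show ?thesis using q sq by simp
  qed
  have i2: "((\<lambda>t. h * (q / 4) * (1 / t)) has_integral h * (q / 4) * (ln 9 - ln 7)) {7..9}"
  proof (rule has_integral_mult_right, rule fundamental_theorem_of_calculus)
    show "(ln has_vector_derivative 1 / x) (at x within {7..9})" if "x \<in> {7..9}" for x :: real
      using that by (auto simp flip: has_real_derivative_iff_has_vector_derivative intro!: derivative_eq_intros)
  qed simp
  have "energy q (trial' q) \<le> (\<integral>\<^sup>+t. indicator {0..7} t * ennreal (((15 / 112) powr (q / 2))\<^sup>2 * (q * t powr (q - 1)))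
      + indicator {7..9} t * ennreal (h * (q / 4) * (1 / t)) \<partial>lborel)"
    unfolding energy_def
  proof (rule nn_integral_mono)
    fix t :: real
    consider "t \<le> 0 \<or> t = 7 \<or> 9 \<le> t" | "0 < t" "t < 7" | "7 < t" "t < 9" by linarith
    then show "indicator {0<..} t * ennreal (t powr (1 - q) * (trial' q t)\<^sup>2 / q) \<le> indicator {0..7} t * ennreal (((15 / 112) powr (q / 2))\<^sup>2 * (q * t powr (q - 1)))
      + indicator {7..9} t * ennreal (h * (q / 4) * (1 / t))"
    proof cases
      case 1
      then show ?thesis by (auto simp: trial'_def)
    next
      case 2
      have "t powr (1 - q) * (q * t powr (q - 1))\<^sup>2 / q = (t powr (1 - q) * t powr (q - 1)) * (q * t powr (q - 1))"
        using q by (simp add: power2_eq_square)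
      also have "t powr (1 - q) * t powr (q - 1) = 1" using 2 by (simp flip: powr_add)
      finally have eq: "t powr (1 - q) * (q * t powr (q - 1))\<^sup>2 / q = q * t powr (q - 1)" by simp
      have "t powr (1 - q) * (trial' q t)\<^sup>2 / q = ((15 / 112) powr (q / 2))\<^sup>2 * (t powr (1 - q) * (q * t powr (q - 1))\<^sup>2 / q)"
        using 2 by (simp add: trial'_def power_mult_distrib)
      then have "t powr (1 - q) * (trial' q t)\<^sup>2 / q = ((15 / 112) powr (q / 2))\<^sup>2 * (q * t powr (q - 1))"
        unfolding eq .
      then show ?thesis using 2 by simp
    next
      case 3
      have "t powr (1 - q) * (q / 2 * t powr (q / 2 - 1))\<^sup>2 / q = q / 4 * (t powr (1 - q) * (t powr (q / 2 - 1) * t powr (q / 2 - 1)))"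
        using q by (simp add: power2_eq_square)
      also have "t powr (1 - q) * (t powr (q / 2 - 1) * t powr (q / 2 - 1)) = 1 / t"
        using 3 by (simp add: powr_minus_divide flip: powr_add)
      finally have eq: "t powr (1 - q) * (q / 2 * t powr (q / 2 - 1))\<^sup>2 / q = q / 4 * (1 / t)" .
      have "trial' q t = (15 / 16) powr (q / 2) * (q / 2 * t powr (q / 2 - 1))" using 3 by (simp add: trial'_def)
      then have "t powr (1 - q) * (trial' q t)\<^sup>2 / q = h * (t powr (1 - q) * (q / 2 * t powr (q / 2 - 1))\<^sup>2 / q)"
        by (simp only: power_mult_distrib sq(2)) simp
      then have "t powr (1 - q) * (trial' q t)\<^sup>2 / q = h * (q / 4) * (1 / t)"
        unfolding eq by simp
      then show ?thesis using 3 by simp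
    qed
  qed
  also have "\<dots> = ennreal h + ennreal (h * (q / 4) * (ln 9 - ln 7))"
  proof -
    have "(\<integral>\<^sup>+t. indicator {0..7} t * ennreal (((15 / 112) powr (q / 2))\<^sup>2 * (q * t powr (q - 1))) \<partial>lborel) = ennreal h"
      by (rule nn_integral_indicator_has_integral[OF _ i1]) (use q in auto)
    moreover have "(\<integral>\<^sup>+t. indicator {7..9} t * ennreal (h * (q / 4) * (1 / t)) \<partial>lborel) = ennreal (h * (q / 4) * (ln 9 - ln 7))"
      by (rule nn_integral_indicator_has_integral[OF _ i2]) (use q in \<open>auto simp: h_def\<close>)
    moreover have "(\<integral>\<^sup>+t. indicator {0..7} t * ennreal (((15 / 112) powr (q / 2))\<^sup>2 * (q * t powr (q - 1)))
        + indicator {7..9} t * ennreal (h * (q / 4) * (1 / t)) \<partial>lborel)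
      = (\<integral>\<^sup>+t. indicator {0..7} t * ennreal (((15 / 112) powr (q / 2))\<^sup>2 * (q * t powr (q - 1))) \<partial>lborel)
        + (\<integral>\<^sup>+t. indicator {7..9} t * ennreal (h * (q / 4) * (1 / t)) \<partial>lborel)"
      by (rule nn_integral_add) measurable
    ultimately show ?thesis by (simp only:)
  qed
  also have "\<dots> = ennreal (h * (1 + q / 4 * (ln 9 - ln 7)))"
  proof -
    have "0 \<le> h" by (simp add: h_def)
    moreover from this have "0 \<le> h * (q / 4) * (ln 9 - ln 7)" using q by simp
    moreover have "h * (1 + q / 4 * L) = h + h * (q / 4) * L" for L by (simp add: distrib_left)
    ultimately show ?thesis by (simp only: ennreal_plus)
  qed
  also have "\<dots> \<le> 1"
  proof -
    have "ln 9 - ln 7 = ln (9 / 7 :: real)" by (simp add: ln_div)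
    also have "\<dots> \<le> ln ((16 / 15) ^ 4)" by (simp add: power4_eq_xxxx)
    also have "\<dots> = 4 * ln (16 / 15)" by (simp add: ln_realpow)
    finally have "q / 4 * (ln 9 - ln 7) \<le> q / 4 * (4 * ln (16 / 15))" using q by (intro mult_left_mono) auto
    then have "1 + q / 4 * (ln 9 - ln 7) \<le> 1 + q * ln (16 / 15)" by simp
    \<comment> \<open>The right-hand side is (16 / 15) powr q, the inverse of h, so the energy bound
      is 1 for all q at once.\<close>
    also have "\<dots> \<le> exp (q * ln (16 / 15))" by (rule exp_ge_add_one_self)
    finally have "h * (1 + q / 4 * (ln 9 - ln 7)) \<le> h * exp (q * ln (16 / 15))" by (intro mult_left_mono) (auto simp: h_def)
    also have "h * exp (q * ln (16 / 15)) = 1"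
    proof -
      have "h * (16 / 15) powr q = (15 / 16 * (16 / 15)) powr q" unfolding h_def by (rule powr_mult[symmetric])
      then show ?thesis by (simp add: powr_def)
    qed
    finally show ?thesis by (simp add: ennreal_le_1)
  qed
  finally show ?thesis .
qed

text \<open>By \<open>trial_powr\<close> the integrand is the same for all q, so one numerical
  estimate serves every \<beta>. On unit intervals up to 7 and on {7..9} Jensen's inequality
  replaces the exponent by its mean; the part beyond 9 integrates exactly to exp (- 9 / 16).\<close>

lemma trial_moser:
  assumes q: "0 < q"
  shows "ennreal (1 + exp 1) < moser q (trial q)"
proof -
  define f where "f t = exp (\<bar>trial q t\<bar> powr (2 / q) - t)" for t
  have contf: "continuous_on {a..b} f" if "0 \<le> a" for a b
    unfolding f_def using q that
    by (intro continuous_intros continuous_on_powr' continuous_on_subset[OF trial_continuous[OF q]]) auto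
  \<comment> \<open>The exponent is the mean over {a..b} of \<open>15 / 112 * t\<^sup>2 - t\<close>;
    on the unit intervals it takes the seven values listed below.\<close>
  have piece: "(b - a) * exp (5 / 112 * (a\<^sup>2 + a * b + b\<^sup>2) - (a + b) / 2) \<le> integral {a..b} f"
    if ab: "0 \<le> a" "a < b" "b \<le> 7" for a b
  proof -
    have "integral {a..b} f = integral {a..b} (\<lambda>t. exp (15 / 112 * t\<^sup>2 - t))"
      by (rule integral_cong) (use ab q in \<open>auto simp: f_def trial_powr\<close>)
    moreover have "((\<lambda>t. 15 / 112 * t\<^sup>2 - t) has_integral ((5 / 112 * b ^ 3 - b\<^sup>2 / 2) - (5 / 112 * a ^ 3 - a\<^sup>2 / 2))) {a..b}"
      by (rule fundamental_theorem_of_calculus)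
        (use ab in \<open>auto simp flip: has_real_derivative_iff_has_vector_derivative intro!: derivative_eq_intros\<close>)
    moreover have "(5 / 112 * b ^ 3 - b\<^sup>2 / 2) - (5 / 112 * a ^ 3 - a\<^sup>2 / 2) = (b - a) * (5 / 112 * (a\<^sup>2 + a * b + b\<^sup>2) - (a + b) / 2)"
      by (simp add: field_simps power2_eq_square power3_eq_cube)
    ultimately show ?thesis
      using integral_exp_ge[OF ab(2), of "\<lambda>t. 15 / 112 * t\<^sup>2 - t"] by (simp add: continuous_intros)
  qed
  have piece2: "2 * exp (- 1 / 2) \<le> integral {7..9} f"
  proof -
    have "integral {7..9} f = integral {7..9} (\<lambda>t. exp (- (1 / 16) * t))"
      by (rule integral_cong) (use q in \<open>auto simp: f_def trial_powr\<close>)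
    moreover have "((\<lambda>t. - (1 / 16) * t) has_integral (- (1 / 32) * 9\<^sup>2 - - (1 / 32) * 7\<^sup>2)) {7..9::real}"
      by (rule fundamental_theorem_of_calculus)
        (auto simp flip: has_real_derivative_iff_has_vector_derivative intro!: derivative_eq_intros)
    then have "((\<lambda>t. - (1 / 16) * t) has_integral (9 - 7) * (- 1 / 2)) {7..9::real}" by simp
    ultimately show ?thesis
      using integral_exp_ge[of 7 9 "\<lambda>t. - (1 / 16) * t" "- 1 / 2"] by (simp add: continuous_intros)
  qed
  have comb: "integral {a..b} f + integral {b..9} f = integral {a..9} f" if "0 \<le> a" "a \<le> b" "b \<le> 9" for a b
    by (rule Henstock_Kurzweil_Integration.integral_combine) (use that contf in \<open>auto intro: integrable_continuous_real\<close>)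
  \<comment> \<open>Rational lower bounds for the exponentials reduce the comparison with 1 + e,
    which is below 3.72, to exact arithmetic.\<close>
  have E: "(1 - x / 16) ^ 16 \<le> exp (- x)" if "x \<le> 16" for x :: real
    using exp_ge_one_minus_x_over_n_power_n[of x 16] that by simp
  have "(1 - 51 / 112 / 16) ^ 16 + (1 - 19 / 16 / 16) ^ 16 + (1 - 185 / 112 / 16) ^ 16 + (1 - 207 / 112 / 16) ^ 16
     + (1 - 199 / 112 / 16) ^ 16 + (1 - 23 / 16 / 16) ^ 16 + (1 - 93 / 112 / 16) ^ 16 + 2 * (1 - 1 / 2 / 16) ^ 16
     \<le> exp (- (51 / 112)) + exp (- (19 / 16)) + exp (- (185 / 112)) + exp (- (207 / 112))
      + exp (- (199 / 112)) + exp (- (23 / 16)) + exp (- (93 / 112)) + 2 * exp (- (1 / 2) :: real)"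
    by (intro add_mono mult_left_mono E) auto
  also have "\<dots> \<le> integral {0..9} f"
  proof -
    have p: "exp (- (51 / 112)) \<le> integral {0..1} f" "exp (- (19 / 16)) \<le> integral {1..2} f" "exp (- (185 / 112)) \<le> integral {2..3} f"
      "exp (- (207 / 112)) \<le> integral {3..4} f" "exp (- (199 / 112)) \<le> integral {4..5} f" "exp (- (23 / 16)) \<le> integral {5..6} f"
      "exp (- (93 / 112)) \<le> integral {6..7} f" "2 * exp (- (1 / 2)) \<le> integral {7..9} f"
      using piece[of 0 1] piece[of 1 2] piece[of 2 3] piece[of 3 4] piece[of 4 5] piece[of 5 6] piece[of 6 7] piece2
      by simp_all
    have "integral {0..1} f + (integral {1..2} f + (integral {2..3} f + (integral {3..4} f + (integral {4..5} f
      + (integral {5..6} f + (integral {6..7} f + integral {7..9} f)))))) = integral {0..9} f"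
      by (simp add: comb)
    then show ?thesis using p by linarith
  qed
  finally have I: "(1 - 51 / 112 / 16) ^ 16 + (1 - 19 / 16 / 16) ^ 16 + (1 - 185 / 112 / 16) ^ 16 + (1 - 207 / 112 / 16) ^ 16
     + (1 - 199 / 112 / 16) ^ 16 + (1 - 23 / 16 / 16) ^ 16 + (1 - 93 / 112 / 16) ^ 16 + 2 * (1 - 1 / 2 / 16) ^ 16
     \<le> integral {0..9} f" .
  have T: "(1 - 9 / 16 / 16) ^ 16 \<le> exp (- (9 / 16 :: real))" by (rule E) simp
  have num: "1 + 272 / 100 < (1 - 51 / 112 / 16) ^ 16 + (1 - 19 / 16 / 16) ^ 16 + (1 - 185 / 112 / 16) ^ 16 + (1 - 207 / 112 / 16) ^ 16
     + (1 - 199 / 112 / 16) ^ 16 + (1 - 23 / 16 / 16) ^ 16 + (1 - 93 / 112 / 16) ^ 16 + 2 * (1 - 1 / 2 / 16) ^ 16 + (1 - 9 / 16 / 16 :: real) ^ 16"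
    by (simp add: power_divide)
  have "1 + exp 1 < integral {0..9} f + exp (- (9 / 16))"
    using num I T e_less_272 by linarith
  then have "ennreal (1 + exp 1) < ennreal (integral {0..9} f + exp (- (9 / 16)))"
    using exp_gt_zero[of 1] by (intro ennreal_lessI) linarith
  also have "ennreal (integral {0..9} f + exp (- (9 / 16))) = ennreal (integral {0..9} f) + ennreal (exp (- (9 / 16)))"
    by (intro ennreal_plus Henstock_Kurzweil_Integration.integral_nonneg integrable_continuous_real contf) (auto simp: f_def)
  also have "ennreal (integral {0..9} f) = (\<integral>\<^sup>+t. indicator {0..9} t * ennreal (f t) \<partial>lborel)"
    by (rule nn_integral_indicator_has_integral[symmetric]) (auto simp: f_def[symmetric] intro!: integrable_integral integrable_continuous_real contf, simp add: f_def)
  also have "ennreal (exp (- (9 / 16))) = (\<integral>\<^sup>+t. ennreal (exp (135 / 16)) * (ennreal (exp (- 1 * t)) * indicator {9..} t) \<partial>lborel)"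
    by (subst nn_integral_cmult, simp, subst nn_integral_exp_tail) (auto simp: ennreal_mult'[symmetric] simp flip: exp_add)
  also have "(\<integral>\<^sup>+t. indicator {0..9} t * ennreal (f t) \<partial>lborel) + \<dots> = (\<integral>\<^sup>+t. indicator {0..9} t * ennreal (f t) + ennreal (exp (135 / 16)) * (ennreal (exp (- 1 * t)) * indicator {9..} t) \<partial>lborel)"
  proof (rule nn_integral_add[symmetric])
    have "(\<lambda>t. if t \<in> {0..9} then f t else 0) \<in> borel_measurable borel"
      by (rule borel_measurable_continuous_on_if) (auto intro: contf)
    then have "(\<lambda>t. ennreal (if t \<in> {0..9} then f t else 0)) \<in> borel_measurable lborel" by simp
    also have "(\<lambda>t. ennreal (if t \<in> {0..9} then f t else 0)) = (\<lambda>t. indicator {0..9} t * ennreal (f t))"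
      by (auto simp: fun_eq_iff indicator_def)
    finally show "(\<lambda>t. indicator {0..9} t * ennreal (f t)) \<in> borel_measurable lborel" .
  qed simp
  also have "\<dots> = moser q (trial q)"
    unfolding moser_def
  proof (rule nn_integral_cong_AE)
    show "AE t in lborel. indicator {0..9} t * ennreal (f t) + ennreal (exp (135 / 16)) * (ennreal (exp (- 1 * t)) * indicator {9..} t)
      = indicator {0<..} t * ennreal (exp (\<bar>trial q t\<bar> powr (2 / q) - t))"
      using AE_lborel_singleton[of "0::real"] AE_lborel_singleton[of "9::real"]
    proof eventually_elim
      case (elim t)
      consider "t < 0" | "0 < t" "t < 9" | "9 < t" using elim by linarith
      then show ?case
      proof cases
        case 3
        then have "exp (135 / 16) * exp (- 1 * t) = exp (\<bar>trial q t\<bar> powr (2 / q) - t)"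
          using q by (simp add: trial_powr flip: exp_add)
        then show ?thesis using 3 by (simp add: ennreal_mult'[symmetric])
      qed (auto simp: f_def)
    qed
  qed
  finally show ?thesis .
qed

text \<open>A smooth factor with values in [0, 1] that tends to 1 between a and b as N grows. The
  shift by 1 makes it vanish up to a + 1 / N, so that for a = 0 a whole neighbourhood of the
  singularity of t powr r is removed.\<close>

definition plateau :: "real \<Rightarrow> real \<Rightarrow> real \<Rightarrow> real \<Rightarrow> real"
  where "plateau N a b t = bump (N * (t - a) - 1) * bump (N * (b - t) - 1)"

lemma plateau_bounds: "0 \<le> plateau N a b t" "plateau N a b t \<le> 1"
  unfolding plateau_def by (auto intro!: mult_nonneg_nonneg mult_le_one bump_bounds)

lemma plateau_zero:
  assumes "0 < N" "t \<le> a + 1 / N \<or> b \<le> t"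
  shows "plateau N a b t = 0"
proof -
  have "N * (t - a) - 1 \<le> 0 \<or> N * (b - t) - 1 \<le> 0"
  proof (rule disjE[OF assms(2)])
    assume "t \<le> a + 1 / N"
    then have "N * (t - a) \<le> N * (1 / N)" using assms(1) by (intro mult_left_mono) auto
    then show ?thesis using assms(1) by simp
  next
    assume "b \<le> t"
    then have "N * (b - t) \<le> 0" using assms(1) by (intro mult_nonneg_nonpos) auto
    then show ?thesis by simp
  qed
  then show ?thesis by (auto simp: plateau_def bump_def)
qed

lemma plateau_tendsto:
  assumes "a < t" "t < b"
  shows "(\<lambda>n. plateau (real (Suc n)) a b t) \<longlonglongrightarrow> 1"
proof -
  have *: "(\<lambda>n. bump (real (Suc n) * d - 1)) \<longlonglongrightarrow> 1" if d: "0 < d" for d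
  proof -
    have lim: "filterlim (\<lambda>n. real (Suc n) * d - 1) at_top sequentially" using d by real_asymp
    have "((\<lambda>x. exp (- (1 / x))) \<longlongrightarrow> (1::real)) at_top" by real_asymp
    from filterlim_compose[OF this lim]
    have "(\<lambda>n. exp (- (1 / (real (Suc n) * d - 1)))) \<longlonglongrightarrow> 1" .
    moreover have "\<forall>\<^sub>F n in sequentially. exp (- (1 / (real (Suc n) * d - 1))) = bump (real (Suc n) * d - 1)"
      using lim[unfolded filterlim_at_top_dense, rule_format, of 0] by eventually_elim (simp add: bump_def)
    ultimately show ?thesis by (rule Lim_transform_eventually)
  qed
  have "(\<lambda>n. bump (real (Suc n) * (t - a) - 1) * bump (real (Suc n) * (b - t) - 1)) \<longlonglongrightarrow> 1 * 1"
    using assms by (intro tendsto_mult *) auto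
  then show ?thesis by (simp add: plateau_def)
qed

text \<open>Two overlapping open half-lines cover the line: left of a + 1 / N the product is zero,
  and on the positive axis every factor is smooth.\<close>

lemma D_k_plateau_powr:
  assumes N: "0 < N" and a: "0 \<le> a"
  shows "D_k k (\<lambda>t. plateau N a b t * t powr r) UNIV"
proof -
  let ?f = "\<lambda>t. plateau N a b t * t powr r"
  have "D_k k ?f {..<a + 1 / N}"
    by (rule D_k_cong[OF _ _ D_k_const[of k 0]]) (auto simp: plateau_zero[OF N])
  moreover have "D_k k ?f {0<..}"
  proof -
    have b: "D_k k (\<lambda>t. bump (c * t + d)) {0<..}" for c d
      by (rule D_k_compose[OF D_k_bump D_k_affine]) simp
    have "D_k k (\<lambda>t. bump (N * t + (- N * a - 1)) * bump (- N * t + (N * b - 1)) * t powr r) {0<..}"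
      by (rule D_k_mult[OF D_k_mult[OF b b] D_k_powr])
    then show ?thesis by (simp add: plateau_def algebra_simps)
  qed
  ultimately have "D_k k ?f ({..<a + 1 / N} \<union> {0<..})"
    by (intro D_k_union) auto
  moreover have "0 < a + 1 / N" using N a by (simp add: add_nonneg_pos)
  then have "{..<a + 1 / N} \<union> {0<..} = (UNIV :: real set)"
    by (auto simp: set_eq_iff not_less)
  ultimately show ?thesis by simp
qed

text \<open>The trial profile has corners. Its derivative is multiplied by plateaus: the result
  stays below \<open>trial'\<close>, so the energy bound survives, and the primitives converge to
  \<open>trial q\<close>, so by Fatou's lemma the strict inequality survives for some n.\<close>

lemma sharp_smooth_profile:
  assumes q: "0 < q" "q \<le> 1"
  obtains v w :: "real \<Rightarrow> real" and a b where "\<And>k. D_k k v UNIV" "0 < a" "a < b" "\<And>t. t < a \<or> b < t \<Longrightarrow> v t = 0"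
    "\<And>t. (w has_real_derivative v t) (at t)" "w 0 = 0" "energy q v \<le> 1" "ennreal (1 + exp 1) < moser q w"
proof -
  define c1 c2 where "c1 = (15 / 112) powr (q / 2) * q" and "c2 = (15 / 16) powr (q / 2) * (q / 2)"
  have c: "0 \<le> c1" "0 \<le> c2" using q by (auto simp: c1_def c2_def)
  define vn where "vn n t = c1 * (plateau (real (Suc n)) 0 7 t * t powr (q - 1)) + c2 * (plateau (real (Suc n)) 7 9 t * t powr (q / 2 - 1))" for n t
  have vk: "D_k k (vn n) UNIV" for k n
    unfolding vn_def[abs_def] by (intro D_k_lin D_k_plateau_powr) auto
  have N0: "0 < real (Suc n)" for n by simp
  have z1: "plateau (real (Suc n)) 0 7 t = 0" if "t \<le> 0 \<or> 7 \<le> t" for n t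
    by (rule plateau_zero[OF N0]) (use that in \<open>auto intro: order_trans\<close>)
  have z2: "plateau (real (Suc n)) 7 9 t = 0" if "t \<le> 7 \<or> 9 \<le> t" for n t
    by (rule plateau_zero[OF N0]) (use that in \<open>auto intro: order_trans\<close>)
  have vb: "0 \<le> vn n t \<and> vn n t \<le> trial' q t" for n t
  proof -
    have b: "x * (plateau N a b t * y) \<le> x * y" if "0 \<le> x" "0 \<le> y" for x y N a b
      using that plateau_bounds[of N a b t] by (intro mult_left_mono) (auto intro: mult_left_le_one_le)
    consider "t \<le> 0 \<or> t = 7 \<or> 9 \<le> t" | "0 < t" "t < 7" | "7 < t" "t < 9" by linarith
    then show ?thesis
    proof cases
      case 1
      then show ?thesis using z1[of t n] z2[of t n] by (auto simp: vn_def trial'_def)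
    next
      case 2
      have e: "vn n t = c1 * (plateau (real (Suc n)) 0 7 t * t powr (q - 1))" using 2 z2[of t n] by (simp add: vn_def)
      have e': "trial' q t = c1 * t powr (q - 1)" using 2 by (simp add: trial'_def c1_def)
      show ?thesis unfolding e e' using c by (intro conjI b mult_nonneg_nonneg plateau_bounds) auto
    next
      case 3
      have e: "vn n t = c2 * (plateau (real (Suc n)) 7 9 t * t powr (q / 2 - 1))" using 3 z1[of t n] by (simp add: vn_def)
      have e': "trial' q t = c2 * t powr (q / 2 - 1)" using 3 by (simp add: trial'_def c2_def)
      show ?thesis unfolding e e' using c by (intro conjI b mult_nonneg_nonneg plateau_bounds) auto
    qed
  qed
  have vlim: "(\<lambda>n. vn n t) \<longlonglongrightarrow> trial' q t" for t
  proof -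
    consider "t \<le> 0 \<or> t = 7 \<or> 9 \<le> t" | "0 < t" "t < 7" | "7 < t" "t < 9" by linarith
    then show ?thesis
    proof cases
      case 1
      then have "vn n t = trial' q t" for n using z1[of t n] z2[of t n] by (auto simp: vn_def trial'_def)
      then show ?thesis by simp
    next
      case 2
      have e: "vn n t = c1 * (plateau (real (Suc n)) 0 7 t * t powr (q - 1))" for n using 2 z2[of t n] by (simp add: vn_def)
      have e': "trial' q t = c1 * (1 * t powr (q - 1))" using 2 by (simp add: trial'_def c1_def)
      show ?thesis unfolding e e' by (intro tendsto_intros plateau_tendsto 2)
    next
      case 3
      have e: "vn n t = c2 * (plateau (real (Suc n)) 7 9 t * t powr (q / 2 - 1))" for n using 3 z1[of t n] by (simp add: vn_def)
      have e': "trial' q t = c2 * (1 * t powr (q / 2 - 1))" using 3 by (simp add: trial'_def c2_def)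
      show ?thesis unfolding e e' by (intro tendsto_intros plateau_tendsto 3)
    qed
  qed
  have contv: "continuous_on S (vn n)" for n S
  proof -
    obtain v' where "\<And>x. (vn n has_real_derivative v' x) (at x)" by (rule D_k_UNIV_SucE[OF vk[of "Suc 0"]]) (rule that)
    then show ?thesis by (intro DERIV_continuous_on[where D=v']) (rule has_field_derivative_at_within)
  qed
  \<comment> \<open>The lower end -1 lies to the left of the support, so that the primitive is
    differentiable from both sides at t = 0.\<close>
  define wn where "wn n t = integral {-1..t} (vn n)" for n t
  have wn0: "wn n t = 0" if "t \<le> 0" for n t
  proof -
    have "wn n t = integral {-1..t} (\<lambda>_. 0)" unfolding wn_def
      by (rule integral_cong) (use that z1 z2 in \<open>auto simp: vn_def\<close>)
    then show ?thesis by simp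
  qed
  have wd: "(wn n has_real_derivative vn n t) (at t)" for n t
  proof (cases "t < 0")
    case True
    have "vn n t = 0" using True z1[of t n] z2[of t n] by (simp add: vn_def)
    moreover have "(wn n has_real_derivative 0) (at t)"
      by (rule has_field_derivative_transform_within_open[OF DERIV_const[of 0], where S="{..<0}"]) (use True wn0 in auto)
    ultimately show ?thesis by simp
  next
    case False
    then have "(wn n has_real_derivative vn n t) (at t within {-1..t + 1})"
      unfolding wn_def by (intro integral_has_real_derivative contv) auto
    then show ?thesis using False at_within_Icc_at[of "-1" t "t + 1"] by simp
  qed
  have wint: "(vn n has_integral wn n t) {0..t}" if "0 \<le> t" for n t
  proof -
    have "(vn n has_integral (wn n t - wn n 0)) {0..t}"
      by (rule fundamental_theorem_of_calculus[OF that])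
        (use wd in \<open>auto simp flip: has_real_derivative_iff_has_vector_derivative intro: has_field_derivative_at_within\<close>)
    then show ?thesis by (simp add: wn0)
  qed
  have wlim: "(\<lambda>n. wn n t) \<longlonglongrightarrow> trial q t" if "0 \<le> t" for t
  proof -
    note ti = trial'_has_integral[OF q(1) that]
    have "(\<lambda>n. integral {0..t} (vn n)) \<longlonglongrightarrow> integral {0..t} (trial' q)"
    proof (rule dominated_convergence(2)[where h="trial' q"])
      show "vn n integrable_on {0..t}" for n by (rule has_integral_integrable[OF wint[OF that]])
      show "trial' q integrable_on {0..t}" by (rule has_integral_integrable[OF ti])
    qed (use vb vlim in auto)
    then show ?thesis using integral_unique[OF ti] integral_unique[OF wint[OF that]] by simp
  qed
  have contw: "continuous_on UNIV (wn n)" for n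
    by (rule DERIV_continuous_on[where D="vn n"]) (use wd in simp)
  have [measurable]: "wn n \<in> borel_measurable borel" for n by (rule borel_measurable_continuous_onI[OF contw])
  have "moser q (trial q) = (\<integral>\<^sup>+t. liminf (\<lambda>n. indicator {0<..} t * ennreal (exp (\<bar>wn n t\<bar> powr (2 / q) - t))) \<partial>lborel)"
    unfolding moser_def
  proof (rule nn_integral_cong)
    fix t :: real
    show "indicator {0<..} t * ennreal (exp (\<bar>trial q t\<bar> powr (2 / q) - t)) = liminf (\<lambda>n. indicator {0<..} t * ennreal (exp (\<bar>wn n t\<bar> powr (2 / q) - t)))"
    proof (cases "0 < t")
      case True
      have "(\<lambda>n. ennreal (exp (\<bar>wn n t\<bar> powr (2 / q) - t))) \<longlonglongrightarrow> ennreal (exp (\<bar>trial q t\<bar> powr (2 / q) - t))"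
        using q True by (intro tendsto_ennrealI tendsto_intros tendsto_abs_powr_0 wlim) auto
      then have "liminf (\<lambda>n. ennreal (exp (\<bar>wn n t\<bar> powr (2 / q) - t))) = ennreal (exp (\<bar>trial q t\<bar> powr (2 / q) - t))"
        by (rule lim_imp_Liminf[OF sequentially_bot])
      then show ?thesis using True by simp
    next
      case False
      then show ?thesis by (simp add: lim_imp_Liminf)
    qed
  qed
  also have "\<dots> \<le> liminf (\<lambda>n. moser q (wn n))"
    unfolding moser_def by (rule nn_integral_liminf) measurable
  finally have "ennreal (1 + exp 1) < liminf (\<lambda>n. moser q (wn n))"
    using trial_moser[OF q(1)] by (rule less_le_trans[rotated])
  then have "\<forall>\<^sub>F n in sequentially. ennreal (1 + exp 1) < moser q (wn n)" by (rule less_LiminfD)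
  then obtain n where n: "ennreal (1 + exp 1) < moser q (wn n)" using eventually_happens by fastforce
  show ?thesis
  proof (rule that[of "vn n" "1 / real (Suc n)" 10 "wn n"])
    have "1 / real (Suc n) \<le> 1" by (simp add: divide_le_eq)
    then show "1 / real (Suc n) < 10" by linarith
    show "vn n t = 0" if "t < 1 / real (Suc n) \<or> 10 < t" for t
    proof -
      have "1 / real (Suc n) \<le> 1" by (simp add: divide_le_eq)
      then have "t \<le> 7 \<or> 9 \<le> t" using that by linarith
      moreover have "plateau (real (Suc n)) 0 7 t = 0" by (rule plateau_zero[OF N0]) (use that in auto)
      ultimately show ?thesis using z2[of t n] by (simp add: vn_def)
    qed
    have "energy q (vn n) \<le> energy q (trial' q)" unfolding energy_def
    proof (intro nn_integral_mono mult_left_mono ennreal_leI divide_right_mono)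
      fix t show "(vn n t)\<^sup>2 \<le> (trial' q t)\<^sup>2" using vb[of n t] by (intro power_mono) auto
    qed (use q in auto)
    then show "energy q (vn n) \<le> 1" using trial_energy[OF q] by (rule order_trans)
  qed (use vk wd wn0 n in auto)
qed

section \<open>Existence of the maximiser\<close>

text \<open>Diagonal extraction on the positive rationals; \<open>profile_holder\<close> then
  carries the Cauchy property from a rational s slightly below t to every t > 0.\<close>

lemma profile_subsequence:
  assumes q: "0 < q" "q \<le> 1" and prof: "\<And>n. profile q (w n) (w' n)"
  obtains k l where "strict_mono (k :: nat \<Rightarrow> nat)" "\<And>t. 0 < t \<Longrightarrow> (\<lambda>n. w (k n) t) \<longlonglongrightarrow> l t"
proof -
  define S where "S = {t :: real. t \<in> \<rat> \<and> 0 < t}"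
  have "countable S" unfolding S_def by (rule countable_subset[OF _ countable_rat]) auto
  \<comment> \<open>Division by 1 + t turns the growth bound into one common to all t, as the
    diagonal argument asks.\<close>
  moreover have "norm (w n t / (1 + t)) \<le> 1" if "t \<in> S" for n t
  proof -
    have t: "0 < t" using that by (simp add: S_def)
    have "\<bar>w n t\<bar> \<le> t powr (q / 2)" using profile_abs_le[OF q prof] t by simp
    also have "\<dots> \<le> (1 + t) powr (q / 2)" using t q by (intro powr_mono2) auto
    also have "\<dots> \<le> (1 + t) powr 1" using t q by (intro powr_mono) auto
    finally show ?thesis using t by (simp add: abs_divide divide_le_eq)
  qed
  ultimately obtain k where k: "strict_mono (k :: nat \<Rightarrow> nat)" "\<And>t. t \<in> S \<Longrightarrow> \<exists>l. (\<lambda>n. w (k n) t / (1 + t)) \<longlonglongrightarrow> l"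
    using function_convergent_subsequence[of S "\<lambda>n t. w n t / (1 + t)" 1] by blast
  have convS: "Cauchy (\<lambda>n. w (k n) t)" if t: "t \<in> S" for t
  proof -
    obtain l where "(\<lambda>n. w (k n) t / (1 + t)) \<longlonglongrightarrow> l" using k(2)[OF t] by blast
    then have "(\<lambda>n. (1 + t) * (w (k n) t / (1 + t))) \<longlonglongrightarrow> (1 + t) * l" by (intro tendsto_intros)
    moreover have "(1 + t) * (w (k n) t / (1 + t)) = w (k n) t" for n using t by (simp add: S_def)
    ultimately show ?thesis by (simp add: LIMSEQ_imp_Cauchy)
  qed
  have "convergent (\<lambda>n. w (k n) t)" if t: "0 < t" for t
  proof (rule Cauchy_convergent, rule metric_CauchyI)
    fix e :: real assume e: "0 < e"
    have "((\<lambda>s. t powr q - s powr q) \<longlongrightarrow> t powr q - t powr q) (at_left t)"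
      using t q by (intro tendsto_intros) auto
    then have "\<forall>\<^sub>F s in at_left t. t powr q - s powr q < (e / 3)\<^sup>2"
      by (rule order_tendstoD(2)) (use e in simp)
    then obtain b where b: "b < t" "\<And>s. b < s \<Longrightarrow> s < t \<Longrightarrow> t powr q - s powr q < (e / 3)\<^sup>2"
      by (auto simp: eventually_at_left_field)
    obtain s where s: "max b 0 < s" "s < t" "s \<in> \<rat>" using Rats_dense_in_real[of "max b 0" t] b t by auto
    then have sS: "s \<in> S" by (simp add: S_def)
    have close: "\<bar>w (k n) t - w (k n) s\<bar> < e / 3" for n
    proof -
      have "(w (k n) t - w (k n) s)\<^sup>2 \<le> t powr q - s powr q"
        using profile_holder[OF q prof, of s t] s by simp
      also have "\<dots> < (e / 3)\<^sup>2" using b(2) s by simp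
      finally show ?thesis using power_less_imp_less_base[of "\<bar>w (k n) t - w (k n) s\<bar>" 2 "e / 3"] e by simp
    qed
    obtain N where N: "\<And>m n. N \<le> m \<Longrightarrow> N \<le> n \<Longrightarrow> dist (w (k m) s) (w (k n) s) < e / 3"
      using metric_CauchyD[OF convS[OF sS], of "e / 3"] e by auto
    show "\<exists>N. \<forall>m\<ge>N. \<forall>n\<ge>N. dist (w (k m) t) (w (k n) t) < e"
    proof (intro exI allI impI)
      fix m n assume mn: "N \<le> m" "N \<le> n"
      show "dist (w (k m) t) (w (k n) t) < e"
        using N[OF mn] close[of m] close[of n] unfolding dist_real_def by argo
    qed
  qed
  then show ?thesis using that[of k "\<lambda>t. lim (\<lambda>n. w (k n) t)"] k(1) by (simp add: convergent_LIMSEQ_iff)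
qed

lemma represents_const:
  assumes \<beta>: "0 \<le> \<beta>" "\<beta> < 1" and f: "f \<in> test_functions"
  shows "represents \<beta> (\<lambda>_. f) f"
proof -
  have "test_norm \<beta> (\<lambda>x. 0 * f x + 0 * f x) \<le> \<bar>0\<bar> * test_norm \<beta> f + \<bar>0\<bar> * test_norm \<beta> f"
    by (rule test_norm_triangle[OF \<beta> f f])
  then have "test_norm \<beta> (\<lambda>x. f x - f x) = 0" using test_norm_nonneg[of \<beta> "\<lambda>x. 0"] by simp
  then show ?thesis using f test_integrable[OF f] by (simp add: represents_def)
qed

text \<open>Off the origin the function is 1 / norm x, which is integrable in the plane. It is
  written in terms of t = - 2 * ln (norm x) because exp (t / 2) serves to dominate the growth of
  profiles.\<close>

lemma exp_half_integrable: "integrable (lebesgue_on B) (\<lambda>x. exp (- 2 * ln (norm x) / 2))"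
proof (rule integrableI_nonneg)
  have [measurable]: "(\<lambda>x::real^2. exp (- 2 * ln (norm x) / 2)) \<in> borel_measurable borel" by measurable
  then show "(\<lambda>x::real^2. exp (- 2 * ln (norm x) / 2)) \<in> borel_measurable (lebesgue_on B)" by (rule borel_measurable_lebesgue_on)
  have "(\<integral>\<^sup>+x. ennreal (exp (- 2 * ln (norm x) / 2)) \<partial>lebesgue_on B) = (\<integral>\<^sup>+x. indicator B x * ennreal (exp (- 2 * ln (norm x) / 2)) \<partial>lborel)"
    by (rule nn_integral_lebesgue_on_B) measurable
  also have "\<dots> = ennreal pi * (\<integral>\<^sup>+t. indicator {0<..} t * (ennreal (exp (- t)) * ennreal (exp (t / 2))) \<partial>lborel)"
    by (rule nn_integral_ball_radial[of "\<lambda>t. ennreal (exp (t / 2))"]) measurable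
  also have "\<dots> \<le> ennreal pi * (\<integral>\<^sup>+t. ennreal (exp (- (1/2) * t)) * indicator {0..} t \<partial>lborel)"
    by (intro mult_left_mono nn_integral_mono) (auto simp: indicator_def ennreal_mult'[symmetric] simp flip: exp_add)
  also have "\<dots> < \<infinity>" by (subst nn_integral_exp_tail) (auto simp: ennreal_mult_less_top)
  finally show "(\<integral>\<^sup>+x. ennreal (exp (- 2 * ln (norm x) / 2)) \<partial>lebesgue_on B) < \<infinity>" .
qed simp

theorem theorem3:
  fixes \<beta> :: real
  assumes "0 \<le> \<beta>" and "\<beta> < 1"
  shows "\<exists>u\<^sub>\<beta>. u\<^sub>\<beta> \<in> H10_rad \<beta> \<and> H10_norm \<beta> u\<^sub>\<beta> \<le> 1 \<and>
    J \<beta> u\<^sub>\<beta> = (SUP u \<in> {u \<in> H10_rad \<beta>. H10_norm \<beta> u \<le> 1}. J \<beta> u)"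
proof -
  note \<beta> = assms
  define q where "q = 1 - \<beta>"
  have q: "0 < q" "q \<le> 1" using \<beta> by (auto simp: q_def)
  define c where "c = profile_scale \<beta>"
  have c: "0 < c" using profile_scale_pos \<beta> by (simp add: c_def)
  define S where "S = (SUP u \<in> {u \<in> H10_rad \<beta>. H10_norm \<beta> u \<le> 1}. J \<beta> u)"
  have SJ: "J \<beta> u \<le> S" if "u \<in> H10_rad \<beta>" "H10_norm \<beta> u \<le> 1" for u
    unfolding S_def by (rule SUP_upper) (use that in simp)
  \<comment> \<open>A smooth competitor lies strictly above the concentration level; the gap is what
    excludes the zero limit below.\<close>
  have S1: "ennreal (1 + exp 1) < S"
  proof -
    obtain v w a b where v: "\<And>k. D_k k v UNIV" "0 < a" "a < b" "\<And>t. t < a \<or> b < t \<Longrightarrow> v t = 0"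
      "\<And>t. (w has_real_derivative v t) (at t)" "w 0 = 0" "energy q v \<le> 1" "ennreal (1 + exp 1) < moser q w"
      by (rule sharp_smooth_profile[OF q]) (rule that)
    obtain f where f: "f \<in> test_functions" "\<And>x. x \<noteq> 0 \<Longrightarrow> f x = w (- 2 * ln (norm x)) / profile_scale \<beta>"
      "ennreal ((test_norm \<beta> f)\<^sup>2) = energy (1 - \<beta>) v"
      by (rule smooth_profile_test[OF \<beta> v(1-3) _ v(5,6)], erule v(4)) (rule that)
    have "ennreal ((test_norm \<beta> f)\<^sup>2) \<le> 1" using f(3) v(7) by (simp add: q_def)
    then have "(test_norm \<beta> f)\<^sup>2 \<le> 1\<^sup>2" by simp
    then have tn: "test_norm \<beta> f \<le> 1" by (rule power2_le_imp_le) simp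
    have "continuous_on UNIV w" by (rule DERIV_continuous_on[where D=v]) (use v(5) in simp)
    then have wm: "w \<in> borel_measurable borel" by (rule borel_measurable_continuous_onI)
    have "J \<beta> f = moser q w"
      unfolding q_def by (rule J_smooth_profile[OF \<beta> _ wm]) (rule f(2))
    moreover have "J \<beta> f \<le> S"
    proof (rule SJ)
      have "AE x in lebesgue_on B. f x = (\<lambda>r. w (- 2 * ln r) / profile_scale \<beta>) (norm x)"
        using AE_lebesgue_on_B_nonzero by eventually_elim (rule f(2))
      then have "\<exists>v. AE x in lebesgue_on B. f x = v (norm x)"
        by (rule exI[of _ "\<lambda>r. w (- 2 * ln r) / profile_scale \<beta>"])
      moreover have "f \<in> H10 \<beta>" using represents_const[OF \<beta> f(1)] unfolding H10_def by blast
      ultimately show "f \<in> H10_rad \<beta>" unfolding H10_rad_def by simp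
      have "H10_norm \<beta> f = test_norm \<beta> f"
        using LIMSEQ_unique[OF represents_norm_tendsto[OF \<beta> represents_const[OF \<beta> f(1)]] tendsto_const] .
      then show "H10_norm \<beta> f \<le> 1" using tn by simp
    qed
    ultimately show ?thesis using v(8) by simp
  qed
  \<comment> \<open>S may a priori be \<infinity>, so levels C n < S that tend to S index the
    maximising sequence.\<close>
  obtain C where C: "\<And>n. C n < S" "C \<longlonglongrightarrow> S"
    using approx_from_below_dense_linorder[OF S1] by blast
  have "\<exists>f. f \<in> test_functions \<and> test_norm \<beta> f \<le> 1 \<and> C n < moser q (mean_profile \<beta> f) \<and> L1_dist f (\<lambda>x. circle_mean f (norm x)) < 1 / real (Suc n)" for n
  proof -
    obtain u where u: "u \<in> H10_rad \<beta>" "H10_norm \<beta> u \<le> 1" "C n < J \<beta> u"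
      using C(1)[of n] unfolding S_def less_SUP_iff by blast
    show ?thesis unfolding q_def
      by (rule H10_rad_approx[OF \<beta> u, of "1 / real (Suc n)"]) (simp, blast)
  qed
  then obtain f where f: "\<And>n. f n \<in> test_functions" "\<And>n. test_norm \<beta> (f n) \<le> 1" "\<And>n. C n < moser q (mean_profile \<beta> (f n))"
    "\<And>n. L1_dist (f n) (\<lambda>x. circle_mean (f n) (norm x)) < 1 / real (Suc n)" by metis
  have prof: "profile q (mean_profile \<beta> (f n)) (mean_profile' \<beta> (f n))" for n
    unfolding q_def by (rule test_profile[OF \<beta> f(1,2)])
  obtain k l where k: "strict_mono (k :: nat \<Rightarrow> nat)" and l: "\<And>t. 0 < t \<Longrightarrow> (\<lambda>n. mean_profile \<beta> (f (k n)) t) \<longlonglongrightarrow> l t"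
    by (rule profile_subsequence[OF q prof]) (rule that)
  have Ck: "(\<lambda>n. C (k n)) \<longlonglongrightarrow> S" using LIMSEQ_subseq_LIMSEQ[OF C(2) k] by (simp add: o_def)
  \<comment> \<open>Convergence is known for t > 0 only; with the value 0 elsewhere W is a pointwise
    limit of Borel functions.\<close>
  define W where "W t = (if 0 < t then l t else 0)" for t
  have Wlim: "(\<lambda>n. indicator {0<..} t * mean_profile \<beta> (f (k n)) t) \<longlonglongrightarrow> W t" for t
    using l[of t] by (cases "0 < t") (auto simp: W_def)
  have pm [measurable]: "mean_profile \<beta> (f n) \<in> borel_measurable borel" for n by (rule profile_measurable[OF q prof])
  have Wm [measurable]: "W \<in> borel_measurable borel"
    by (rule borel_measurable_LIMSEQ_real[OF Wlim]) measurable
  have SW: "S \<le> moser q W"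
  proof (cases "\<exists>t>0. W t \<noteq> 0")
    case True
    then obtain t0 where t0: "0 < t0" "W t0 \<noteq> 0" by blast
    have "(\<lambda>n. moser q (mean_profile \<beta> (f (k n)))) \<longlonglongrightarrow> moser q W"
      by (rule moser_continuity[where w="\<lambda>n. mean_profile \<beta> (f (k n))" and w'="\<lambda>n. mean_profile' \<beta> (f (k n))" and v=W, OF q prof _ t0]) (use l in \<open>simp add: W_def\<close>)
    then show ?thesis
      by (rule LIMSEQ_le[OF Ck]) (use f(3) less_imp_le in blast)
  next
    case False
    \<comment> \<open>A level strictly between 1 + e and S: with a zero limit,
      \<open>moser_concentration\<close> would keep the functional, and hence S, at or below
      z.\<close>
    obtain z where z: "ennreal (1 + exp 1) < z" "z < S" using dense[OF S1] by blast
    then obtain r where r: "z = ennreal r" "0 \<le> r" by (cases z) auto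
    have "0 \<le> 1 + exp (1::real)" by (intro add_nonneg_nonneg) auto
    then have r1: "1 + exp 1 < r" using z(1) unfolding r(1) by (subst (asm) ennreal_less_iff) auto
    have "\<forall>\<^sub>F n in sequentially. moser q (mean_profile \<beta> (f (k n))) \<le> ennreal (1 + exp 1 + (r - (1 + exp 1)))"
    proof (rule moser_concentration[where w="\<lambda>n. mean_profile \<beta> (f (k n))" and w'="\<lambda>n. mean_profile' \<beta> (f (k n))", OF q prof])
      show "(\<lambda>n. mean_profile \<beta> (f (k n)) t) \<longlonglongrightarrow> 0" if "0 < t" for t
        using l[OF that] False that by (auto simp: W_def)
    qed (use r1 in simp)
    then have "\<forall>\<^sub>F n in sequentially. C (k n) \<le> z"
      by eventually_elim (use f(3) r(1) in \<open>force intro: less_imp_le less_le_trans\<close>)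
    then have "S \<le> z" by (intro tendsto_upperbound[OF Ck]) auto
    then show ?thesis using z(2) by simp
  qed
  define U where "U x = W (- 2 * ln (norm x)) / c" for x :: "real^2"
  have Um [measurable]: "U \<in> borel_measurable borel" unfolding U_def[abs_def] by measurable
  define g where "g n x = circle_mean (f (k n)) (norm x)" for n and x :: "real^2"
  have gm: "g n \<in> borel_measurable borel" for n
    unfolding g_def[abs_def] by (intro borel_measurable_continuous_onI circle_mean_norm_continuous f)
  have gi: "integrable (lebesgue_on B) (g n)" for n unfolding g_def[abs_def] by (intro circle_mean_norm_integrable f)
  \<comment> \<open>An integrable majorant of the circular means: by the growth bound the profiles
    are at most 1 + t, hence at most 2 * exp (t / 2).\<close>
  define D where "D x = 2 / c * exp (- 2 * ln (norm x) / 2)" for x :: "real^2"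
  have Di: "integrable (lebesgue_on B) D" unfolding D_def[abs_def] by (intro integrable_mult_right exp_half_integrable)
  have inB: "AE x in lebesgue_on B. x \<in> B \<and> x \<noteq> 0"
    using AE_lebesgue_on_B_nonzero AE_space by eventually_elim (simp add: space_restrict_space)
  have pt: "(\<lambda>n. g n x) \<longlonglongrightarrow> U x" "\<And>n. \<bar>g n x\<bar> \<le> D x" if x: "x \<in> B" "x \<noteq> 0" for x
  proof -
    define t where "t = - 2 * ln (norm x)"
    have t: "0 < t" using x by (simp add: t_def)
    have g: "g n x = mean_profile \<beta> (f (k n)) t / c" for n
      unfolding g_def t_def c_def by (rule circle_mean_mean_profile[OF \<beta>(2) x(2)])
    have "(\<lambda>n. mean_profile \<beta> (f (k n)) t / c) \<longlonglongrightarrow> l t / c" using c by (intro tendsto_intros l t) auto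
    then show "(\<lambda>n. g n x) \<longlonglongrightarrow> U x" using t unfolding g U_def t_def[symmetric] by (simp add: W_def)
    fix n
    have "\<bar>mean_profile \<beta> (f (k n)) t\<bar> \<le> t powr (q / 2)" using profile_abs_le[OF q prof] t by simp
    also have "\<dots> \<le> (1 + t) powr (q / 2)" using t q by (intro powr_mono2) auto
    also have "\<dots> \<le> (1 + t) powr 1" using t q by (intro powr_mono) auto
    also have "\<dots> = 1 + t" using t by simp
    also have "\<dots> \<le> 2 * exp (t / 2)"
    proof -
      have "1 + t / 2 \<le> exp (t / 2)" by (rule exp_ge_add_one_self)
      then show ?thesis by argo
    qed
    finally have "\<bar>mean_profile \<beta> (f (k n)) t\<bar> / c \<le> 2 * exp (t / 2) / c" using c by (intro divide_right_mono) auto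
    then show "\<bar>g n x\<bar> \<le> D x" using c unfolding g D_def t_def[symmetric] by (simp add: abs_divide)
  qed
  have Ul: "U \<in> borel_measurable (lebesgue_on B)" by (rule borel_measurable_lebesgue_on[OF Um])
  have UD: "\<bar>U x\<bar> \<le> D x" if "x \<in> B" "x \<noteq> 0" for x
    by (rule tendsto_upperbound[OF tendsto_rabs[OF pt(1)[OF that]]]) (use pt(2)[OF that] in auto)
  have Ui: "integrable (lebesgue_on B) U"
  proof (rule Bochner_Integration.integrable_bound[OF Di Ul])
    show "AE x in lebesgue_on B. norm (U x) \<le> norm (D x)"
      using inB by eventually_elim (use UD c in \<open>auto simp: D_def\<close>)
  qed
  have gU: "(\<lambda>n. L1_dist (g n) U) \<longlonglongrightarrow> 0"
  proof -
    have "(\<lambda>n. LINT x|lebesgue_on B. \<bar>g n x - U x\<bar>) \<longlonglongrightarrow> (LINT x|lebesgue_on B. 0)"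
    proof (rule integral_dominated_convergence[where w="\<lambda>x. 2 * D x"])
      show "AE x in lebesgue_on B. (\<lambda>n. \<bar>g n x - U x\<bar>) \<longlonglongrightarrow> 0"
        using inB
      proof eventually_elim
        case (elim x)
        then have "(\<lambda>n. g n x - U x) \<longlonglongrightarrow> U x - U x" by (intro tendsto_intros pt) auto
        then show ?case by (simp add: tendsto_rabs_zero_iff)
      qed
      show "AE x in lebesgue_on B. norm \<bar>g n x - U x\<bar> \<le> 2 * D x" for n
        using inB
      proof eventually_elim
        case (elim x)
        then have "\<bar>g n x\<bar> \<le> D x" "\<bar>U x\<bar> \<le> D x" using pt(2) UD by auto
        then show ?case by simp
      qed
      show "(\<lambda>x. \<bar>g n x - U x\<bar>) \<in> borel_measurable (lebesgue_on B)" for n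
        using borel_measurable_lebesgue_on[OF gm] Ul by measurable
    qed (use Di in auto)
    then show ?thesis by (simp add: L1_dist_def)
  qed
  \<comment> \<open>The means g n converge to U, and each f (k n) was chosen within 1 / Suc (k n) of
    its mean, so the test functions themselves approach U in L1.\<close>
  have approx: "\<exists>h\<in>test_functions. test_norm \<beta> h \<le> 1 \<and> L1_dist h U < e" if e: "0 < e" for e
  proof -
    have "(\<lambda>n. 1 / real (Suc (k n))) \<longlonglongrightarrow> 0"
      using LIMSEQ_subseq_LIMSEQ[OF LIMSEQ_Suc[OF lim_1_over_n] k] by (simp add: o_def)
    then have "(\<lambda>n. 1 / real (Suc (k n)) + L1_dist (g n) U) \<longlonglongrightarrow> 0 + 0" using gU by (rule tendsto_add)
    then have "\<forall>\<^sub>F n in sequentially. 1 / real (Suc (k n)) + L1_dist (g n) U < e"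
      by (rule order_tendstoD(2)) (use e in simp)
    then obtain n where n: "1 / real (Suc (k n)) + L1_dist (g n) U < e" using eventually_happens by fastforce
    have "L1_dist (f (k n)) U \<le> L1_dist (f (k n)) (g n) + L1_dist (g n) U"
      by (rule L1_dist_triangle[OF test_integrable[OF f(1)] gi Ui])
    moreover have "L1_dist (f (k n)) (g n) < 1 / real (Suc (k n))" using f(4)[of "k n"] by (simp add: g_def[abs_def])
    ultimately have "L1_dist (f (k n)) U < e" using n by linarith
    then show ?thesis using f(1,2) by blast
  qed
  have U: "U \<in> H10 \<beta>" "H10_norm \<beta> U \<le> 1"
    using H10_unit_ball_closed[OF \<beta> Ui approx] by auto
  have "AE x in lebesgue_on B. U x = (\<lambda>r. W (- 2 * ln r) / c) (norm x)" by (simp add: U_def)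
  then have "\<exists>v. AE x in lebesgue_on B. U x = v (norm x)"
    by (rule exI[of _ "\<lambda>r. W (- 2 * ln r) / c"])
  then have Ur: "U \<in> H10_rad \<beta>" using U(1) unfolding H10_rad_def by simp
  have "J \<beta> U = moser q W" unfolding U_def[abs_def] c_def q_def by (rule J_radial[OF \<beta>(2) Wm])
  then have "J \<beta> U = S" using SW SJ[OF Ur U(2)] by simp
  then show ?thesis using Ur U(2) unfolding S_def by blast
qed

end
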